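(* Let $\alpha,\beta>-1$. For each $n$ let $\ell_0^{(n)},\dots,\ell_{n-1}^{(n)}$ be the Lagrange basis polynomials for the $n$ Jacobi-Gauss-Radau points that are the roots of $(1-x)P_{n-1}^{(\alpha,\beta)}(x)$. Then $$\max_{0\le j\le n-1}\|\ell_j^{(n)}\|_\infty=\begin{cases} O\left(n^{-\min\{0,\alpha+\frac12,\alpha-\beta\}}\right),&-1<\alpha\le\frac12,\\ O\left(n^{-\min\{0,\frac12-\beta,\frac52-\alpha,\alpha-\beta\}}\right),&\alpha>\frac12. \end{cases}$$
   Context: $P_m^{(\alpha,\beta)}$ is the Jacobi polynomial of degree $m$ (orthogonal on $[-1,1]$ with respect to the weight $(1-t)^\alpha(1+t)^\beta$, normalized by $P_m^{(\alpha,\beta)}(1)=\binom{m+\alpha}{m}$); its $m$ roots are simple and lie in $(-1,1)$. For distinct nodes $x_0,\dots,x_{n-1}$ with $\omega_n(x)=\prod_i(x-x_i)$, the Lagrange basis polynomials are $\ell_k^{(n)}(x)=\frac{\omega_n(x)}{\omega_n'(x_k)(x-x_k)}$. $\|\cdot\|_\infty$ is the supremum norm on $[-1,1]$. The $O$-constants depend only on $\alpha,\beta$, and the asymptotics are as $n\to\infty$. *)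

theory Defs
  imports
    "HOL-Analysis.Analysis"
    "HOL-Computational_Algebra.Polynomial"
    "HOL-Library.Landau_Symbols"
begin

definition is_jacobi_poly :: "real \<Rightarrow> real \<Rightarrow> nat \<Rightarrow> real poly \<Rightarrow> bool" where
  "is_jacobi_poly \<alpha> \<beta> m p \<longleftrightarrow>
     degree p = m \<and>
     (\<forall>q. degree q < m \<longrightarrow>
        ((\<lambda>t. (1 - t) powr \<alpha> * (1 + t) powr \<beta> * poly p t * poly q t) has_integral 0) {-1..1}) \<and>
     poly p 1 = (real m + \<alpha>) gchoose m"

(* For \<alpha>, \<beta> > -1 exactly one polynomial satisfies the predicate. *)
definition jacobi_poly :: "real \<Rightarrow> real \<Rightarrow> nat \<Rightarrow> real poly" where
  "jacobi_poly \<alpha> \<beta> m = (THE p. is_jacobi_poly \<alpha> \<beta> m p)"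

definition nodal_poly :: "nat \<Rightarrow> (nat \<Rightarrow> real) \<Rightarrow> real poly" where
  "nodal_poly n x = (\<Prod>i<n. [:- x i, 1:])"

(* The division is the exact one of polynomials, so that the value at the node x k is the
   intended one and not that of a real division by zero. *)
definition lagrange_basis :: "nat \<Rightarrow> (nat \<Rightarrow> real) \<Rightarrow> nat \<Rightarrow> real poly" where
  "lagrange_basis n x k =
     smult (1 / poly (pderiv (nodal_poly n x)) (x k)) (nodal_poly n x div [:- x k, 1:])"

definition sup_norm :: "real poly \<Rightarrow> real" where
  "sup_norm p = (SUP t\<in>{-1..1}. \<bar>poly p t\<bar>)"

(* The n Gauss-Radau points, in any order; meant for n \<ge> 1. *)
definition radau_points :: "real \<Rightarrow> real \<Rightarrow> nat \<Rightarrow> (nat \<Rightarrow> real) \<Rightarrow> bool" where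
  "radau_points \<alpha> \<beta> n x \<longleftrightarrow>
     bij_betw x {..<n} {t. (1 - t) * poly (jacobi_poly \<alpha> \<beta> (n - 1)) t = 0}"

end

theory Submission
  imports Defs
begin

text \<open>The Jacobi polynomial \<open>p\<close> of degree \<open>m = n - 1\<close> solves a second order differential equation, and
  \<open>v \<theta> = sin (\<theta>/2) powr (\<alpha> + 1/2) * cos (\<theta>/2) powr (\<beta> + 1/2) * p (cos \<theta>)\<close> satisfies
  \<open>v'' + (n\<^sup>2 + O(n) + O(1 / sin\<^sup>2 \<theta>)) v = 0\<close>. Hence the logarithmic derivative of the energy
  \<open>v'\<^sup>2 + n\<^sup>2 v\<^sup>2\<close> is \<open>O(1 + 1 / (n sin\<^sup>2 \<theta>))\<close>, whose integral over \<open>[\<epsilon>/n, \<pi> - \<epsilon>/n]\<close> is bounded: up to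
  constants, the energy equals one number \<open>G\<^sup>2\<close> there. At a zero of \<open>p\<close> it is essentially \<open>p'\<^sup>2\<close>, elsewhere
  it bounds \<open>p\<^sup>2\<close>, and at distance \<open>\<epsilon>/n\<close> from the endpoints it is comparable to
  \<open>n powr (1 - 2 * \<alpha>) * p(1)\<^sup>2\<close> and \<open>n powr (1 - 2 * \<beta>) * p(-1)\<^sup>2\<close>, because the expansion of \<open>p\<close> at an
  endpoint is dominated by its constant term on that scale (which also keeps the zeros away from it).
  In each Lagrange basis polynomial \<open>G\<close> cancels, and only an inequality between powers of
  \<open>sin\<close> and \<open>cos\<close> of the half angles remains. It gives the exponent
  \<open>max {0, - 1/2 - \<alpha>, \<alpha> - 5/2, \<beta> - 1/2, \<beta> - \<alpha>}\<close>, which is the one in the statement in both cases.\<close>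

section \<open>The differential equation and the expansion at 1\<close>

text \<open>The definition by orthogonality says nothing about size, so \<open>jacobi_poly\<close>
  is reached from the other side: polynomial solutions of the equation come from a recursion, the
  self-adjoint form of the equation makes them orthogonal, and uniqueness identifies them. The cut
  at distance of order \<open>1 / n\<close> is forced from both sides: the integral of
  \<open>1 / (n * sin\<^sup>2 \<theta>)\<close> diverges at the endpoints, while the expansion at 1
  has the natural variable \<open>n\<^sup>2 * (1 - t)\<close>. The exponents record extreme
  positions of the evaluation angle \<theta> and the zero \<phi>. Both near 0: \<alpha> - 5/2 if
  \<theta> is the closer one, -1/2 - \<alpha> if \<phi> is. Both near \<open>pi\<close>: \<beta> -
  1/2, with \<theta> closer. With \<theta> near \<open>pi\<close> and \<phi> near 0: \<beta> -
  \<alpha>. The node 1 adds no further exponent.\<close>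

definition jacobi_eigenvalue :: "real \<Rightarrow> real \<Rightarrow> nat \<Rightarrow> real" where
  "jacobi_eigenvalue \<alpha> \<beta> m = real m * (real m + \<alpha> + \<beta> + 1)"

definition jacobi_ode :: "real \<Rightarrow> real \<Rightarrow> nat \<Rightarrow> real poly \<Rightarrow> bool" where
  "jacobi_ode \<alpha> \<beta> m p \<longleftrightarrow>
     (\<forall>t. (1 - t\<^sup>2) * poly (pderiv (pderiv p)) t + (\<beta> - \<alpha> - (\<alpha> + \<beta> + 2) * t) * poly (pderiv p) t
       + jacobi_eigenvalue \<alpha> \<beta> m * poly p t = 0)"

lemma reflect_at_one: "pcompose (pcompose p [:1, -1:]) [:1, -1:] = (p :: real poly)"
  by (simp add: pcompose_assoc[symmetric] pcompose_pCons)

text \<open>In the variable \<open>1 - t\<close> the endpoint 1 becomes a singular point at 0, and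
  the equation couples only neighbouring coefficients. The equivalence serves both ways: to control
  the coefficients of a solution and to construct one.\<close>

lemma jacobi_ode_coeffs_iff:
  "jacobi_ode \<alpha> \<beta> m p \<longleftrightarrow>
     (\<forall>k. 2 * (real k + 1) * (real k + \<alpha> + 1) * coeff (pcompose p [:1, -1:]) (Suc k)
        = (real k * (real k + \<alpha> + \<beta> + 1) - jacobi_eigenvalue \<alpha> \<beta> m) * coeff (pcompose p [:1, -1:]) k)"
proof -
  define r where "r = pcompose p [:1, -1:]"
  \<comment> \<open>\<open>R\<close> is the equation in \<open>y = 1 - t\<close>:
    \<open>1 - t\<^sup>2\<close> becomes \<open>2 * y - y\<^sup>2\<close>, and the chain rule
    changes the sign of the first derivative only.\<close>
  define R where "R = [:0, 2, -1:] * pderiv (pderiv r) + [:2 * \<alpha> + 2, - (\<alpha> + \<beta> + 2):] * pderiv r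
       + smult (jacobi_eigenvalue \<alpha> \<beta> m) r"
  have r1: "pderiv r = - pcompose (pderiv p) [:1, -1:]"
    by (simp add: r_def pderiv_pcompose pderiv_pCons)
  have r2: "pderiv (pderiv r) = pcompose (pderiv (pderiv p)) [:1, -1:]"
    by (simp add: r1 pderiv_minus pderiv_pcompose pderiv_pCons)
  have R: "poly R (1 - t) = (1 - t\<^sup>2) * poly (pderiv (pderiv p)) t
      + (\<beta> - \<alpha> - (\<alpha> + \<beta> + 2) * t) * poly (pderiv p) t + jacobi_eigenvalue \<alpha> \<beta> m * poly p t" for t
    unfolding R_def unfolding r2 unfolding r1 by (simp add: r_def poly_pcompose algebra_simps power2_eq_square)
  have "R = 0" if "jacobi_ode \<alpha> \<beta> m p"
  proof -
    have "poly R y = poly 0 y" for y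
      using R[of "1 - y"] that by (simp add: jacobi_ode_def)
    then show ?thesis using poly_eq_poly_eq_iff by blast
  qed
  then have "jacobi_ode \<alpha> \<beta> m p \<longleftrightarrow> R = 0"
    using R by (auto simp: jacobi_ode_def)
  moreover have "coeff R k = 2 * (real k + 1) * (real k + \<alpha> + 1) * coeff r (Suc k)
        - (real k * (real k + \<alpha> + \<beta> + 1) - jacobi_eigenvalue \<alpha> \<beta> m) * coeff r k" for k
  proof (cases k)
    case 0
    then show ?thesis by (simp add: R_def coeff_pderiv algebra_simps)
  next
    case (Suc j)
    show ?thesis
    proof (cases j)
      case 0
      then show ?thesis using Suc by (simp add: R_def coeff_pderiv algebra_simps)
    next
      case (Suc i)
      then show ?thesis using \<open>k = Suc j\<close>
        by (simp add: R_def coeff_pderiv algebra_simps)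
    qed
  qed
  ultimately show ?thesis
    unfolding r_def[symmetric] poly_eq_iff[of R] by simp
qed

text \<open>Transfers every fact about the endpoint 1 to -1, with \<alpha> and \<beta>
  exchanged.\<close>

lemma jacobi_ode_reflect:
  assumes "jacobi_ode \<alpha> \<beta> m p"
  shows "jacobi_ode \<beta> \<alpha> m (pcompose p [:0, -1:])"
  unfolding jacobi_ode_def
proof
  fix t
  define q where "q = pcompose p [:0, -1:]"
  have q1: "pderiv q = - pcompose (pderiv p) [:0, -1:]"
    by (simp add: q_def pderiv_pcompose pderiv_pCons)
  have q2: "pderiv (pderiv q) = pcompose (pderiv (pderiv p)) [:0, -1:]"
    by (simp add: q1 pderiv_minus pderiv_pcompose pderiv_pCons)
  have "jacobi_eigenvalue \<beta> \<alpha> m = jacobi_eigenvalue \<alpha> \<beta> m"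
    by (simp add: jacobi_eigenvalue_def algebra_simps)
  moreover have "(1 - (-t)\<^sup>2) * poly (pderiv (pderiv p)) (-t)
      + (\<beta> - \<alpha> - (\<alpha> + \<beta> + 2) * (-t)) * poly (pderiv p) (-t) + jacobi_eigenvalue \<alpha> \<beta> m * poly p (-t) = 0"
    using assms unfolding jacobi_ode_def by blast
  ultimately show "(1 - t\<^sup>2) * poly (pderiv (pderiv q)) t
      + (\<alpha> - \<beta> - (\<beta> + \<alpha> + 2) * t) * poly (pderiv q) t + jacobi_eigenvalue \<beta> \<alpha> m * poly q t = 0"
    unfolding q2 unfolding q1 by (simp add: q_def poly_pcompose algebra_simps)
qed

context
  fixes \<alpha> \<beta> :: real
  assumes \<alpha>: "\<alpha> > -1" and \<beta>: "\<beta> > -1"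
begin

text \<open>The factorization governs the recursion: \<open>real m - real k\<close> stops it after
  degree \<open>m\<close>, and for \<open>k < m\<close> both factors are positive, so successive
  coefficients have opposite signs.\<close>

lemma eigenvalue_diff:
  "real k * (real k + \<alpha> + \<beta> + 1) - jacobi_eigenvalue \<alpha> \<beta> m
     = - ((real m - real k) * (real m + real k + \<alpha> + \<beta> + 1))"
  by (simp add: jacobi_eigenvalue_def algebra_simps)

lemma eigenvalue_sum_pos: "k < m \<Longrightarrow> real m + real k + \<alpha> + \<beta> + 1 > 0"
  using \<alpha> \<beta> by (cases m) auto

lemma jacobi_eigenvalue_inj: "k \<noteq> m \<Longrightarrow> jacobi_eigenvalue \<alpha> \<beta> k \<noteq> jacobi_eigenvalue \<alpha> \<beta> m"
  using eigenvalue_diff[of k m] eigenvalue_sum_pos[of k m] eigenvalue_sum_pos[of m k]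
  by (cases "k < m") (auto simp: jacobi_eigenvalue_def)

lemma jacobi_ode_coeff_Suc:
  assumes "jacobi_ode \<alpha> \<beta> m p"
  shows "coeff (pcompose p [:1, -1:]) (Suc k)
     = - ((real m - real k) * (real m + real k + \<alpha> + \<beta> + 1) / (2 * (real k + 1) * (real k + \<alpha> + 1)))
         * coeff (pcompose p [:1, -1:]) k"
proof -
  have "2 * (real k + 1) * (real k + \<alpha> + 1) > 0" using \<alpha> by simp
  moreover have "2 * (real k + 1) * (real k + \<alpha> + 1) * coeff (pcompose p [:1, -1:]) (Suc k)
      = - ((real m - real k) * (real m + real k + \<alpha> + \<beta> + 1)) * coeff (pcompose p [:1, -1:]) k"
    using assms unfolding jacobi_ode_coeffs_iff eigenvalue_diff by blast
  ultimately show ?thesis by (simp add: field_simps)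
qed

lemma jacobi_ode_coeff_eq_0:
  assumes "jacobi_ode \<alpha> \<beta> m p" "m < k"
  shows "coeff (pcompose p [:1, -1:]) k = 0"
  using assms(2)
proof (induction k)
  case (Suc k)
  then show ?case unfolding jacobi_ode_coeff_Suc[OF assms(1), of k] by (cases "k = m") auto
qed simp

lemma poly_altdef_le: "degree (p :: real poly) \<le> n \<Longrightarrow> poly p x = (\<Sum>i\<le>n. coeff p i * x ^ i)"
  unfolding poly_altdef by (rule sum.mono_neutral_left) (auto simp: coeff_eq_0)

lemma poly_reflect_expand:
  assumes "jacobi_ode \<alpha> \<beta> m p"
  shows "poly p t = (\<Sum>k\<le>m. coeff (pcompose p [:1, -1:]) k * (1 - t) ^ k)"
    and "poly (pderiv p) t = - (\<Sum>k<m. real (Suc k) * coeff (pcompose p [:1, -1:]) (Suc k) * (1 - t) ^ k)"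
proof -
  define r where "r = pcompose p [:1, -1:]"
  have p: "p = pcompose r [:1, -1:]" by (simp add: r_def reflect_at_one)
  have deg: "degree r \<le> m"
    using jacobi_ode_coeff_eq_0[OF assms] by (intro degree_le) (auto simp: r_def)
  have "poly p t = poly r (1 - t)" by (simp add: p poly_pcompose)
  also have "\<dots> = (\<Sum>k\<le>m. coeff r k * (1 - t) ^ k)"
    using deg by (simp add: poly_altdef_le)
  finally show "poly p t = (\<Sum>k\<le>m. coeff (pcompose p [:1, -1:]) k * (1 - t) ^ k)"
    by (simp add: r_def)
  have "poly (pderiv p) t = - poly (pderiv r) (1 - t)"
    by (simp add: p pderiv_pcompose poly_pcompose pderiv_pCons)
  also have "poly (pderiv r) (1 - t) = (\<Sum>k<m. coeff (pderiv r) k * (1 - t) ^ k)"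
  proof (cases m)
    case 0
    then have "pderiv r = 0" using deg by (simp add: pderiv_eq_0_iff)
    then show ?thesis using 0 by simp
  next
    case (Suc l)
    have "degree (pderiv r) \<le> l" using deg Suc by (simp add: degree_pderiv)
    then show ?thesis using Suc by (simp add: poly_altdef_le lessThan_Suc_atMost)
  qed
  finally show "poly (pderiv p) t
      = - (\<Sum>k<m. real (Suc k) * coeff (pcompose p [:1, -1:]) (Suc k) * (1 - t) ^ k)"
    by (simp add: coeff_pderiv r_def)
qed

lemma coeff_0_reflect: "coeff (pcompose p [:1, -1:]) 0 = poly p (1::real)"
  by simp

text \<open>Beyond the endpoint all the terms of the expansion in powers of \<open>1 - t\<close> have the same sign.\<close>

lemma jacobi_ode_ge_1:
  assumes "jacobi_ode \<alpha> \<beta> m p" "t \<ge> 1"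
  shows "\<bar>poly p 1\<bar> \<le> \<bar>poly p t\<bar>"
proof -
  define r where "r = pcompose p [:1, -1:]"
  \<comment> \<open>The factor \<open>coeff r 0\<close>, which is \<open>poly p 1\<close>, fixes the
    common sign of the terms without a case distinction.\<close>
  have pos: "coeff r k * (1 - t) ^ k * coeff r 0 \<ge> 0" if "k \<le> m" for k
    using that
  proof (induction k)
    case (Suc k)
    define f where "f = (real m - real k) * (real m + real k + \<alpha> + \<beta> + 1) / (2 * (real k + 1) * (real k + \<alpha> + 1))"
    have "f \<ge> 0" unfolding f_def using Suc.prems eigenvalue_sum_pos[of k m] \<alpha> by simp
    have "coeff r (Suc k) * (1 - t) ^ Suc k * coeff r 0
        = (f * (t - 1)) * (coeff r k * (1 - t) ^ k * coeff r 0)"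
      unfolding r_def jacobi_ode_coeff_Suc[OF assms(1), of k] f_def[symmetric] by (simp add: algebra_simps)
    also have "\<dots> \<ge> 0"
      using Suc \<open>f \<ge> 0\<close> assms(2) by simp
    finally show ?case .
  qed simp
  have "poly p t * coeff r 0 = (\<Sum>k\<le>m. coeff r k * (1 - t) ^ k * coeff r 0)"
    unfolding poly_reflect_expand(1)[OF assms(1), of t] r_def[symmetric] by (rule sum_distrib_right)
  also have "\<dots> \<ge> (\<Sum>k\<in>{0}. coeff r k * (1 - t) ^ k * coeff r 0)"
    by (rule sum_mono2) (auto simp: pos)
  finally have "poly p t * poly p 1 \<ge> (poly p 1)\<^sup>2"
    by (simp add: r_def coeff_0_reflect power2_eq_square)
  then have "\<bar>poly p 1\<bar> * \<bar>poly p 1\<bar> \<le> \<bar>poly p t\<bar> * \<bar>poly p 1\<bar>"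
    by (simp add: power2_eq_square abs_mult[symmetric])
  then show ?thesis
    using mult_right_le_imp_le[of "\<bar>poly p 1\<bar>" "\<bar>poly p 1\<bar>"] by (cases "poly p 1 = 0") auto
qed

lemma jacobi_ode_at_1:
  assumes "jacobi_ode \<alpha> \<beta> m p" "p \<noteq> 0"
  shows "poly p 1 \<noteq> 0"
proof
  assume "poly p 1 = 0"
  then have "coeff (pcompose p [:1, -1:]) k = 0" for k
  proof (induction k)
    case (Suc k)
    then show ?case unfolding jacobi_ode_coeff_Suc[OF assms(1), of k] by simp
  qed (simp add: coeff_0_reflect)
  then have "pcompose p [:1, -1:] = 0" by (simp add: poly_eq_iff)
  then show False using assms(2) reflect_at_one[of p] by simp
qed

text \<open>Bounds the factor between successive coefficients after division by
  \<open>(m + 1)\<^sup>2\<close>. The summand 1 makes it at least 1, which later keeps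
  \<open>edge_eps\<close> at most 1/2.\<close>

definition edge_const :: real where
  "edge_const = 1 + (3 + \<bar>\<alpha> + \<beta>\<bar>) / (2 * (\<alpha> + 1))"

lemma edge_const_ge_1: "edge_const \<ge> 1"
  using \<alpha> by (simp add: edge_const_def)

lemma jacobi_ode_coeff_bound:
  assumes "jacobi_ode \<alpha> \<beta> m p"
  shows "\<bar>coeff (pcompose p [:1, -1:]) k\<bar> \<le> (edge_const * (real (Suc m))\<^sup>2) ^ k * \<bar>poly p 1\<bar>"
proof (induction k)
  case 0
  then show ?case by (simp add: coeff_0_reflect)
next
  case (Suc k)
  define f where "f = (real m - real k) * (real m + real k + \<alpha> + \<beta> + 1) / (2 * (real k + 1) * (real k + \<alpha> + 1))"
  have E: "edge_const * (real (Suc m))\<^sup>2 \<ge> 0" using edge_const_ge_1 by simp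
  show ?case
  proof (cases "k < m")
    case True
    have "(real m - real k) * (real m + real k + \<alpha> + \<beta> + 1) \<le> real (Suc m) * ((3 + \<bar>\<alpha> + \<beta>\<bar>) * real (Suc m))"
    proof (rule mult_mono)
      have "real m + real k + \<alpha> + \<beta> + 1 \<le> 2 * real (Suc m) + \<bar>\<alpha> + \<beta>\<bar> * 1"
        using True by simp
      also have "\<dots> \<le> 2 * real (Suc m) + \<bar>\<alpha> + \<beta>\<bar> * real (Suc m)"
        by (intro add_left_mono mult_left_mono) auto
      also have "\<dots> \<le> (3 + \<bar>\<alpha> + \<beta>\<bar>) * real (Suc m)" by (simp add: algebra_simps)
      finally show "real m + real k + \<alpha> + \<beta> + 1 \<le> (3 + \<bar>\<alpha> + \<beta>\<bar>) * real (Suc m)" .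
    qed (use eigenvalue_sum_pos[OF True] in auto)
    then have "f \<le> (real (Suc m) * ((3 + \<bar>\<alpha> + \<beta>\<bar>) * real (Suc m))) / (2 * (\<alpha> + 1))"
      unfolding f_def
    proof (rule frac_le[rotated 1])
      have "(\<alpha> + 1) * 1 \<le> (real k + \<alpha> + 1) * (real k + 1)"
        using \<alpha> by (intro mult_mono) auto
      then show "2 * (\<alpha> + 1) \<le> 2 * (real k + 1) * (real k + \<alpha> + 1)" by (simp add: algebra_simps)
    qed (use \<alpha> in auto)
    also have "\<dots> \<le> edge_const * (real (Suc m))\<^sup>2"
      using \<alpha> by (simp add: edge_const_def power2_eq_square algebra_simps)
    finally have "f \<le> edge_const * (real (Suc m))\<^sup>2" .
    moreover have "f \<ge> 0"
      unfolding f_def using True eigenvalue_sum_pos[OF True] \<alpha> by simp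
    ultimately have "\<bar>f\<bar> * \<bar>coeff (pcompose p [:1, -1:]) k\<bar>
        \<le> (edge_const * (real (Suc m))\<^sup>2) * ((edge_const * (real (Suc m))\<^sup>2) ^ k * \<bar>poly p 1\<bar>)"
      using Suc.IH E by (intro mult_mono) auto
    then show ?thesis
      unfolding jacobi_ode_coeff_Suc[OF assms, of k] f_def[symmetric] abs_mult
      by (simp add: mult_ac)
  next
    case False
    then show ?thesis using jacobi_ode_coeff_eq_0[OF assms, of "Suc k"] E by simp
  qed
qed

lemma geometric_sum_le_2:
  fixes c :: real
  assumes "0 \<le> c" "c \<le> 1/2"
  shows "(\<Sum>k<m. c ^ k) \<le> 2"
proof -
  have "(\<Sum>k<m. c ^ k) \<le> 2 - 2 * c ^ m"
  proof (induction m)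
    case (Suc m)
    moreover have "c * c ^ m \<le> 1/2 * c ^ m" using assms by (intro mult_right_mono) auto
    ultimately show ?case by simp
  qed simp
  also have "\<dots> \<le> 2" using assms by simp
  finally show ?thesis .
qed

text \<open>On this radius the terms decay like \<open>(1/4) ^ k\<close>, so all terms after the
  constant one sum to at most half of it. In the derivative \<open>Suc k \<le> 2 ^ k\<close> leaves
  a decay like \<open>(1/2) ^ k\<close>. The 4 in the radius serves both.\<close>

lemma jacobi_ode_edge:
  assumes "jacobi_ode \<alpha> \<beta> m p"
    and t: "t \<le> 1" "1 - t \<le> 1 / (4 * edge_const * (real (Suc m))\<^sup>2)"
  shows "\<bar>poly p t - poly p 1\<bar> \<le> \<bar>poly p 1\<bar> / 2"
    and "\<bar>poly (pderiv p) t\<bar> \<le> 2 * edge_const * (real (Suc m))\<^sup>2 * \<bar>poly p 1\<bar>"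
proof -
  define r where "r = pcompose p [:1, -1:]"
  define K where "K = edge_const * (real (Suc m))\<^sup>2"
  have K: "K > 0" using edge_const_ge_1 by (simp add: K_def)
  have y: "K * (1 - t) \<le> 1 / 4" "K * (1 - t) \<ge> 0"
  proof -
    have "1 - t \<le> 1 / (4 * K)" using t by (simp add: K_def mult.assoc)
    then show "K * (1 - t) \<le> 1 / 4" using K by (simp add: field_simps)
    show "K * (1 - t) \<ge> 0" using K t by simp
  qed
  have b: "\<bar>coeff r k\<bar> \<le> K ^ k * \<bar>poly p 1\<bar>" for k
    using jacobi_ode_coeff_bound[OF assms(1), of k] by (simp add: r_def K_def)
  have pw: "(K * (1 - t)) ^ k \<le> (1 / 4) ^ k" for k
    by (rule power_mono) (use y in auto)
  have "poly p t - poly p 1 = (\<Sum>k<m. coeff r (Suc k) * (1 - t) ^ Suc k)"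
    unfolding poly_reflect_expand(1)[OF assms(1), of t] r_def[symmetric] sum.atMost_shift
    by (simp add: r_def)
  also have "\<bar>\<dots>\<bar> \<le> (\<Sum>k<m. (1 / 4) ^ Suc k * \<bar>poly p 1\<bar>)"
  proof (rule order_trans[OF sum_abs sum_mono])
    fix k
    have "\<bar>coeff r (Suc k) * (1 - t) ^ Suc k\<bar> = \<bar>coeff r (Suc k)\<bar> * (1 - t) ^ Suc k"
      using t by (simp add: abs_mult)
    also have "\<dots> \<le> (K ^ Suc k * \<bar>poly p 1\<bar>) * (1 - t) ^ Suc k"
      by (rule mult_right_mono[OF b]) (use t in simp)
    also have "\<dots> = (K * (1 - t)) ^ Suc k * \<bar>poly p 1\<bar>" by (simp add: power_mult_distrib)
    also have "\<dots> \<le> (1 / 4) ^ Suc k * \<bar>poly p 1\<bar>" by (rule mult_right_mono[OF pw]) simp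
    finally show "\<bar>coeff r (Suc k) * (1 - t) ^ Suc k\<bar> \<le> (1 / 4) ^ Suc k * \<bar>poly p 1\<bar>" .
  qed
  also have "\<dots> = (\<Sum>k<m. (1 / 4) ^ k) / 4 * \<bar>poly p 1\<bar>"
    by (simp add: sum_divide_distrib sum_distrib_right)
  also have "\<dots> \<le> 2 / 4 * \<bar>poly p 1\<bar>"
    by (intro mult_right_mono divide_right_mono geometric_sum_le_2) auto
  finally show "\<bar>poly p t - poly p 1\<bar> \<le> \<bar>poly p 1\<bar> / 2" by simp

  have "\<bar>poly (pderiv p) t\<bar> \<le> (\<Sum>k<m. (1 / 2) ^ k * (K * \<bar>poly p 1\<bar>))"
    unfolding poly_reflect_expand(2)[OF assms(1)] r_def[symmetric] abs_minus_cancel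
  proof (rule order_trans[OF sum_abs sum_mono])
    fix k
    have "\<bar>real (Suc k) * coeff r (Suc k) * (1 - t) ^ k\<bar>
        = real (Suc k) * \<bar>coeff r (Suc k)\<bar> * (1 - t) ^ k"
      using t by (simp add: abs_mult)
    also have "\<dots> \<le> 2 ^ k * (K ^ Suc k * \<bar>poly p 1\<bar>) * (1 - t) ^ k"
    proof (intro mult_right_mono mult_mono b)
      have "Suc k \<le> 2 ^ k" by (induction k) auto
      then show "real (Suc k) \<le> 2 ^ k" by (metis of_nat_le_iff of_nat_numeral of_nat_power)
    qed (use t in auto)
    also have "\<dots> = (K * (1 - t)) ^ k * (2 ^ k * (K * \<bar>poly p 1\<bar>))"
      by (simp add: power_mult_distrib)
    also have "\<dots> \<le> (1 / 4) ^ k * (2 ^ k * (K * \<bar>poly p 1\<bar>))"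
      by (rule mult_right_mono[OF pw]) (use K in simp)
    also have "\<dots> = (1 / 2) ^ k * (K * \<bar>poly p 1\<bar>)"
    proof -
      have "(1 / 4) ^ k * 2 ^ k = (1 / 2 :: real) ^ k"
        unfolding power_mult_distrib[symmetric] by simp
      then show ?thesis by (simp add: mult.assoc[symmetric])
    qed
    finally show "\<bar>real (Suc k) * coeff r (Suc k) * (1 - t) ^ k\<bar> \<le> (1 / 2) ^ k * (K * \<bar>poly p 1\<bar>)" .
  qed
  also have "\<dots> = (\<Sum>k<m. (1 / 2) ^ k) * (K * \<bar>poly p 1\<bar>)" by (simp add: sum_distrib_right)
  also have "\<dots> \<le> 2 * (K * \<bar>poly p 1\<bar>)"
    by (intro mult_right_mono geometric_sum_le_2) (use K in auto)
  finally show "\<bar>poly (pderiv p) t\<bar> \<le> 2 * edge_const * (real (Suc m))\<^sup>2 * \<bar>poly p 1\<bar>"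
    by (simp add: K_def mult_ac)
qed

end

section \<open>Orthogonality and uniqueness\<close>

definition jacobi_orth :: "real \<Rightarrow> real \<Rightarrow> nat \<Rightarrow> real poly \<Rightarrow> bool" where
  "jacobi_orth \<alpha> \<beta> m p \<longleftrightarrow> (\<forall>q. degree q < m \<longrightarrow>
        ((\<lambda>t. (1 - t) powr \<alpha> * (1 + t) powr \<beta> * poly p t * poly q t) has_integral 0) {-1..1})"

text \<open>Lagrange's identity: the powers \<open>\<alpha> + 1\<close> and
  \<open>\<beta> + 1\<close> form the integrating factor of the self-adjoint form, so the
  first-order terms cancel and only the difference of the eigenvalues survives.\<close>

lemma has_vector_derivative_wronskian:
  assumes p: "jacobi_ode \<alpha> \<beta> m p" and q: "jacobi_ode \<alpha> \<beta> k q" and t: "-1 < t" "t < 1"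
  shows "((\<lambda>t. (1 - t) powr (\<alpha> + 1) * (1 + t) powr (\<beta> + 1) *
             (poly (pderiv p) t * poly q t - poly p t * poly (pderiv q) t)) has_vector_derivative
           (jacobi_eigenvalue \<alpha> \<beta> k - jacobi_eigenvalue \<alpha> \<beta> m) *
              ((1 - t) powr \<alpha> * (1 + t) powr \<beta> * poly p t * poly q t)) (at t)"
proof -
  define W where "W = (1 - t) powr \<alpha> * (1 + t) powr \<beta>"
  define Q where "Q = poly (pderiv p) t * poly q t - poly p t * poly (pderiv q) t"
  have a: "(1 - t) powr (\<alpha> + 1) = (1 - t) powr \<alpha> * (1 - t)"
    and b: "(1 + t) powr (\<beta> + 1) = (1 + t) powr \<beta> * (1 + t)"
    using t by (simp_all add: powr_add)
  have pt: "(1 - t\<^sup>2) * poly (pderiv (pderiv p)) t = - (\<beta> - \<alpha> - (\<alpha> + \<beta> + 2) * t) * poly (pderiv p) t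
      - jacobi_eigenvalue \<alpha> \<beta> m * poly p t"
    and qt: "(1 - t\<^sup>2) * poly (pderiv (pderiv q)) t = - (\<beta> - \<alpha> - (\<alpha> + \<beta> + 2) * t) * poly (pderiv q) t
      - jacobi_eigenvalue \<alpha> \<beta> k * poly q t"
    using p q unfolding jacobi_ode_def by (smt (verit) mult_minus_left)+
  have "W * (((\<beta> - \<alpha>) - (\<alpha> + \<beta> + 2) * t) * Q
        + (((1 - t\<^sup>2) * poly (pderiv (pderiv p)) t) * poly q t
          - poly p t * ((1 - t\<^sup>2) * poly (pderiv (pderiv q)) t)))
      = (jacobi_eigenvalue \<alpha> \<beta> k - jacobi_eigenvalue \<alpha> \<beta> m) * (W * poly p t * poly q t)"
    unfolding pt qt Q_def by (simp add: algebra_simps)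
  moreover have "((\<lambda>t. (1 - t) powr (\<alpha> + 1) * (1 + t) powr (\<beta> + 1) *
             (poly (pderiv p) t * poly q t - poly p t * poly (pderiv q) t)) has_real_derivative
           (- ((\<alpha> + 1) * (1 - t) powr \<alpha> * ((1 + t) powr \<beta> * (1 + t)))
              + (1 - t) powr \<alpha> * (1 - t) * ((\<beta> + 1) * (1 + t) powr \<beta>)) * Q
           + (1 - t) powr \<alpha> * (1 - t) * ((1 + t) powr \<beta> * (1 + t)) *
             (poly (pderiv (pderiv p)) t * poly q t - poly p t * poly (pderiv (pderiv q)) t)) (at t)"
    using t
    by (auto intro!: derivative_eq_intros simp: Q_def a b) (simp add: algebra_simps)
  ultimately show ?thesis
    unfolding has_real_derivative_iff_has_vector_derivative[symmetric]
    by (elim DERIV_cong) (simp add: W_def Q_def algebra_simps power2_eq_square)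
qed

context
  fixes \<alpha> \<beta> :: real
  assumes \<alpha>: "\<alpha> > -1" and \<beta>: "\<beta> > -1"
begin

text \<open>Lagrange's identity integrated; the boundary terms vanish because
  \<open>\<alpha> + 1\<close> and \<open>\<beta> + 1\<close> are positive. For negative \<alpha> or
  \<beta> the integrand may blow up at an endpoint, hence the fundamental theorem with derivatives
  in the interior only.\<close>

lemma jacobi_ode_orthogonal:
  assumes p: "jacobi_ode \<alpha> \<beta> m p" and q: "jacobi_ode \<alpha> \<beta> k q" and "k \<noteq> m"
  shows "((\<lambda>t. (1 - t) powr \<alpha> * (1 + t) powr \<beta> * poly p t * poly q t) has_integral 0) {-1..1}"
proof -
  define F where "F = (\<lambda>t. (1 - t) powr (\<alpha> + 1) * (1 + t) powr (\<beta> + 1) *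
             (poly (pderiv p) t * poly q t - poly p t * poly (pderiv q) t))"
  define d where "d = jacobi_eigenvalue \<alpha> \<beta> k - jacobi_eigenvalue \<alpha> \<beta> m"
  have "d \<noteq> 0" using jacobi_eigenvalue_inj[OF \<alpha> \<beta> \<open>k \<noteq> m\<close>] by (simp add: d_def)
  have "((\<lambda>t. d * ((1 - t) powr \<alpha> * (1 + t) powr \<beta> * poly p t * poly q t)) has_integral (F 1 - F (-1))) {-1..1}"
  proof (rule fundamental_theorem_of_calculus_interior)
    show "continuous_on {-1..1} F"
      unfolding F_def using \<alpha> \<beta> by (intro continuous_intros continuous_on_powr') auto
    show "(F has_vector_derivative d * ((1 - t) powr \<alpha> * (1 + t) powr \<beta> * poly p t * poly q t)) (at t)"
      if "t \<in> {-1<..<1}" for t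
      using has_vector_derivative_wronskian[OF p q, of t] that by (simp add: F_def d_def)
  qed simp
  moreover have "F 1 = 0" "F (-1) = 0" by (simp_all add: F_def)
  ultimately have "((\<lambda>t. inverse d * (d * ((1 - t) powr \<alpha> * (1 + t) powr \<beta> * poly p t * poly q t)))
      has_integral (inverse d * 0)) {-1..1}"
    by (intro has_integral_mult_right) simp
  then show ?thesis using \<open>d \<noteq> 0\<close> by (simp add: mult.assoc[symmetric])
qed

lemma jacobi_ode_exists: "\<exists>p. jacobi_ode \<alpha> \<beta> m p \<and> degree p = m \<and> poly p 1 = 1"
proof -
  \<comment> \<open>Products of the ratios that the recursion prescribes; the factor at
    \<open>i = m\<close> makes \<open>a k\<close> vanish for \<open>k > m\<close>.\<close>
  define a where "a k = (\<Prod>i<k. - ((real m - real i) * (real m + real i + \<alpha> + \<beta> + 1)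
    / (2 * (real i + 1) * (real i + \<alpha> + 1))))" for k
  define r where "r = (\<Sum>k\<le>m. monom (a k) k)"
  define p where "p = pcompose r [:1, -1:]"
  have a0: "a k = 0" if "m < k" for k
    unfolding a_def by (rule prod_zero) (use that in auto)
  have coeff: "coeff r k = a k" for k
    by (cases "k \<le> m") (auto simp: r_def coeff_sum sum.delta' a0 not_le)
  have pr: "pcompose p [:1, -1:] = r" by (simp add: p_def reflect_at_one)
  have "jacobi_ode \<alpha> \<beta> m p"
    unfolding jacobi_ode_coeffs_iff pr coeff eigenvalue_diff[OF \<alpha> \<beta>]
  proof
    fix k
    have "real k + \<alpha> + 1 \<noteq> 0" "real k + 1 \<noteq> 0" using \<alpha> by auto
    then show "2 * (real k + 1) * (real k + \<alpha> + 1) * a (Suc k)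
        = - ((real m - real k) * (real m + real k + \<alpha> + \<beta> + 1)) * a k"
      by (simp add: a_def)
  qed
  moreover have "a m \<noteq> 0"
  proof -
    have "- ((real m - real i) * (real m + real i + \<alpha> + \<beta> + 1)
      / (2 * (real i + 1) * (real i + \<alpha> + 1))) \<noteq> 0" if "i < m" for i
    proof -
      have "real i + \<alpha> + 1 > 0" "real m - real i > 0" using \<alpha> that by auto
      then show ?thesis using eigenvalue_sum_pos[OF \<alpha> \<beta> that] by simp
    qed
    then show ?thesis unfolding a_def by simp
  qed
  then have "degree r = m"
    by (intro antisym degree_le le_degree) (auto simp: coeff a0)
  then have "degree p = m" by (simp add: p_def degree_pcompose)
  moreover have "poly p 1 = 1"
    by (simp add: p_def poly_pcompose poly_0_coeff_0 coeff a_def)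
  ultimately show ?thesis by blast
qed

text \<open>The solutions of degrees below \<open>m\<close> span the test polynomials: subtracting a
  multiple of the solution of the same degree lowers the degree of \<open>q\<close>.\<close>

lemma jacobi_ode_imp_orth:
  assumes p: "jacobi_ode \<alpha> \<beta> m p"
  shows "jacobi_orth \<alpha> \<beta> m p"
  unfolding jacobi_orth_def
proof (intro allI impI)
  fix q :: "real poly"
  assume "degree q < m"
  then show "((\<lambda>t. (1 - t) powr \<alpha> * (1 + t) powr \<beta> * poly p t * poly q t) has_integral 0) {-1..1}"
  proof (induction "degree q" arbitrary: q rule: less_induct)
    case less
    show ?case
    proof (cases "q = 0")
      case False
      define k where "k = degree q"
      obtain e where e: "jacobi_ode \<alpha> \<beta> k e" "degree e = k" "poly e 1 = 1"
        using jacobi_ode_exists by blast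
      then have "e \<noteq> 0" by auto
      define c where "c = lead_coeff q / lead_coeff e"
      define s where "s = q - smult c e"
      have "coeff e k \<noteq> 0" using e(2) \<open>e \<noteq> 0\<close> by auto
      then have s: "coeff s k = 0" by (simp add: s_def c_def e(2) k_def[symmetric])
      have "degree s \<le> k"
        unfolding s_def by (rule degree_diff_le) (auto simp: k_def e(2)[unfolded k_def] intro: order_trans[OF degree_smult_le])
      have split: "q = s + smult c e" by (simp add: s_def)
      have e0: "((\<lambda>t. (1 - t) powr \<alpha> * (1 + t) powr \<beta> * poly p t * poly e t) has_integral 0) {-1..1}"
        by (rule jacobi_ode_orthogonal[OF p e(1)]) (use less.prems k_def in auto)
      have s0: "((\<lambda>t. (1 - t) powr \<alpha> * (1 + t) powr \<beta> * poly p t * poly s t) has_integral 0) {-1..1}"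
      proof (cases "s = 0")
        case False
        then have "degree s < k" using s \<open>degree s \<le> k\<close>
          by (metis leading_coeff_0_iff le_neq_implies_less)
        then show ?thesis using less.hyps[of s] less.prems by (simp add: k_def)
      qed simp
      have "((\<lambda>t. (1 - t) powr \<alpha> * (1 + t) powr \<beta> * poly p t * poly s t
          + c * ((1 - t) powr \<alpha> * (1 + t) powr \<beta> * poly p t * poly e t)) has_integral (0 + c * 0)) {-1..1}"
        by (intro has_integral_add has_integral_mult_right s0 e0)
      then show ?thesis
        by (subst split) (simp add: algebra_simps)
    qed simp
  qed
qed

lemma jacobi_orth_self:
  assumes "jacobi_orth \<alpha> \<beta> m d" "degree d < m"
  shows "d = 0"
proof (rule ccontr)
  assume "d \<noteq> 0"
  define f where "f = (\<lambda>t. (1 - t) powr \<alpha> * (1 + t) powr \<beta> * poly d t * poly d t)"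
  have f0: "(f has_integral 0) {-1..1}"
    using assms unfolding f_def jacobi_orth_def by blast
  have nonneg: "f t \<ge> 0" for t
    by (simp add: f_def mult.assoc)
  \<comment> \<open>The interval stays away from the endpoints, where the weight may be
    discontinuous; vanishing there already gives infinitely many zeros.\<close>
  have cont: "continuous_on {0..1/2} f"
    unfolding f_def by (intro continuous_intros) auto
  then obtain i where i: "(f has_integral i) {0..1/2}"
    using integrable_continuous_interval by blast
  have "i \<le> 0" by (rule has_integral_subset_le[OF _ i f0]) (auto simp: nonneg)
  moreover have "i \<ge> 0" by (rule has_integral_nonneg[OF i]) (auto simp: nonneg)
  ultimately have "(f has_integral 0) (cbox 0 (1/2))" using i by simp
  then have "f t = 0" if "t \<in> cbox 0 (1/2)" for t
    by (rule has_integral_0_cbox_imp_0[rotated 2]) (use cont nonneg that in auto)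
  then have "poly d t = 0" if "t \<in> {0..1/2}" for t
    using that by (force simp: f_def)
  then have "{0..1/2} \<subseteq> {t. poly d t = 0}" by auto
  moreover have "infinite {0..(1/2::real)}" by simp
  ultimately show False using poly_roots_finite[OF \<open>d \<noteq> 0\<close>] finite_subset by blast
qed

text \<open>Once a multiple of \<open>q\<close> cancels the leading term of \<open>p\<close>, the
  difference is orthogonal to everything of lower degree, itself included. The value at 1 then fixes
  the multiple.\<close>

lemma jacobi_orth_unique:
  assumes "jacobi_orth \<alpha> \<beta> m p" "degree p = m" "jacobi_orth \<alpha> \<beta> m q" "degree q = m"
    and "poly p 1 = poly q 1" "poly q 1 \<noteq> 0"
  shows "p = q"
proof (cases "m = 0")
  case True
  then show ?thesis using assms by (auto elim!: degree_eq_zeroE)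
next
  case False
  define c where "c = lead_coeff p / lead_coeff q"
  define d where "d = p - smult c q"
  have "q \<noteq> 0" using assms by auto
  have "coeff q m \<noteq> 0" using assms(4) \<open>q \<noteq> 0\<close> by auto
  then have d: "coeff d m = 0" using assms(2,4) by (simp add: d_def c_def)
  have "degree d \<le> m"
    unfolding d_def by (rule degree_diff_le) (auto simp: assms intro: order_trans[OF degree_smult_le])
  then have "degree d < m"
    using d False by (metis leading_coeff_0_iff le_neq_implies_less degree_0)
  moreover have "jacobi_orth \<alpha> \<beta> m d"
    unfolding jacobi_orth_def
  proof (intro allI impI)
    fix e :: "real poly" assume "degree e < m"
    then have "((\<lambda>t. (1 - t) powr \<alpha> * (1 + t) powr \<beta> * poly p t * poly e t
          - c * ((1 - t) powr \<alpha> * (1 + t) powr \<beta> * poly q t * poly e t)) has_integral (0 - c * 0)) {-1..1}"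
      using assms(1,3) unfolding jacobi_orth_def
      by (intro has_integral_diff has_integral_mult_right) auto
    then show "((\<lambda>t. (1 - t) powr \<alpha> * (1 + t) powr \<beta> * poly d t * poly e t) has_integral 0) {-1..1}"
      by (simp add: d_def algebra_simps)
  qed
  ultimately have "d = 0" by (rule jacobi_orth_self[rotated])
  then have "p = smult c q" by (simp add: d_def)
  moreover from this have "c = 1" using assms by simp
  ultimately show ?thesis by simp
qed

text \<open>Existence and uniqueness justify the definite description; everything later about
  \<open>jacobi_poly\<close> goes through these three facts.\<close>

lemma jacobi_poly_ode: "jacobi_ode \<alpha> \<beta> m (jacobi_poly \<alpha> \<beta> m)" "jacobi_poly \<alpha> \<beta> m \<noteq> 0"
    "degree (jacobi_poly \<alpha> \<beta> m) = m"
proof -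
  obtain e where e: "jacobi_ode \<alpha> \<beta> m e" "degree e = m" "poly e 1 = 1"
    using jacobi_ode_exists by blast
  define c where "c = (real m + \<alpha>) gchoose m"
  have "c \<noteq> 0"
    using \<alpha> by (auto simp: c_def gbinomial_prod_rev)
  define p where "p = smult c e"
  have p: "jacobi_ode \<alpha> \<beta> m p"
    unfolding jacobi_ode_def
  proof
    fix t
    have "c * ((1 - t\<^sup>2) * poly (pderiv (pderiv e)) t + (\<beta> - \<alpha> - (\<alpha> + \<beta> + 2) * t) * poly (pderiv e) t
       + jacobi_eigenvalue \<alpha> \<beta> m * poly e t) = 0"
      using e(1) by (simp add: jacobi_ode_def)
    then show "(1 - t\<^sup>2) * poly (pderiv (pderiv p)) t + (\<beta> - \<alpha> - (\<alpha> + \<beta> + 2) * t) * poly (pderiv p) t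
       + jacobi_eigenvalue \<alpha> \<beta> m * poly p t = 0"
      by (simp add: p_def pderiv_smult algebra_simps)
  qed
  have deg: "degree p = m" using \<open>c \<noteq> 0\<close> e by (simp add: p_def)
  have jac: "is_jacobi_poly \<alpha> \<beta> m q \<longleftrightarrow> degree q = m \<and> jacobi_orth \<alpha> \<beta> m q \<and> poly q 1 = c" for q
    by (simp add: is_jacobi_poly_def jacobi_orth_def c_def)
  have "jacobi_poly \<alpha> \<beta> m = p"
    unfolding jacobi_poly_def
  proof (rule the_equality)
    show *: "is_jacobi_poly \<alpha> \<beta> m p"
      unfolding jac using deg jacobi_ode_imp_orth[OF p] e(3) by (simp add: p_def)
    show "q = p" if "is_jacobi_poly \<alpha> \<beta> m q" for q
      using that * \<open>c \<noteq> 0\<close> unfolding jac by (intro jacobi_orth_unique) auto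
  qed
  then show "jacobi_ode \<alpha> \<beta> m (jacobi_poly \<alpha> \<beta> m)" "jacobi_poly \<alpha> \<beta> m \<noteq> 0"
    "degree (jacobi_poly \<alpha> \<beta> m) = m"
    using p deg \<open>c \<noteq> 0\<close> e by (auto simp: p_def)
qed

end

section \<open>The energy of the Liouville transform\<close>

text \<open>Up to a constant, the square root of the orthogonality weight expressed in the angle,
  since \<open>1 - t\<close>, \<open>1 + t\<close> and \<open>dt\<close> become
  \<open>2 * sin\<^sup>2 (\<theta>/2)\<close>, \<open>2 * cos\<^sup>2 (\<theta>/2)\<close> and
  \<open>sin \<theta> d\<theta>\<close>.\<close>

definition jacobi_weight :: "real \<Rightarrow> real \<Rightarrow> real \<Rightarrow> real" where
  "jacobi_weight \<alpha> \<beta> \<theta> = sin (\<theta> / 2) powr (\<alpha> + 1/2) * cos (\<theta> / 2) powr (\<beta> + 1/2)"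

definition jacobi_v :: "real \<Rightarrow> real \<Rightarrow> real poly \<Rightarrow> real \<Rightarrow> real" where
  "jacobi_v \<alpha> \<beta> p \<theta> = jacobi_weight \<alpha> \<beta> \<theta> * poly p (cos \<theta>)"

text \<open>Minus the weight times the derivative of \<open>poly p (cos \<theta>)\<close> with
  respect to \<theta>.\<close>

definition jacobi_w :: "real \<Rightarrow> real \<Rightarrow> real poly \<Rightarrow> real \<Rightarrow> real" where
  "jacobi_w \<alpha> \<beta> p \<theta> = jacobi_weight \<alpha> \<beta> \<theta> * (poly (pderiv p) (cos \<theta>) * sin \<theta>)"

text \<open>The logarithmic derivative of \<open>jacobi_weight\<close>, \<open>(\<alpha> + 1/2) / 2
  * cot (\<theta>/2) - (\<beta> + 1/2) / 2 * tan (\<theta>/2)\<close>, over a common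
  denominator.\<close>

definition jacobi_g :: "real \<Rightarrow> real \<Rightarrow> real \<Rightarrow> real" where
  "jacobi_g \<alpha> \<beta> \<theta> = ((\<alpha> - \<beta>) + (\<alpha> + \<beta> + 1) * cos \<theta>) / (2 * sin \<theta>)"

text \<open>The derivative of \<open>jacobi_v\<close>, written so that at a zero of \<open>p\<close>
  it is visibly \<open>- jacobi_w\<close>.\<close>

definition jacobi_d :: "real \<Rightarrow> real \<Rightarrow> real poly \<Rightarrow> real \<Rightarrow> real" where
  "jacobi_d \<alpha> \<beta> p \<theta> = jacobi_g \<alpha> \<beta> \<theta> * jacobi_v \<alpha> \<beta> p \<theta> - jacobi_w \<alpha> \<beta> p \<theta>"

text \<open>The frequency is \<open>Suc m\<close> instead of the square root of the eigenvalue: it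
  is positive also for \<open>m = 0\<close>, and the squares differ only by a term of order
  \<open>m + 1\<close>, which costs a bounded factor.\<close>

definition jacobi_energy :: "real \<Rightarrow> real \<Rightarrow> nat \<Rightarrow> real poly \<Rightarrow> real \<Rightarrow> real" where
  "jacobi_energy \<alpha> \<beta> m p \<theta> = (jacobi_d \<alpha> \<beta> p \<theta>)\<^sup>2 + (real (Suc m) * jacobi_v \<alpha> \<beta> p \<theta>)\<^sup>2"

lemma half_angle: "sin \<theta> = 2 * sin (\<theta> / 2) * cos (\<theta> / 2)"
    "cos \<theta> = (cos (\<theta> / 2))\<^sup>2 - (sin (\<theta> / 2))\<^sup>2" for \<theta> :: real
  using sin_double[of "\<theta> / 2"] cos_double[of "\<theta> / 2"] by simp_all

lemma half_angle_pos:
  fixes \<theta> :: real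
  assumes "0 < \<theta>" "\<theta> < pi"
  shows "sin (\<theta> / 2) > 0" "cos (\<theta> / 2) > 0" "sin \<theta> > 0"
  using assms by (auto intro!: sin_gt_zero cos_gt_zero)

lemma jacobi_weight_pos: "0 < \<theta> \<Longrightarrow> \<theta> < pi \<Longrightarrow> jacobi_weight \<alpha> \<beta> \<theta> > 0"
  using half_angle_pos[of \<theta>] by (simp add: jacobi_weight_def)

lemma jacobi_weight_deriv:
  assumes "0 < \<theta>" "\<theta> < pi"
  shows "(jacobi_weight \<alpha> \<beta> has_real_derivative jacobi_g \<alpha> \<beta> \<theta> * jacobi_weight \<alpha> \<beta> \<theta>) (at \<theta>)"
proof -
  define s c where "s = sin (\<theta> / 2)" and "c = cos (\<theta> / 2)"
  have sc: "s > 0" "c > 0" using half_angle_pos[OF assms] by (auto simp: s_def c_def)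
  have pyth: "s\<^sup>2 + c\<^sup>2 = 1" by (simp add: s_def c_def)
  define W where "W = s powr (\<alpha> + 1/2) * c powr (\<beta> + 1/2)"
  have "((\<lambda>\<theta>. sin (\<theta> / 2) powr (\<alpha> + 1/2)) has_real_derivative (\<alpha> + 1/2) * s powr (\<alpha> + 1/2 - 1) * (c / 2)) (at \<theta>)"
    using sc by (auto intro!: derivative_eq_intros simp: s_def c_def powr_diff field_simps)
  moreover have "((\<lambda>\<theta>. cos (\<theta> / 2) powr (\<beta> + 1/2)) has_real_derivative (\<beta> + 1/2) * c powr (\<beta> + 1/2 - 1) * (- s / 2)) (at \<theta>)"
    using sc by (auto intro!: derivative_eq_intros simp: s_def c_def powr_diff field_simps)
  ultimately have "(jacobi_weight \<alpha> \<beta> has_real_derivative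
      (\<alpha> + 1/2) * s powr (\<alpha> + 1/2 - 1) * (c / 2) * c powr (\<beta> + 1/2)
      + (\<beta> + 1/2) * c powr (\<beta> + 1/2 - 1) * (- s / 2) * s powr (\<alpha> + 1/2)) (at \<theta>)"
    unfolding jacobi_weight_def[abs_def] s_def c_def by (rule DERIV_mult)
  moreover have "(\<alpha> + 1/2) * s powr (\<alpha> + 1/2 - 1) * (c / 2) * c powr (\<beta> + 1/2)
      + (\<beta> + 1/2) * c powr (\<beta> + 1/2 - 1) * (- s / 2) * s powr (\<alpha> + 1/2)
      = ((\<alpha> + 1/2) * c / (2 * s) - (\<beta> + 1/2) * s / (2 * c)) * W"
  proof -
    define A B where "A = s powr (\<alpha> + 1/2)" and "B = c powr (\<beta> + 1/2)"
    show ?thesis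
      unfolding powr_diff[of _ _ 1] W_def A_def[symmetric] B_def[symmetric]
      using sc by (simp add: field_simps)
  qed
  moreover have "(\<alpha> + 1/2) * c / (2 * s) - (\<beta> + 1/2) * s / (2 * c) = jacobi_g \<alpha> \<beta> \<theta>"
  proof -
    have "jacobi_g \<alpha> \<beta> \<theta> = ((\<alpha> - \<beta>) * (s\<^sup>2 + c\<^sup>2) + (\<alpha> + \<beta> + 1) * (c\<^sup>2 - s\<^sup>2)) / (2 * (2 * s * c))"
      unfolding jacobi_g_def half_angle(1)[of \<theta>] half_angle(2)[of \<theta>] s_def[symmetric] c_def[symmetric]
      by (simp add: pyth)
    also have "\<dots> = (\<alpha> + 1/2) * c / (2 * s) - (\<beta> + 1/2) * s / (2 * c)"
      using sc by (simp add: field_simps power2_eq_square)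
    finally show ?thesis by simp
  qed
  ultimately show ?thesis by (simp add: jacobi_weight_def W_def s_def c_def)
qed

lemma jacobi_v_deriv:
  assumes "0 < \<theta>" "\<theta> < pi"
  shows "(jacobi_v \<alpha> \<beta> p has_real_derivative jacobi_d \<alpha> \<beta> p \<theta>) (at \<theta>)"
  unfolding jacobi_v_def[abs_def]
  by (rule derivative_eq_intros jacobi_weight_deriv[OF assms] refl)+
    (simp add: jacobi_d_def jacobi_v_def jacobi_w_def algebra_simps)

text \<open>For \<open>y = poly p (cos \<theta>)\<close> the equation reads \<open>y'' + 2 * g * y'
  + jacobi_eigenvalue \<alpha> \<beta> m * y = 0\<close> with \<open>g\<close> the logarithmic
  derivative of the weight; the weight absorbs one of the two copies of \<open>g\<close>.\<close>

lemma jacobi_w_deriv: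
  assumes "0 < \<theta>" "\<theta> < pi" and ode: "jacobi_ode \<alpha> \<beta> m p"
  shows "(jacobi_w \<alpha> \<beta> p has_real_derivative
     - jacobi_g \<alpha> \<beta> \<theta> * jacobi_w \<alpha> \<beta> p \<theta> + jacobi_eigenvalue \<alpha> \<beta> m * jacobi_v \<alpha> \<beta> p \<theta>) (at \<theta>)"
proof -
  define W where "W = jacobi_weight \<alpha> \<beta> \<theta>"
  define P1 P2 where "P1 = poly (pderiv p) (cos \<theta>)" and "P2 = poly (pderiv (pderiv p)) (cos \<theta>)"
  have g: "2 * (jacobi_g \<alpha> \<beta> \<theta> * sin \<theta>) = (\<alpha> - \<beta>) + (\<alpha> + \<beta> + 1) * cos \<theta>"
    using half_angle_pos[OF assms(1,2)] by (simp add: jacobi_g_def)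
  have "(1 - (cos \<theta>)\<^sup>2) * P2 + (\<beta> - \<alpha> - (\<alpha> + \<beta> + 2) * cos \<theta>) * P1
       + jacobi_eigenvalue \<alpha> \<beta> m * poly p (cos \<theta>) = 0"
    using ode by (simp add: jacobi_ode_def P1_def P2_def)
  moreover have "1 - (cos \<theta>)\<^sup>2 = sin \<theta> * sin \<theta>" by (simp add: sin_squared_eq flip: power2_eq_square)
  ultimately have "P2 * (sin \<theta> * sin \<theta>) = 2 * (jacobi_g \<alpha> \<beta> \<theta> * sin \<theta>) * P1 + cos \<theta> * P1
       - jacobi_eigenvalue \<alpha> \<beta> m * poly p (cos \<theta>)"
    unfolding g by (simp add: algebra_simps)
  then have eq: "W * (P2 * (sin \<theta> * sin \<theta>)) = W * (2 * (jacobi_g \<alpha> \<beta> \<theta> * sin \<theta>) * P1 + cos \<theta> * P1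
       - jacobi_eigenvalue \<alpha> \<beta> m * poly p (cos \<theta>))" by simp
  have "(jacobi_w \<alpha> \<beta> p has_real_derivative
     jacobi_g \<alpha> \<beta> \<theta> * W * (P1 * sin \<theta>) + (P2 * (- sin \<theta>) * sin \<theta> + P1 * cos \<theta>) * W) (at \<theta>)"
    unfolding jacobi_w_def[abs_def] W_def P1_def P2_def
    by (rule derivative_eq_intros jacobi_weight_deriv[OF assms(1,2)] refl)+ (simp add: algebra_simps)
  then show ?thesis
    by (rule DERIV_cong) (use eq in \<open>simp add: jacobi_w_def jacobi_v_def W_def[symmetric] P1_def[symmetric] algebra_simps\<close>)
qed

lemma jacobi_g_deriv:
  assumes "0 < \<theta>" "\<theta> < pi"
  shows "(jacobi_g \<alpha> \<beta> has_real_derivative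
     - ((\<alpha> + \<beta> + 1) + (\<alpha> - \<beta>) * cos \<theta>) / (2 * (sin \<theta>)\<^sup>2)) (at \<theta>)"
proof -
  have s: "sin \<theta> > 0" using half_angle_pos[OF assms] by simp
  have "(\<alpha> + \<beta> + 1) * (sin \<theta> * sin \<theta>) = (\<alpha> + \<beta> + 1) * (1 - cos \<theta> * cos \<theta>)"
    by (simp add: sin_squared_eq flip: power2_eq_square)
  then have num: "(- ((\<alpha> + \<beta> + 1) * sin \<theta>)) * (2 * sin \<theta>) - ((\<alpha> - \<beta>) + (\<alpha> + \<beta> + 1) * cos \<theta>) * (2 * cos \<theta>)
      = 2 * (- ((\<alpha> + \<beta> + 1) + (\<alpha> - \<beta>) * cos \<theta>))"
    by (simp add: algebra_simps)
  have "(jacobi_g \<alpha> \<beta> has_real_derivative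
      ((- ((\<alpha> + \<beta> + 1) * sin \<theta>)) * (2 * sin \<theta>) - ((\<alpha> - \<beta>) + (\<alpha> + \<beta> + 1) * cos \<theta>) * (2 * cos \<theta>))
        / (2 * sin \<theta> * (2 * sin \<theta>))) (at \<theta>)"
    unfolding jacobi_g_def[abs_def] using s by (auto intro!: derivative_eq_intros)
  moreover have "2 * (- ((\<alpha> + \<beta> + 1) + (\<alpha> - \<beta>) * cos \<theta>)) / (2 * sin \<theta> * (2 * sin \<theta>))
      = - ((\<alpha> + \<beta> + 1) + (\<alpha> - \<beta>) * cos \<theta>) / (2 * (sin \<theta>)\<^sup>2)"
    using s by (simp add: power2_eq_square field_simps)
  ultimately show ?thesis unfolding num by simp
qed

text \<open>In the derivative of \<open>g * v - w\<close> the terms \<open>g * d\<close> and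
  \<open>g * w\<close> add up to \<open>g\<^sup>2 * v\<close>, so no first-order term is left: this
  is the Liouville normal form of the equation.\<close>

lemma jacobi_d_deriv:
  assumes "0 < \<theta>" "\<theta> < pi" and ode: "jacobi_ode \<alpha> \<beta> m p"
  shows "(jacobi_d \<alpha> \<beta> p has_real_derivative
     (- ((\<alpha> + \<beta> + 1) + (\<alpha> - \<beta>) * cos \<theta>) / (2 * (sin \<theta>)\<^sup>2) + (jacobi_g \<alpha> \<beta> \<theta>)\<^sup>2
       - jacobi_eigenvalue \<alpha> \<beta> m) * jacobi_v \<alpha> \<beta> p \<theta>) (at \<theta>)"
  unfolding jacobi_d_def[abs_def]
  apply (rule DERIV_cong)
   apply (rule DERIV_diff DERIV_mult jacobi_g_deriv jacobi_v_deriv jacobi_w_deriv assms)+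
  apply (simp add: jacobi_d_def algebra_simps power2_eq_square)
  done

text \<open>With \<open>M\<close> the sum of the two absolute values, \<open>(M + 2)\<^sup>2\<close>
  dominates both \<open>M / 2 + M\<^sup>2 / 4\<close>, which bounds the coefficient of
  \<open>1 / sin\<^sup>2 \<theta>\<close>, and \<open>M + 2\<close>, which bounds the mismatch of
  the squared frequencies divided by \<open>n\<close>.\<close>

definition energy_const :: "real \<Rightarrow> real \<Rightarrow> real" where
  "energy_const \<alpha> \<beta> = (\<bar>\<alpha> - \<beta>\<bar> + \<bar>\<alpha> + \<beta> + 1\<bar> + 2)\<^sup>2"

text \<open>The derivative is \<open>2 * v' * (v'' + n\<^sup>2 * v)\<close>, and the bracket is
  \<open>v\<close> times a mismatch of order \<open>n + 1 / sin\<^sup>2 \<theta>\<close>. As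
  \<open>2 * |n * v * v'|\<close> is at most the energy, the mismatch enters divided by
  \<open>n\<close>.\<close>

lemma jacobi_energy_deriv:
  assumes \<theta>: "0 < \<theta>" "\<theta> < pi" and ode: "jacobi_ode \<alpha> \<beta> m p"
  obtains e where "(jacobi_energy \<alpha> \<beta> m p has_real_derivative e) (at \<theta>)"
    "\<bar>e\<bar> \<le> energy_const \<alpha> \<beta> * (1 + 1 / (real (Suc m) * (sin \<theta>)\<^sup>2)) * jacobi_energy \<alpha> \<beta> m p \<theta>"
proof -
  define \<kappa> \<tau> n where "\<kappa> = \<alpha> - \<beta>" and "\<tau> = \<alpha> + \<beta> + 1" and "n = real (Suc m)"
  define s where "s = sin \<theta>"
  have s: "s > 0" using half_angle_pos[OF \<theta>] by (simp add: s_def)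
  have n: "n \<ge> 1" by (simp add: n_def)
  define f where "f = - (\<tau> + \<kappa> * cos \<theta>) / (2 * s\<^sup>2) + (jacobi_g \<alpha> \<beta> \<theta>)\<^sup>2"
  define \<mu> where "\<mu> = n\<^sup>2 - jacobi_eigenvalue \<alpha> \<beta> m"
  define v d where "v = jacobi_v \<alpha> \<beta> p \<theta>" and "d = jacobi_d \<alpha> \<beta> p \<theta>"
  define M where "M = \<bar>\<kappa>\<bar> + \<bar>\<tau>\<bar>"
  have M: "M \<ge> 0" by (simp add: M_def)
  have abs1: "\<bar>\<tau> + \<kappa> * cos \<theta>\<bar> \<le> M" "\<bar>\<kappa> + \<tau> * cos \<theta>\<bar> \<le> M"
  proof -
    have "\<bar>\<kappa> * cos \<theta>\<bar> \<le> \<bar>\<kappa>\<bar> * 1" "\<bar>\<tau> * cos \<theta>\<bar> \<le> \<bar>\<tau>\<bar> * 1"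
      unfolding abs_mult by (intro mult_left_mono; simp)+
    then show "\<bar>\<tau> + \<kappa> * cos \<theta>\<bar> \<le> M" "\<bar>\<kappa> + \<tau> * cos \<theta>\<bar> \<le> M" by (auto simp: M_def)
  qed
  have minus: "\<bar>- \<tau> - \<kappa> * cos \<theta>\<bar> = \<bar>\<tau> + \<kappa> * cos \<theta>\<bar>" by simp
  have "\<bar>f\<bar> \<le> \<bar>\<tau> + \<kappa> * cos \<theta>\<bar> / (2 * s\<^sup>2) + \<bar>\<kappa> + \<tau> * cos \<theta>\<bar>\<^sup>2 / (4 * s\<^sup>2)"
    unfolding f_def jacobi_g_def \<kappa>_def[symmetric] \<tau>_def[symmetric] s_def[symmetric]
    by (rule order_trans[OF abs_triangle_ineq]) (simp add: abs_mult power_divide power_mult_distrib minus)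
  also have "\<dots> \<le> M / (2 * s\<^sup>2) + M\<^sup>2 / (4 * s\<^sup>2)"
    using abs1 by (intro add_mono divide_right_mono power_mono) auto
  also have "\<dots> \<le> (M + 2)\<^sup>2 / s\<^sup>2"
    using M s by (simp add: field_simps power2_eq_square)
  finally have f: "\<bar>f\<bar> \<le> energy_const \<alpha> \<beta> / s\<^sup>2"
    by (simp add: energy_const_def M_def \<kappa>_def \<tau>_def add.assoc)
  have "\<bar>\<mu>\<bar> = \<bar>real m * (2 - \<tau>) + 1\<bar>"
    by (simp add: \<mu>_def jacobi_eigenvalue_def n_def \<tau>_def power2_eq_square algebra_simps)
  also have "\<dots> \<le> real m * \<bar>2 - \<tau>\<bar> + 1"
    by (rule order_trans[OF abs_triangle_ineq]) (simp add: abs_mult)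
  also have "\<dots> \<le> real m * (M + 2) + (M + 2)"
    using M by (intro add_mono mult_left_mono) (auto simp: M_def)
  also have "\<dots> = (M + 2) * n" by (simp add: n_def algebra_simps)
  also have "\<dots> \<le> (M + 2)\<^sup>2 * n"
    using M n by (intro mult_right_mono) (auto simp: power2_eq_square)
  finally have \<mu>: "\<bar>\<mu>\<bar> \<le> energy_const \<alpha> \<beta> * n"
    by (simp add: energy_const_def M_def \<kappa>_def \<tau>_def add.assoc)
  have "(jacobi_energy \<alpha> \<beta> m p has_real_derivative 2 * (d * v) * (f + \<mu>)) (at \<theta>)"
    unfolding jacobi_energy_def[abs_def]
    by (rule derivative_eq_intros jacobi_v_deriv[OF \<theta>] jacobi_d_deriv[OF \<theta> ode] refl)+
      (simp add: f_def \<mu>_def v_def d_def s_def \<kappa>_def \<tau>_def n_def power2_eq_square algebra_simps)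
  moreover have "\<bar>2 * (d * v) * (f + \<mu>)\<bar> \<le>
      energy_const \<alpha> \<beta> * (1 + 1 / (n * s\<^sup>2)) * jacobi_energy \<alpha> \<beta> m p \<theta>"
  proof -
    have "2 * (\<bar>d\<bar> * \<bar>n * v\<bar>) \<le> jacobi_energy \<alpha> \<beta> m p \<theta>"
      using sum_squares_bound[of "\<bar>d\<bar>" "\<bar>n * v\<bar>"]
      by (simp add: jacobi_energy_def d_def v_def n_def mult.assoc)
    moreover have "\<bar>f + \<mu>\<bar> / n \<le> energy_const \<alpha> \<beta> * (1 + 1 / (n * s\<^sup>2))"
    proof -
      have "\<bar>f + \<mu>\<bar> / n \<le> (energy_const \<alpha> \<beta> / s\<^sup>2 + energy_const \<alpha> \<beta> * n) / n"
        using f \<mu> n by (intro divide_right_mono) auto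
      also have "\<dots> = energy_const \<alpha> \<beta> * (1 + 1 / (n * s\<^sup>2))"
        using n s by (simp add: field_simps)
      finally show ?thesis .
    qed
    ultimately have "2 * (\<bar>d\<bar> * \<bar>n * v\<bar>) * (\<bar>f + \<mu>\<bar> / n) \<le>
       jacobi_energy \<alpha> \<beta> m p \<theta> * (energy_const \<alpha> \<beta> * (1 + 1 / (n * s\<^sup>2)))"
      using n by (intro mult_mono) (auto simp: jacobi_energy_def)
    moreover have "2 * (\<bar>d\<bar> * \<bar>n * v\<bar>) * (\<bar>f + \<mu>\<bar> / n) = \<bar>2 * (d * v) * (f + \<mu>)\<bar>"
      using n by (simp add: abs_mult)
    ultimately show ?thesis by (simp add: mult_ac)
  qed
  ultimately show ?thesis using that by (simp add: n_def s_def)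
qed

text \<open>An antiderivative of the rate in \<open>jacobi_energy_deriv\<close>: the cotangent has
  derivative \<open>- 1 / sin\<^sup>2\<close>.\<close>

definition energy_phase :: "real \<Rightarrow> real \<Rightarrow> nat \<Rightarrow> real \<Rightarrow> real" where
  "energy_phase \<alpha> \<beta> m \<theta> = energy_const \<alpha> \<beta> * (\<theta> - cos \<theta> / (real (Suc m) * sin \<theta>))"

lemma energy_phase_deriv:
  assumes "0 < \<theta>" "\<theta> < pi"
  shows "(energy_phase \<alpha> \<beta> m has_real_derivative
    energy_const \<alpha> \<beta> * (1 + 1 / (real (Suc m) * (sin \<theta>)\<^sup>2))) (at \<theta>)"
proof -
  define n where "n = real (Suc m)"
  have s: "sin \<theta> > 0" using half_angle_pos[OF assms] by simp
  have n: "n > 0" by (simp add: n_def)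
  have pyth: "sin \<theta> * sin \<theta> = 1 - cos \<theta> * cos \<theta>"
    by (simp add: sin_squared_eq flip: power2_eq_square)
  have "((\<lambda>\<theta>. cos \<theta> / (n * sin \<theta>)) has_real_derivative
      (- sin \<theta> * (n * sin \<theta>) - cos \<theta> * (n * cos \<theta>)) / (n * sin \<theta> * (n * sin \<theta>))) (at \<theta>)"
    using s n by (auto intro!: derivative_eq_intros)
  moreover have "(- sin \<theta> * (n * sin \<theta>) - cos \<theta> * (n * cos \<theta>)) / (n * sin \<theta> * (n * sin \<theta>))
      = - 1 / (n * (sin \<theta>)\<^sup>2)"
  proof -
    have "- sin \<theta> * (n * sin \<theta>) - cos \<theta> * (n * cos \<theta>) = - n * (sin \<theta> * sin \<theta> + cos \<theta> * cos \<theta>)"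
      by algebra
    also have "\<dots> = - n" unfolding pyth by simp
    finally have num: "- sin \<theta> * (n * sin \<theta>) - cos \<theta> * (n * cos \<theta>) = - n" .
    show ?thesis unfolding num using s n by (simp add: power2_eq_square)
  qed
  ultimately have *: "((\<lambda>\<theta>. cos \<theta> / (n * sin \<theta>)) has_real_derivative - 1 / (n * (sin \<theta>)\<^sup>2)) (at \<theta>)"
    by simp
  have "((\<lambda>\<theta>. energy_const \<alpha> \<beta> * (\<theta> - cos \<theta> / (n * sin \<theta>))) has_real_derivative
      energy_const \<alpha> \<beta> * (1 - - 1 / (n * (sin \<theta>)\<^sup>2))) (at \<theta>)"
    by (intro DERIV_cmult DERIV_diff DERIV_ident *)
  then show ?thesis by (simp add: energy_phase_def[abs_def] n_def)
qed

section \<open>Comparison of the energy at two angles\<close>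

lemma jacobi_energy_nonneg: "jacobi_energy \<alpha> \<beta> m p \<theta> \<ge> 0"
  by (simp add: jacobi_energy_def)

text \<open>Gronwall's argument in both directions: multiplied by \<open>exp\<close> of the phase
  the energy is nondecreasing, and multiplied by \<open>exp\<close> of minus the phase it is
  nonincreasing.\<close>

lemma jacobi_energy_compare:
  assumes ode: "jacobi_ode \<alpha> \<beta> m p" and \<theta>: "0 < \<theta>" "\<theta> \<le> \<phi>" "\<phi> < pi"
  defines "\<Delta> \<equiv> energy_phase \<alpha> \<beta> m \<phi> - energy_phase \<alpha> \<beta> m \<theta>"
  shows "jacobi_energy \<alpha> \<beta> m p \<theta> \<le> exp \<Delta> * jacobi_energy \<alpha> \<beta> m p \<phi>"
    and "jacobi_energy \<alpha> \<beta> m p \<phi> \<le> exp \<Delta> * jacobi_energy \<alpha> \<beta> m p \<theta>"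
proof -
  define H where "H = energy_phase \<alpha> \<beta> m"
  define E where "E = jacobi_energy \<alpha> \<beta> m p"
  have der: "\<exists>e h. (E has_real_derivative e) (at x) \<and> (H has_real_derivative h) (at x) \<and> \<bar>e\<bar> \<le> h * E x"
    if x: "\<theta> \<le> x" "x \<le> \<phi>" for x
  proof -
    have x: "0 < x" "x < pi" using x \<theta> by auto
    obtain e where "(jacobi_energy \<alpha> \<beta> m p has_real_derivative e) (at x)"
      "\<bar>e\<bar> \<le> energy_const \<alpha> \<beta> * (1 + 1 / (real (Suc m) * (sin x)\<^sup>2)) * jacobi_energy \<alpha> \<beta> m p x"
      by (rule jacobi_energy_deriv[OF x ode])
    then show ?thesis using energy_phase_deriv[OF x, of \<alpha> \<beta> m] unfolding E_def H_def by blast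
  qed
  have "E \<theta> * exp (H \<theta>) \<le> E \<phi> * exp (H \<phi>)"
  proof (rule DERIV_nonneg_imp_nondecreasing[OF \<theta>(2)])
    fix x assume "\<theta> \<le> x" "x \<le> \<phi>"
    then obtain e h where eh: "(E has_real_derivative e) (at x)" "(H has_real_derivative h) (at x)" "\<bar>e\<bar> \<le> h * E x"
      using der by blast
    have "((\<lambda>x. E x * exp (H x)) has_real_derivative (e + h * E x) * exp (H x)) (at x)"
      by (rule derivative_eq_intros eh refl)+ (simp add: algebra_simps)
    moreover have "(e + h * E x) * exp (H x) \<ge> 0" using eh(3) by (intro mult_nonneg_nonneg) auto
    ultimately show "\<exists>y. ((\<lambda>x. E x * exp (H x)) has_real_derivative y) (at x) \<and> 0 \<le> y" by blast
  qed
  then show "jacobi_energy \<alpha> \<beta> m p \<theta> \<le> exp \<Delta> * jacobi_energy \<alpha> \<beta> m p \<phi>"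
    by (simp add: E_def H_def \<Delta>_def exp_diff field_simps)
  have "E \<theta> * exp (- H \<theta>) \<ge> E \<phi> * exp (- H \<phi>)"
  proof (rule DERIV_nonpos_imp_nonincreasing[OF \<theta>(2)])
    fix x assume "\<theta> \<le> x" "x \<le> \<phi>"
    then obtain e h where eh: "(E has_real_derivative e) (at x)" "(H has_real_derivative h) (at x)" "\<bar>e\<bar> \<le> h * E x"
      using der by blast
    have "((\<lambda>x. E x * exp (- H x)) has_real_derivative (e - h * E x) * exp (- H x)) (at x)"
      by (rule derivative_eq_intros eh refl)+ (simp add: algebra_simps)
    moreover have "(e - h * E x) * exp (- H x) \<le> 0" using eh(3) by (intro mult_nonpos_nonneg) auto
    ultimately show "\<exists>y. ((\<lambda>x. E x * exp (- H x)) has_real_derivative y) (at x) \<and> y \<le> 0" by blast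
  qed
  then show "jacobi_energy \<alpha> \<beta> m p \<phi> \<le> exp \<Delta> * jacobi_energy \<alpha> \<beta> m p \<theta>"
    by (simp add: E_def H_def \<Delta>_def exp_diff exp_minus field_simps)
qed

text \<open>Jordan's inequality: the sine is concave here and so lies above its chord.\<close>

lemma sin_ge_two_div_pi:
  fixes x :: real
  assumes "0 \<le> x" "x \<le> pi / 2"
  shows "2 * x / pi \<le> sin x"
proof -
  have "concave_on {0..pi/2} sin"
    unfolding concave_on_def
  proof (rule f''_ge0_imp_convex)
    show "convex {0..pi/2}" by simp
    show "((\<lambda>x. - sin x) has_real_derivative - cos x) (at x)" for x :: real
      by (auto intro!: derivative_eq_intros)
    show "((\<lambda>x. - cos x) has_real_derivative sin x) (at x)" for x :: real
      by (auto intro!: derivative_eq_intros)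
    show "0 \<le> sin x" if "x \<in> {0..pi/2}" for x :: real
      using that by (intro sin_ge_zero) auto
  qed
  from concave_onD[OF this, of "2 * x / pi" 0 "pi / 2"] show ?thesis
    using assms by (simp add: field_simps)
qed

text \<open>The maximum and the minimum occur because the sign of \<open>a\<close> is open.\<close>

lemma powr_between:
  fixes z :: real
  assumes "0 < l" "l \<le> z" "z \<le> u"
  shows "z powr a \<le> max (l powr a) (u powr a)" "min (l powr a) (u powr a) \<le> z powr a"
  using assms powr_mono2[of a l z] powr_mono2[of a z u] powr_mono2'[of a l z] powr_mono2'[of a z u]
  by (cases "a \<ge> 0"; force)+

lemma jacobi_reflect:
  assumes "0 < \<theta>" "\<theta> < pi"
  shows "jacobi_v \<beta> \<alpha> (pcompose p [:0, -1:]) \<theta> = jacobi_v \<alpha> \<beta> p (pi - \<theta>)"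
    and "jacobi_w \<beta> \<alpha> (pcompose p [:0, -1:]) \<theta> = - jacobi_w \<alpha> \<beta> p (pi - \<theta>)"
    and "jacobi_d \<beta> \<alpha> (pcompose p [:0, -1:]) \<theta> = - jacobi_d \<alpha> \<beta> p (pi - \<theta>)"
    and "jacobi_energy \<beta> \<alpha> m (pcompose p [:0, -1:]) \<theta> = jacobi_energy \<alpha> \<beta> m p (pi - \<theta>)"
proof -
  have half: "(pi - \<theta>) / 2 = pi / 2 - \<theta> / 2" by (simp add: field_simps)
  have W: "jacobi_weight \<beta> \<alpha> \<theta> = jacobi_weight \<alpha> \<beta> (pi - \<theta>)"
    unfolding jacobi_weight_def half by (simp add: sin_diff cos_diff mult.commute)
  have g: "jacobi_g \<beta> \<alpha> \<theta> = - jacobi_g \<alpha> \<beta> (pi - \<theta>)"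
    using half_angle_pos[OF assms] by (simp add: jacobi_g_def field_simps)
  show v: "jacobi_v \<beta> \<alpha> (pcompose p [:0, -1:]) \<theta> = jacobi_v \<alpha> \<beta> p (pi - \<theta>)"
    by (simp add: jacobi_v_def W poly_pcompose)
  show w: "jacobi_w \<beta> \<alpha> (pcompose p [:0, -1:]) \<theta> = - jacobi_w \<alpha> \<beta> p (pi - \<theta>)"
    by (simp add: jacobi_w_def W poly_pcompose pderiv_pcompose pderiv_pCons)
  show d: "jacobi_d \<beta> \<alpha> (pcompose p [:0, -1:]) \<theta> = - jacobi_d \<alpha> \<beta> p (pi - \<theta>)"
    unfolding jacobi_d_def v w g by simp
  show "jacobi_energy \<beta> \<alpha> m (pcompose p [:0, -1:]) \<theta> = jacobi_energy \<alpha> \<beta> m p (pi - \<theta>)"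
    unfolding jacobi_energy_def v d by simp
qed

text \<open>By Jordan's inequality \<open>n * sin x\<close> is at least
  \<open>2 * \<epsilon> / pi\<close> on this interval, so the phase is bounded there independently
  of \<open>m\<close> and \<open>p\<close>. The 2 in the exponent comes from the difference of two
  phases.\<close>

lemma jacobi_energy_bulk:
  assumes ode: "jacobi_ode \<alpha> \<beta> m p" and \<epsilon>: "0 < \<epsilon>" "\<epsilon> \<le> 1"
    and \<theta>: "\<theta> \<in> {\<epsilon> / real (Suc m)..pi - \<epsilon> / real (Suc m)}"
    and \<phi>: "\<phi> \<in> {\<epsilon> / real (Suc m)..pi - \<epsilon> / real (Suc m)}"
  shows "jacobi_energy \<alpha> \<beta> m p \<theta>
    \<le> exp (2 * energy_const \<alpha> \<beta> * (pi + pi / (2 * \<epsilon>))) * jacobi_energy \<alpha> \<beta> m p \<phi>"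
proof -
  define n where "n = real (Suc m)"
  define B where "B = energy_const \<alpha> \<beta> * (pi + pi / (2 * \<epsilon>))"
  have n: "n \<ge> 1" by (simp add: n_def)
  have c0: "energy_const \<alpha> \<beta> \<ge> 0" by (simp add: energy_const_def)
  have H: "\<bar>energy_phase \<alpha> \<beta> m x\<bar> \<le> B" and x0: "0 < x" "x < pi"
    if "x \<in> {\<epsilon> / n..pi - \<epsilon> / n}" for x
  proof -
    have "0 < \<epsilon> / n" using \<epsilon> n by simp
    then show x: "0 < x" "x < pi" using that by auto
    have "\<epsilon> / n \<le> 1" using \<epsilon> n by (simp add: divide_le_eq)
    have "2 * (\<epsilon> / n) / pi \<le> sin x"
    proof (cases "x \<le> pi / 2")
      case True
      have "2 * (\<epsilon> / n) / pi \<le> 2 * x / pi" using that by (intro divide_right_mono) auto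
      also have "\<dots> \<le> sin x" using x True by (intro sin_ge_two_div_pi) auto
      finally show ?thesis .
    next
      case False
      have "2 * (\<epsilon> / n) / pi \<le> 2 * (pi - x) / pi" using that by (intro divide_right_mono) auto
      also have "\<dots> \<le> sin (pi - x)" using x False by (intro sin_ge_two_div_pi) auto
      finally show ?thesis by simp
    qed
    then have s: "2 * \<epsilon> / pi \<le> n * sin x" using n by (simp add: field_simps)
    have s0: "2 * \<epsilon> / pi > 0" using \<epsilon> by simp
    have "\<bar>cos x / (n * sin x)\<bar> \<le> 1 / (2 * \<epsilon> / pi)"
      using s s0 unfolding abs_divide by (intro frac_le) auto
    then have "\<bar>cos x / (n * sin x)\<bar> \<le> pi / (2 * \<epsilon>)" by simp
    then have "\<bar>x - cos x / (n * sin x)\<bar> \<le> pi + pi / (2 * \<epsilon>)"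
      using x by linarith
    then show "\<bar>energy_phase \<alpha> \<beta> m x\<bar> \<le> B"
      using c0 unfolding energy_phase_def B_def n_def[symmetric] abs_mult by (intro mult_mono) auto
  qed
  have *: "exp \<Delta> * E \<le> exp (2 * B) * E" if "\<Delta> \<le> 2 * B" "E \<ge> 0" for \<Delta> E :: real
    using that by (intro mult_right_mono) auto
  have "jacobi_energy \<alpha> \<beta> m p \<theta> \<le> exp (2 * B) * jacobi_energy \<alpha> \<beta> m p \<phi>"
  proof (cases "\<theta> \<le> \<phi>")
    case True
    show ?thesis
      by (rule order_trans[OF jacobi_energy_compare(1)[OF ode _ True] *])
        (use H[of \<theta>] H[of \<phi>] x0[of \<theta>] x0[of \<phi>] \<theta> \<phi> jacobi_energy_nonneg in \<open>auto simp: n_def\<close>)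
  next
    case False
    then have "\<phi> \<le> \<theta>" by simp
    show ?thesis
      by (rule order_trans[OF jacobi_energy_compare(2)[OF ode _ \<open>\<phi> \<le> \<theta>\<close>] *])
        (use H[of \<theta>] H[of \<phi>] x0[of \<theta>] x0[of \<phi>] \<theta> \<phi> jacobi_energy_nonneg in \<open>auto simp: n_def\<close>)
  qed
  then show ?thesis by (simp add: B_def mult.assoc)
qed

section \<open>The energy at distance of order 1/n from an endpoint\<close>

definition edge_eps :: "real \<Rightarrow> real \<Rightarrow> real" where
  "edge_eps \<alpha> \<beta> = 1 / (2 * edge_const \<alpha> \<beta>)"

text \<open>\<open>1 - cos \<theta> \<le> \<theta>\<^sup>2 / 2\<close> brings the angle into the
  radius of \<open>jacobi_ode_edge\<close>, with a factor \<open>1 / (2 * K) \<le> 1\<close> to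
  spare.\<close>

lemma edge_angle:
  assumes \<alpha>: "\<alpha> > -1" and \<beta>: "\<beta> > -1" and "0 \<le> \<theta>" "\<theta> \<le> edge_eps \<alpha> \<beta> / real (Suc m)"
  shows "1 - cos \<theta> \<le> 1 / (4 * edge_const \<alpha> \<beta> * (real (Suc m))\<^sup>2)"
proof -
  define K n where "K = edge_const \<alpha> \<beta>" and "n = real (Suc m)"
  have K: "K \<ge> 1" unfolding K_def by (rule edge_const_ge_1[OF \<alpha> \<beta>])
  have n: "n \<ge> 1" by (simp add: n_def)
  have "sin (\<theta> / 2) \<le> \<theta> / 2" using assms by (intro sin_x_le_x) auto
  moreover have th: "\<theta> \<le> 1 / (2 * K * n)" using assms(4) by (simp add: edge_eps_def K_def n_def)
  have "1 / (2 * K * n) \<le> 1" using K n mult_mono[of 1 K 1 n] by (simp add: divide_le_eq)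
  then have "sin (\<theta> / 2) \<ge> 0" using assms th pi_gt3 by (intro sin_ge_zero) auto
  ultimately have "(sin (\<theta> / 2))\<^sup>2 \<le> (\<theta> / 2)\<^sup>2" by (intro power_mono) auto
  moreover have "1 - cos \<theta> = 2 * (sin (\<theta> / 2))\<^sup>2"
    using cos_double_sin[of "\<theta> / 2"] by simp
  ultimately have "1 - cos \<theta> \<le> \<theta>\<^sup>2 / 2" by (simp add: power_divide)
  also have "\<dots> \<le> (1 / (2 * K * n))\<^sup>2 / 2"
    using assms(3) th by (intro divide_right_mono power_mono) auto
  also have "\<dots> = (1 / (4 * K * n\<^sup>2)) * (1 / (2 * K))"
    by (simp add: power_divide power_mult_distrib power2_eq_square)
  also have "\<dots> \<le> (1 / (4 * K * n\<^sup>2)) * 1"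
    using K by (intro mult_left_mono) auto
  finally show ?thesis by (simp add: K_def n_def)
qed

text \<open>At this angle the weight is of order \<open>n powr (- \<alpha> - 1/2)\<close> and
  \<open>p\<close> is comparable to its value at 1, so \<open>n * v\<close> alone has the claimed
  size and gives the lower bound. For the upper bound, \<open>d\<close> is no larger:
  \<open>g\<close> is of order \<open>n\<close>, and the factor \<open>n\<^sup>2\<close> in the
  bound of \<open>p'\<close> is reduced to \<open>n\<close> by \<open>sin \<theta>\<close>.\<close>

lemma jacobi_energy_edge:
  assumes \<alpha>: "\<alpha> > -1" and \<beta>: "\<beta> > -1" and \<epsilon>: "0 < \<epsilon>" "\<epsilon> \<le> edge_eps \<alpha> \<beta>"
  obtains C where "C > 0" and "\<And>m p. jacobi_ode \<alpha> \<beta> m p \<Longrightarrow>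
     sqrt (jacobi_energy \<alpha> \<beta> m p (\<epsilon> / real (Suc m))) \<le> C * (real (Suc m) powr (1/2 - \<alpha>) * \<bar>poly p 1\<bar>)"
    "\<And>m p. jacobi_ode \<alpha> \<beta> m p \<Longrightarrow>
     real (Suc m) powr (1/2 - \<alpha>) * \<bar>poly p 1\<bar> \<le> C * sqrt (jacobi_energy \<alpha> \<beta> m p (\<epsilon> / real (Suc m)))"
proof -
  define a b where "a = \<alpha> + 1/2" and "b = \<beta> + 1/2"
  define K where "K = edge_const \<alpha> \<beta>"
  have K: "K \<ge> 1" unfolding K_def by (rule edge_const_ge_1[OF \<alpha> \<beta>])
  \<comment> \<open>Bounds for the two factors of \<open>n powr a * W\<close>: below,
    \<open>n * sin (\<theta> / 2)\<close> lies between \<open>\<epsilon> / pi\<close> and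
    \<open>\<epsilon> / 2\<close>, and \<open>cos (\<theta> / 2)\<close> between 1/2 and 1.\<close>
  define l1 l2 u1 u2 where "l1 = min ((\<epsilon> / pi) powr a) ((\<epsilon> / 2) powr a)"
    and "l2 = min ((1/2) powr b) (1 powr b)" and "u1 = max ((\<epsilon> / pi) powr a) ((\<epsilon> / 2) powr a)"
    and "u2 = max ((1/2) powr b) (1 powr b)"
  have pos: "l1 > 0" "l2 > 0" "u1 > 0" "u2 > 0"
    using \<epsilon> by (simp_all add: l1_def l2_def u1_def u2_def less_max_iff_disj)
  define A1 A2 where "A1 = l1 * l2" and "A2 = u1 * u2"
  have A1: "A1 > 0" and A2: "A2 > 0" using pos by (simp_all add: A1_def A2_def)
  define M where "M = (\<bar>\<alpha> - \<beta>\<bar> + \<bar>\<alpha> + \<beta> + 1\<bar>) * pi / (4 * \<epsilon>)"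
  have M: "M \<ge> 0" using \<epsilon> by (simp add: M_def)
  have "1 / (2 * K) \<le> 1 / 2" using K by simp
  then have \<epsilon>1: "\<epsilon> \<le> 1/2" using \<epsilon> by (simp add: edge_eps_def K_def)
  define C where "C = 2 * M * A2 + 2 * K * \<epsilon> * A2 + 2 * A2 + 2 / A1"
  have C: "C > 0" unfolding C_def using M K \<epsilon> A1 A2 by (intro add_nonneg_pos add_nonneg_nonneg) auto
  have main: "sqrt (jacobi_energy \<alpha> \<beta> m p (\<epsilon> / real (Suc m))) \<le> C * (real (Suc m) powr (1/2 - \<alpha>) * \<bar>poly p 1\<bar>)
    \<and> real (Suc m) powr (1/2 - \<alpha>) * \<bar>poly p 1\<bar> \<le> C * sqrt (jacobi_energy \<alpha> \<beta> m p (\<epsilon> / real (Suc m)))"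
    if ode: "jacobi_ode \<alpha> \<beta> m p" for m p
  proof -
    define n where "n = real (Suc m)"
    have n: "n \<ge> 1" by (simp add: n_def)
    define \<theta> where "\<theta> = \<epsilon> / n"
    have "\<theta> \<le> \<epsilon>" using n \<epsilon> by (simp add: \<theta>_def divide_le_eq)
    then have \<theta>: "0 < \<theta>" "\<theta> \<le> 1/2" using n \<epsilon> \<epsilon>1 by (auto simp: \<theta>_def)
    then have \<theta>pi: "\<theta> < pi" using pi_gt3 by simp
    define Q where "Q = \<bar>poly p 1\<bar>"
    have Q: "Q \<ge> 0" by (simp add: Q_def)
    define W where "W = jacobi_weight \<alpha> \<beta> \<theta>"
    have W0: "W > 0" unfolding W_def by (rule jacobi_weight_pos[OF \<theta>(1) \<theta>pi])
    have "\<theta> \<le> edge_eps \<alpha> \<beta> / n" unfolding \<theta>_def using \<epsilon> n by (intro divide_right_mono) auto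
    then have cos: "1 - cos \<theta> \<le> 1 / (4 * edge_const \<alpha> \<beta> * (real (Suc m))\<^sup>2)"
      using \<alpha> \<beta> \<theta> by (intro edge_angle) (auto simp: n_def)
    have "\<bar>poly p (cos \<theta>) - poly p 1\<bar> \<le> \<bar>poly p 1\<bar> / 2"
      by (rule jacobi_ode_edge(1)[OF \<alpha> \<beta> ode _ cos]) simp
    then have p: "\<bar>poly p (cos \<theta>)\<bar> \<le> 2 * Q" "Q \<le> 2 * \<bar>poly p (cos \<theta>)\<bar>"
      unfolding Q_def by arith+
    have p': "\<bar>poly (pderiv p) (cos \<theta>)\<bar> \<le> 2 * K * n\<^sup>2 * Q"
      using jacobi_ode_edge(2)[OF \<alpha> \<beta> ode _ cos] unfolding Q_def K_def n_def by auto
    have Wn: "n powr a * W = (n * sin (\<theta> / 2)) powr a * cos (\<theta> / 2) powr b"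
      using n half_angle_pos(1)[OF \<theta>(1) \<theta>pi] by (simp add: W_def jacobi_weight_def a_def b_def powr_mult)
    have s1: "\<epsilon> / pi \<le> n * sin (\<theta> / 2)"
    proof -
      have "2 * (\<theta> / 2) / pi \<le> sin (\<theta> / 2)" using \<theta> \<theta>pi by (intro sin_ge_two_div_pi) auto
      then have "n * (\<theta> / pi) \<le> n * sin (\<theta> / 2)" using n by (intro mult_left_mono) auto
      then show ?thesis using n by (simp add: \<theta>_def)
    qed
    have s2: "n * sin (\<theta> / 2) \<le> \<epsilon> / 2"
    proof -
      have "n * sin (\<theta> / 2) \<le> n * (\<theta> / 2)" using n \<theta> by (intro mult_left_mono sin_x_le_x) auto
      then show ?thesis using n by (simp add: \<theta>_def)
    qed
    have c1: "1/2 \<le> cos (\<theta> / 2)"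
    proof -
      have "cos (pi / 3) \<le> cos (\<theta> / 2)" using \<theta> pi_gt3 by (intro cos_monotone_0_pi_le) auto
      then show ?thesis by (simp add: cos_60)
    qed
    have "0 < \<epsilon> / pi" using \<epsilon> by simp
    note sb = powr_between[OF this s1 s2, of a, folded l1_def u1_def]
    have cb: "cos (\<theta> / 2) powr b \<le> u2" "l2 \<le> cos (\<theta> / 2) powr b"
      unfolding l2_def u2_def by (rule powr_between[OF _ c1 cos_le_one], simp)+
    have W1: "A1 \<le> n powr a * W"
      unfolding Wn A1_def by (rule mult_mono[OF sb(2) cb(2)]) (use pos in auto)
    have W2: "n powr a * W \<le> A2"
      unfolding Wn A2_def by (rule mult_mono[OF sb(1) cb(1)]) (use pos in auto)
    define N where "N = n powr (1/2 - \<alpha>)"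
    have N: "n powr a * N = n"
      using n by (simp add: N_def a_def flip: powr_add)
    have N0: "N > 0" using n by (simp add: N_def)
    have nW: "(n powr a * W) * N = n * W"
      by (subst (2) N[symmetric]) (simp add: mult_ac)
    have nW_bounds: "A1 * N \<le> n * W" "n * W \<le> A2 * N"
      using mult_right_mono[OF W1, of N] mult_right_mono[OF W2, of N] N0 unfolding nW by auto
    have v: "n * \<bar>jacobi_v \<alpha> \<beta> p \<theta>\<bar> = (n * W) * \<bar>poly p (cos \<theta>)\<bar>"
      using W0 by (simp add: jacobi_v_def W_def[symmetric] abs_mult)
    have v1: "n * \<bar>jacobi_v \<alpha> \<beta> p \<theta>\<bar> \<le> (A2 * N) * (2 * Q)"
      unfolding v by (rule mult_mono[OF nW_bounds(2) p(1)]) (use N0 A2 in auto)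
    have v2: "(A1 * N) * (Q / 2) \<le> n * \<bar>jacobi_v \<alpha> \<beta> p \<theta>\<bar>"
      unfolding v by (rule mult_mono[OF nW_bounds(1)]) (use p N0 A1 n W0 Q in auto)
    have sin: "2 * \<epsilon> / pi \<le> n * sin \<theta>" "n * sin \<theta> \<le> \<epsilon>"
    proof -
      have "2 * \<theta> / pi \<le> sin \<theta>" using \<theta> pi_gt3 by (intro sin_ge_two_div_pi) auto
      then have "n * (2 * \<theta> / pi) \<le> n * sin \<theta>" using n by (intro mult_left_mono) auto
      then show "2 * \<epsilon> / pi \<le> n * sin \<theta>" using n by (simp add: \<theta>_def)
      have "n * sin \<theta> \<le> n * \<theta>" using n \<theta> by (intro mult_left_mono sin_x_le_x) auto
      then show "n * sin \<theta> \<le> \<epsilon>" using n by (simp add: \<theta>_def)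
    qed
    have sin0: "sin \<theta> > 0" using half_angle_pos[OF \<theta>(1) \<theta>pi] by simp
    have g: "\<bar>jacobi_g \<alpha> \<beta> \<theta>\<bar> \<le> M * n"
    proof -
      have "\<bar>\<alpha> - \<beta> + (\<alpha> + \<beta> + 1) * cos \<theta>\<bar> \<le> \<bar>\<alpha> - \<beta>\<bar> + \<bar>\<alpha> + \<beta> + 1\<bar> * \<bar>cos \<theta>\<bar>"
        by (rule order_trans[OF abs_triangle_ineq]) (simp add: abs_mult)
      also have "\<dots> \<le> \<bar>\<alpha> - \<beta>\<bar> + \<bar>\<alpha> + \<beta> + 1\<bar> * 1"
        by (intro add_left_mono mult_left_mono) auto
      finally have num: "\<bar>\<alpha> - \<beta> + (\<alpha> + \<beta> + 1) * cos \<theta>\<bar> \<le> \<bar>\<alpha> - \<beta>\<bar> + \<bar>\<alpha> + \<beta> + 1\<bar>" by simp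
      have "2 * (2 * \<epsilon> / (pi * n)) \<le> 2 * sin \<theta>" using sin(1) n by (simp add: field_simps)
      then have "\<bar>jacobi_g \<alpha> \<beta> \<theta>\<bar> \<le> (\<bar>\<alpha> - \<beta>\<bar> + \<bar>\<alpha> + \<beta> + 1\<bar>) / (2 * (2 * \<epsilon> / (pi * n)))"
        unfolding jacobi_g_def abs_divide using num sin0 \<epsilon> n by (intro frac_le) auto
      also have "\<dots> = M * n" by (simp add: M_def field_simps)
      finally show ?thesis .
    qed
    have w: "\<bar>jacobi_w \<alpha> \<beta> p \<theta>\<bar> \<le> (A2 * N) * (2 * K * Q) * \<epsilon>"
    proof -
      have "\<bar>jacobi_w \<alpha> \<beta> p \<theta>\<bar> = W * (\<bar>poly (pderiv p) (cos \<theta>)\<bar> * sin \<theta>)"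
        using W0 sin0 by (simp add: jacobi_w_def W_def[symmetric] abs_mult)
      also have "\<dots> \<le> W * ((2 * K * n\<^sup>2 * Q) * sin \<theta>)"
        using p' W0 sin0 by (intro mult_left_mono mult_right_mono) auto
      also have "\<dots> = (n * W) * (2 * K * Q) * (n * sin \<theta>)" by (simp add: power2_eq_square mult_ac)
      also have "\<dots> \<le> (A2 * N) * (2 * K * Q) * \<epsilon>"
        by (rule mult_mono[OF mult_right_mono[OF nW_bounds(2)] sin(2)]) (use sin0 n W0 K Q A2 N0 in auto)
      finally show ?thesis .
    qed
    have d: "\<bar>jacobi_d \<alpha> \<beta> p \<theta>\<bar> \<le> (2 * M * A2 + 2 * K * \<epsilon> * A2) * (N * Q)"
    proof -
      have "\<bar>jacobi_d \<alpha> \<beta> p \<theta>\<bar> \<le> \<bar>jacobi_g \<alpha> \<beta> \<theta>\<bar> * \<bar>jacobi_v \<alpha> \<beta> p \<theta>\<bar> + \<bar>jacobi_w \<alpha> \<beta> p \<theta>\<bar>"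
        unfolding jacobi_d_def by (rule order_trans[OF abs_triangle_ineq4]) (simp add: abs_mult)
      also have "\<dots> \<le> M * n * \<bar>jacobi_v \<alpha> \<beta> p \<theta>\<bar> + (A2 * N) * (2 * K * Q) * \<epsilon>"
        using g w by (intro add_mono mult_right_mono) auto
      also have "\<dots> \<le> M * ((A2 * N) * (2 * Q)) + (A2 * N) * (2 * K * Q) * \<epsilon>"
        using v1 M by (simp add: mult.assoc mult_left_mono)
      finally show ?thesis by (simp add: algebra_simps)
    qed
    have "sqrt (jacobi_energy \<alpha> \<beta> m p \<theta>) \<le> \<bar>jacobi_d \<alpha> \<beta> p \<theta>\<bar> + \<bar>n * jacobi_v \<alpha> \<beta> p \<theta>\<bar>"
      unfolding jacobi_energy_def n_def[symmetric] by (rule sqrt_sum_squares_le_sum_abs)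
    also have "\<dots> = \<bar>jacobi_d \<alpha> \<beta> p \<theta>\<bar> + n * \<bar>jacobi_v \<alpha> \<beta> p \<theta>\<bar>" using n by (simp add: abs_mult)
    also have "\<dots> \<le> (2 * M * A2 + 2 * K * \<epsilon> * A2 + 2 * A2) * (N * Q)"
      using d v1 by (simp add: algebra_simps)
    also have "\<dots> \<le> C * (N * Q)"
      using N0 Q A1 by (intro mult_right_mono) (auto simp: C_def)
    finally have 1: "sqrt (jacobi_energy \<alpha> \<beta> m p \<theta>) \<le> C * (N * Q)" .
    have "n * \<bar>jacobi_v \<alpha> \<beta> p \<theta>\<bar> = sqrt ((n * jacobi_v \<alpha> \<beta> p \<theta>)\<^sup>2)" using n by (simp add: abs_mult)
    also have "\<dots> \<le> sqrt (jacobi_energy \<alpha> \<beta> m p \<theta>)"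
      by (intro real_sqrt_le_mono) (simp add: jacobi_energy_def n_def)
    finally have "A1 * (N * Q) \<le> 2 * sqrt (jacobi_energy \<alpha> \<beta> m p \<theta>)" using v2 by (simp add: mult_ac)
    then have "N * Q \<le> 2 / A1 * sqrt (jacobi_energy \<alpha> \<beta> m p \<theta>)"
      using A1 by (simp add: pos_le_divide_eq mult.commute)
    also have "\<dots> \<le> C * sqrt (jacobi_energy \<alpha> \<beta> m p \<theta>)"
      using M K \<epsilon> A2 jacobi_energy_nonneg by (intro mult_right_mono) (auto simp: C_def)
    finally have 2: "N * Q \<le> C * sqrt (jacobi_energy \<alpha> \<beta> m p \<theta>)" .
    show ?thesis using 1 2 unfolding N_def Q_def \<theta>_def n_def by (rule conjI)
  qed
  show ?thesis by (rule that[OF C]) (simp_all only: main)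
qed

section \<open>Size of the Jacobi polynomials\<close>

text \<open>All that the later estimates use of the energy: \<open>G\<close> stands for its square
  root, and \<epsilon> and \<open>C\<close> will be uniform in \<open>m\<close> and
  \<open>p\<close>. The zeros keep twice the width of the caps from the endpoints, so that a zero
  and a point of a cap are always separated.\<close>

definition jacobi_profile :: "real \<Rightarrow> real \<Rightarrow> nat \<Rightarrow> real poly \<Rightarrow> real \<Rightarrow> real \<Rightarrow> real \<Rightarrow> bool" where
  "jacobi_profile \<alpha> \<beta> m p \<epsilon> C G \<longleftrightarrow>
     G \<le> C * (real (Suc m) powr (1/2 - \<alpha>) * \<bar>poly p 1\<bar>) \<and>
     (\<forall>\<theta>\<in>{\<epsilon> / real (Suc m)..pi - \<epsilon> / real (Suc m)}.
        real (Suc m) * \<bar>jacobi_v \<alpha> \<beta> p \<theta>\<bar> \<le> C * G \<and> \<bar>jacobi_d \<alpha> \<beta> p \<theta>\<bar> \<le> C * G) \<and>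
     (\<forall>\<theta>\<in>{0<..<pi}. poly p (cos \<theta>) = 0 \<longrightarrow>
        \<theta> \<in> {2 * \<epsilon> / real (Suc m)..pi - 2 * \<epsilon> / real (Suc m)} \<and> G \<le> C * \<bar>jacobi_w \<alpha> \<beta> p \<theta>\<bar>) \<and>
     (\<forall>\<theta>\<in>{0..\<epsilon> / real (Suc m)}. real (Suc m) powr (1/2 - \<alpha>) * \<bar>poly p (cos \<theta>)\<bar> \<le> C * G) \<and>
     (\<forall>\<theta>\<in>{pi - \<epsilon> / real (Suc m)..pi}. real (Suc m) powr (1/2 - \<beta>) * \<bar>poly p (cos \<theta>)\<bar> \<le> C * G)"

lemma jacobi_near_1:
  assumes \<alpha>: "\<alpha> > -1" and \<beta>: "\<beta> > -1" and ode: "jacobi_ode \<alpha> \<beta> m p"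
    and \<theta>: "0 \<le> \<theta>" "\<theta> \<le> edge_eps \<alpha> \<beta> / real (Suc m)"
  shows "\<bar>poly p (cos \<theta>)\<bar> \<le> 2 * \<bar>poly p 1\<bar>" "\<bar>poly p 1\<bar> \<le> 2 * \<bar>poly p (cos \<theta>)\<bar>"
proof -
  have "\<bar>poly p (cos \<theta>) - poly p 1\<bar> \<le> \<bar>poly p 1\<bar> / 2"
    by (rule jacobi_ode_edge(1)[OF \<alpha> \<beta> ode _ edge_angle[OF \<alpha> \<beta> \<theta>]]) simp
  then show "\<bar>poly p (cos \<theta>)\<bar> \<le> 2 * \<bar>poly p 1\<bar>" "\<bar>poly p 1\<bar> \<le> 2 * \<bar>poly p (cos \<theta>)\<bar>" by arith+
qed

text \<open>\<open>G\<close> is the square root of the energy at \<open>pi / 2\<close>. The bulk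
  comparison carries it to the zeros, where only \<open>w\<close> is left of the energy, and to both
  edges, where it meets the endpoint values; the edge at \<open>pi\<close> is treated through the
  reflected polynomial \<open>q\<close>.\<close>

lemma jacobi_profile_exists:
  assumes \<alpha>: "\<alpha> > -1" and \<beta>: "\<beta> > -1"
  obtains \<epsilon> C where "0 < \<epsilon>" "\<epsilon> \<le> 1/4" "C > 0"
    "\<And>m p. jacobi_ode \<alpha> \<beta> m p \<Longrightarrow> p \<noteq> 0 \<Longrightarrow> \<exists>G>0. jacobi_profile \<alpha> \<beta> m p \<epsilon> C G"
proof -
  \<comment> \<open>Halved so that angles up to \<open>2 * \<epsilon> / n\<close> are still in the
    range where \<open>p\<close> is comparable to its endpoint value, hence nonzero.\<close>
  define \<epsilon> where "\<epsilon> = min (edge_eps \<alpha> \<beta>) (edge_eps \<beta> \<alpha>) / 2"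
  have K: "edge_const \<alpha> \<beta> \<ge> 1" "edge_const \<beta> \<alpha> \<ge> 1"
    using edge_const_ge_1[OF \<alpha> \<beta>] edge_const_ge_1[OF \<beta> \<alpha>] by auto
  then have "0 < edge_eps \<alpha> \<beta>" "0 < edge_eps \<beta> \<alpha>" "edge_eps \<alpha> \<beta> \<le> 1/2"
    by (auto simp: edge_eps_def divide_le_eq)
  then have \<epsilon>: "0 < \<epsilon>" "\<epsilon> \<le> 1/4" "2 * \<epsilon> \<le> edge_eps \<alpha> \<beta>" "2 * \<epsilon> \<le> edge_eps \<beta> \<alpha>"
    by (auto simp: \<epsilon>_def)
  then have \<epsilon>': "\<epsilon> \<le> edge_eps \<alpha> \<beta>" "\<epsilon> \<le> edge_eps \<beta> \<alpha>" "\<epsilon> \<le> 1" by linarith+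
  obtain C1 where C1: "C1 > 0" "\<And>m p. jacobi_ode \<alpha> \<beta> m p \<Longrightarrow>
     sqrt (jacobi_energy \<alpha> \<beta> m p (\<epsilon> / real (Suc m))) \<le> C1 * (real (Suc m) powr (1/2 - \<alpha>) * \<bar>poly p 1\<bar>)"
    "\<And>m p. jacobi_ode \<alpha> \<beta> m p \<Longrightarrow>
     real (Suc m) powr (1/2 - \<alpha>) * \<bar>poly p 1\<bar> \<le> C1 * sqrt (jacobi_energy \<alpha> \<beta> m p (\<epsilon> / real (Suc m)))"
    using jacobi_energy_edge[OF \<alpha> \<beta> \<epsilon>(1) \<epsilon>'(1)] by metis
  obtain C2 where C2: "C2 > 0"
    "\<And>m p. jacobi_ode \<beta> \<alpha> m p \<Longrightarrow>
     real (Suc m) powr (1/2 - \<beta>) * \<bar>poly p 1\<bar> \<le> C2 * sqrt (jacobi_energy \<beta> \<alpha> m p (\<epsilon> / real (Suc m)))"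
    using jacobi_energy_edge[OF \<beta> \<alpha> \<epsilon>(1) \<epsilon>'(2)] by metis
  define B where "B = sqrt (exp (2 * energy_const \<alpha> \<beta> * (pi + pi / (2 * \<epsilon>))))"
  have B: "B > 0" by (simp add: B_def)
  define C where "C = B + C1 * B + 2 * C1 * B + 2 * C2 * B"
  have C: "C > 0" unfolding C_def using B C1(1) C2(1) by (intro add_pos_pos mult_pos_pos) auto
  have CB: "B \<le> C" "C1 * B \<le> C" "2 * C1 * B \<le> C" "2 * C2 * B \<le> C"
    using B C1(1) C2(1) by (simp_all add: C_def)
  have "\<exists>G>0. jacobi_profile \<alpha> \<beta> m p \<epsilon> C G" if ode: "jacobi_ode \<alpha> \<beta> m p" and "p \<noteq> 0" for m p
  proof -
    define n where "n = real (Suc m)"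
    have n: "n \<ge> 1" by (simp add: n_def)
    have en: "0 < \<epsilon> / n" "\<epsilon> / n \<le> 1/4" using \<epsilon> n by (auto simp: divide_le_eq)
    define I where "I = {\<epsilon> / n..pi - \<epsilon> / n}"
    define S where "S \<theta> = sqrt (jacobi_energy \<alpha> \<beta> m p \<theta>)" for \<theta>
    have S: "S \<theta> \<le> B * S \<phi>" if "\<theta> \<in> I" "\<phi> \<in> I" for \<theta> \<phi>
      unfolding S_def B_def real_sqrt_mult[symmetric]
      by (intro real_sqrt_le_mono jacobi_energy_bulk[OF ode \<epsilon>(1) \<epsilon>'(3)]) (use that in \<open>auto simp: I_def n_def\<close>)
    define G where "G = S (pi / 2)"
    have I: "pi / 2 \<in> I" "\<epsilon> / n \<in> I" "pi - \<epsilon> / n \<in> I"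
      unfolding I_def atLeastAtMost_iff using en pi_gt3 by linarith+
    define q where "q = pcompose p [:0, -1:]"
    have q: "jacobi_ode \<beta> \<alpha> m q" unfolding q_def by (rule jacobi_ode_reflect[OF ode])
    have poly_q: "poly q t = poly p (- t)" for t by (simp add: q_def poly_pcompose)
    have "q \<noteq> 0" using \<open>p \<noteq> 0\<close> poly_q by (metis add.inverse_inverse poly_0 poly_all_0_iff_0)
    have p1: "poly p 1 \<noteq> 0" by (rule jacobi_ode_at_1[OF \<alpha> \<beta> ode \<open>p \<noteq> 0\<close>])
    have q1: "poly q 1 \<noteq> 0" by (rule jacobi_ode_at_1[OF \<beta> \<alpha> q \<open>q \<noteq> 0\<close>])
    have Sq: "sqrt (jacobi_energy \<beta> \<alpha> m q (\<epsilon> / real (Suc m))) = S (pi - \<epsilon> / n)"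
    proof -
      have "\<epsilon> / n < pi" using en pi_gt3 by linarith
      then show ?thesis
        using jacobi_reflect(4)[of "\<epsilon> / n" \<beta> \<alpha> m p] en(1) by (simp only: S_def q_def n_def)
    qed
    define A where "A = n powr (1/2 - \<alpha>) * \<bar>poly p 1\<bar>"
    define A' where "A' = n powr (1/2 - \<beta>) * \<bar>poly q 1\<bar>"
    have "A > 0" using n p1 by (simp add: A_def)
    have A1: "S (\<epsilon> / n) \<le> C1 * A" "A \<le> C1 * S (\<epsilon> / n)"
      using C1(2,3)[OF ode] by (simp_all only: A_def S_def n_def)
    have A2: "A' \<le> C2 * S (pi - \<epsilon> / n)"
      using C2(2)[OF q] by (simp only: A'_def Sq n_def)
    have AG: "A \<le> C1 * (B * G)"
      by (rule order_trans[OF A1(2) mult_left_mono]) (use S[OF I(2,1)] C1(1) in \<open>auto simp: G_def\<close>)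
    have A'G: "A' \<le> C2 * (B * G)"
      by (rule order_trans[OF A2 mult_left_mono]) (use S[OF I(3,1)] C2(1) in \<open>auto simp: G_def\<close>)
    have G0: "G > 0"
    proof (rule ccontr)
      assume "\<not> G > 0"
      then have "C1 * (B * G) \<le> 0" using C1(1) B by (simp add: mult_le_0_iff)
      then show False using AG \<open>A > 0\<close> by simp
    qed
    have scale: "x \<le> C * G" if "x \<le> c * B * G" "c * B \<le> C" for x c
      by (rule order_trans[OF that(1)]) (use that(2) G0 in \<open>simp add: mult_right_mono\<close>)
    have "G \<le> C * A"
    proof -
      have "G \<le> B * (C1 * A)"
        unfolding G_def by (rule order_trans[OF S[OF I(1,2)]]) (use A1 B in \<open>simp add: mult_left_mono\<close>)
      also have "\<dots> = (C1 * B) * A" by simp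
      also have "\<dots> \<le> C * A" using CB \<open>A > 0\<close> by (intro mult_right_mono) auto
      finally show ?thesis .
    qed
    moreover have "n * \<bar>jacobi_v \<alpha> \<beta> p \<theta>\<bar> \<le> C * G \<and> \<bar>jacobi_d \<alpha> \<beta> p \<theta>\<bar> \<le> C * G" if "\<theta> \<in> I" for \<theta>
    proof -
      have SG: "S \<theta> \<le> 1 * B * G" using S[OF that I(1)] by (simp add: G_def)
      have "\<bar>n * jacobi_v \<alpha> \<beta> p \<theta>\<bar> \<le> S \<theta>" "\<bar>jacobi_d \<alpha> \<beta> p \<theta>\<bar> \<le> S \<theta>"
        unfolding S_def jacobi_energy_def n_def real_sqrt_abs[symmetric] by (rule real_sqrt_le_mono; simp)+
      then have "\<bar>n * jacobi_v \<alpha> \<beta> p \<theta>\<bar> \<le> C * G" "\<bar>jacobi_d \<alpha> \<beta> p \<theta>\<bar> \<le> C * G"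
        using scale[OF SG] CB(1) by auto
      then show ?thesis using n by (simp add: abs_mult)
    qed
    moreover have "\<theta> \<in> {2 * \<epsilon> / n..pi - 2 * \<epsilon> / n} \<and> G \<le> C * \<bar>jacobi_w \<alpha> \<beta> p \<theta>\<bar>"
      if \<theta>: "\<theta> \<in> {0<..<pi}" and zero: "poly p (cos \<theta>) = 0" for \<theta>
    proof -
      have "\<theta> \<ge> 2 * \<epsilon> / n"
      proof (rule ccontr)
        assume "\<not> \<theta> \<ge> 2 * \<epsilon> / n"
        then have "\<theta> \<le> 2 * \<epsilon> / n" by simp
        also have "\<dots> \<le> edge_eps \<alpha> \<beta> / n" using \<epsilon> n by (intro divide_right_mono) auto
        finally show False using jacobi_near_1(2)[OF \<alpha> \<beta> ode, of \<theta>] zero p1 \<theta> by (simp add: n_def)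
      qed
      moreover have "\<theta> \<le> pi - 2 * \<epsilon> / n"
      proof (rule ccontr)
        assume "\<not> \<theta> \<le> pi - 2 * \<epsilon> / n"
        then have "pi - \<theta> \<le> 2 * \<epsilon> / n" by simp
        also have "\<dots> \<le> edge_eps \<beta> \<alpha> / n" using \<epsilon> n by (intro divide_right_mono) auto
        finally show False using jacobi_near_1(2)[OF \<beta> \<alpha> q, of "pi - \<theta>"] zero q1 \<theta> by (simp add: n_def poly_q)
      qed
      ultimately have range: "\<theta> \<in> {2 * \<epsilon> / n..pi - 2 * \<epsilon> / n}" by simp
      have "\<epsilon> / n \<le> 2 * \<epsilon> / n" using \<epsilon> n by (intro divide_right_mono) auto
      then have "\<theta> \<in> I" using range by (simp add: I_def)
      have v0: "jacobi_v \<alpha> \<beta> p \<theta> = 0" by (simp add: jacobi_v_def zero)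
      have "S \<theta> = \<bar>jacobi_w \<alpha> \<beta> p \<theta>\<bar>"
        by (simp add: S_def jacobi_energy_def jacobi_d_def v0)
      then have "G \<le> B * \<bar>jacobi_w \<alpha> \<beta> p \<theta>\<bar>" using S[OF I(1) \<open>\<theta> \<in> I\<close>] by (simp add: G_def)
      also have "\<dots> \<le> C * \<bar>jacobi_w \<alpha> \<beta> p \<theta>\<bar>" using CB by (intro mult_right_mono) auto
      finally show ?thesis using range by simp
    qed
    moreover have "n powr (1/2 - \<alpha>) * \<bar>poly p (cos \<theta>)\<bar> \<le> C * G" if "\<theta> \<in> {0..\<epsilon> / n}" for \<theta>
    proof -
      have "\<epsilon> / n \<le> edge_eps \<alpha> \<beta> / n" using \<epsilon>' n by (intro divide_right_mono) auto
      then have "\<bar>poly p (cos \<theta>)\<bar> \<le> 2 * \<bar>poly p 1\<bar>"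
        using that by (intro jacobi_near_1(1)[OF \<alpha> \<beta> ode]) (auto simp: n_def)
      then have "n powr (1/2 - \<alpha>) * \<bar>poly p (cos \<theta>)\<bar> \<le> n powr (1/2 - \<alpha>) * (2 * \<bar>poly p 1\<bar>)"
        by (intro mult_left_mono) auto
      also have "\<dots> = 2 * A" by (simp add: A_def)
      also have "\<dots> \<le> (2 * C1) * B * G" using AG by simp
      finally show ?thesis by (rule scale[OF _ CB(3)])
    qed
    moreover have "n powr (1/2 - \<beta>) * \<bar>poly p (cos \<theta>)\<bar> \<le> C * G" if "\<theta> \<in> {pi - \<epsilon> / n..pi}" for \<theta>
    proof -
      have "\<epsilon> / n \<le> edge_eps \<beta> \<alpha> / n" using \<epsilon>' n by (intro divide_right_mono) auto
      then have "\<bar>poly q (cos (pi - \<theta>))\<bar> \<le> 2 * \<bar>poly q 1\<bar>"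
        using that by (intro jacobi_near_1(1)[OF \<beta> \<alpha> q]) (auto simp: n_def)
      then have "n powr (1/2 - \<beta>) * \<bar>poly p (cos \<theta>)\<bar> \<le> n powr (1/2 - \<beta>) * (2 * \<bar>poly q 1\<bar>)"
        by (intro mult_left_mono) (auto simp: poly_q)
      also have "\<dots> = 2 * A'" by (simp add: A'_def)
      also have "\<dots> \<le> (2 * C2) * B * G" using A'G by simp
      finally show ?thesis by (rule scale[OF _ CB(4)])
    qed
    ultimately have "jacobi_profile \<alpha> \<beta> m p \<epsilon> C G"
      unfolding jacobi_profile_def n_def[symmetric] I_def A_def by blast
    then show ?thesis using G0 by blast
  qed
  then show ?thesis using that \<epsilon> C by blast
qed

section \<open>Power estimates\<close>

text \<open>For nonnegative \<gamma> the power is at most 1; otherwise the worst \<open>a\<close> is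
  \<open>\<delta> / n\<close>. The two lower bounds on \<open>f\<close> belong to these two
  cases.\<close>

lemma powr_le_scale:
  fixes a n :: real
  assumes "0 < \<delta>" "n \<ge> 1" "\<delta> / n \<le> a" "a \<le> 1" "f \<ge> 0" "f \<ge> - \<gamma>"
  shows "a powr \<gamma> \<le> (1 + \<delta> powr \<gamma>) * n powr f"
proof -
  have "0 < \<delta> / n" using assms by simp
  then have a: "a > 0" using assms by linarith
  have n1: "n powr f \<ge> 1" using assms by (simp add: ge_one_powr_ge_zero)
  have "a powr \<gamma> \<le> max 1 (\<delta> powr \<gamma> * n powr f)"
  proof (cases "\<gamma> \<ge> 0")
    case True
    then have "a powr \<gamma> \<le> 1 powr \<gamma>" using a assms by (intro powr_mono2) auto
    then show ?thesis by simp
  next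
    case False
    then have "a powr \<gamma> \<le> (\<delta> / n) powr \<gamma>" using \<open>0 < \<delta> / n\<close> assms by (intro powr_mono2') auto
    also have "\<dots> = \<delta> powr \<gamma> * n powr (- \<gamma>)" using assms by (simp add: powr_divide powr_minus_divide)
    also have "\<dots> \<le> \<delta> powr \<gamma> * n powr f" using assms by (intro mult_left_mono powr_mono) auto
    finally show ?thesis by simp
  qed
  also have "\<dots> \<le> n powr f + \<delta> powr \<gamma> * n powr f"
    by (intro max.boundedI) (use n1 in \<open>auto intro: add_increasing2\<close>)
  finally show ?thesis by (simp add: algebra_simps)
qed

lemma powr_le_two_powr:
  fixes c :: real
  assumes "1/2 \<le> c" "c \<le> 2"
  shows "c powr \<gamma> \<le> 2 powr \<bar>\<gamma>\<bar>"
proof (cases "\<gamma> \<ge> 0")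
  case True
  then show ?thesis using assms by (auto intro: powr_mono2)
next
  case False
  then have "c powr \<gamma> \<le> (1/2) powr \<gamma>" using assms by (intro powr_mono2') auto
  also have "\<dots> = 2 powr (- \<gamma>)" by (simp add: powr_divide powr_minus_divide)
  finally show ?thesis using False by simp
qed

text \<open>One summand for each range of \<open>r = a / b\<close> in \<open>kernel_bound\<close>:
  between 1/2 and 2, below 1/2, above 2.\<close>

definition kernel_const :: "real \<Rightarrow> real \<Rightarrow> real" where
  "kernel_const \<delta> \<gamma> = 2 powr \<bar>\<gamma>\<bar> + 2 / \<delta> * (1 + \<delta> powr (\<gamma> + 1)) + 2 / \<delta> * (1 + \<delta> powr (2 - \<gamma>))"

text \<open>With \<open>r = a / b\<close>, the quotient of the left-hand side by \<open>a + b\<close> is \<open>r powr \<gamma> / (1 + r) * M\<close>. It is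
  \<open>O(r powr (\<gamma> + 1))\<close> for small \<open>r\<close> and \<open>O(r powr (\<gamma> - 2))\<close> for large \<open>r\<close>, because \<open>M = O(min r (1 / r))\<close> there.\<close>

lemma kernel_bound:
  fixes a b n M :: real
  assumes \<delta>: "0 < \<delta>" and n: "n \<ge> 1" and a: "\<delta> / n \<le> a" "a \<le> 1" and b: "\<delta> / n \<le> b" "b \<le> 1"
    and M: "0 \<le> M" "M \<le> 1" "M * (n * \<bar>a - b\<bar>) \<le> 1"
    and e: "e \<ge> 0" "e \<ge> - 1 - \<gamma>" "e \<ge> \<gamma> - 2"
  shows "a powr \<gamma> * b powr (1 - \<gamma>) * M \<le> kernel_const \<delta> \<gamma> * n powr e * (a + b)"
proof -
  have "0 < \<delta> / n" using \<delta> n by simp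
  then have pos: "a > 0" "b > 0" using a b by linarith+
  define r where "r = a / b"
  have r: "r > 0" using pos by (simp add: r_def)
  have lhs: "a powr \<gamma> * b powr (1 - \<gamma>) = r powr \<gamma> * b"
    using pos by (simp add: r_def powr_divide powr_diff)
  have n1: "n powr e \<ge> 1" using n e by (simp add: ge_one_powr_ge_zero)
  have na: "1 / n \<le> a / \<delta>" "1 / n \<le> b / \<delta>" using a b \<delta> n by (simp_all add: field_simps)
  have t: "0 \<le> 2 powr \<bar>\<gamma>\<bar>" "0 \<le> 2 / \<delta> * (1 + \<delta> powr (\<gamma> + 1))" "0 \<le> 2 / \<delta> * (1 + \<delta> powr (2 - \<gamma>))"
    using \<delta> by auto
  have "r powr \<gamma> * M \<le> kernel_const \<delta> \<gamma> * n powr e * (r + 1)"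
  proof -
    consider "r < 1/2" | "1/2 \<le> r" "r \<le> 2" | "r > 2" by linarith
    \<comment> \<open>Proved first with a single term of \<open>r + 1\<close>: \<open>r\<close>
      itself for large \<open>r\<close>, and 1 otherwise.\<close>
    then have "r powr \<gamma> * M \<le> kernel_const \<delta> \<gamma> * n powr e * (if r > 2 then r else 1)"
    proof cases
      case 1
      then have "2 * a < b" using pos by (simp add: r_def field_simps)
      then have "b / 2 \<le> \<bar>a - b\<bar>" by arith
      then have "M * (n * (b / 2)) \<le> M * (n * \<bar>a - b\<bar>)" using M n by (intro mult_left_mono) auto
      then have "M * (n * b) \<le> 2" using M by simp
      \<comment> \<open>The decay \<open>1 / (n * b)\<close> of \<open>M\<close> becomes a factor
        \<open>r\<close>, because the lower bound on \<open>a\<close> gives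
        \<open>1 / n \<le> a / \<delta>\<close>.\<close>
      then have "M \<le> 2 / b * (1 / n)" using pos n by (simp add: field_simps)
      also have "\<dots> \<le> 2 / b * (a / \<delta>)" using na pos by (intro mult_left_mono) auto
      finally have M2: "M \<le> 2 / \<delta> * r" by (simp add: r_def mult_ac)
      have "r powr \<gamma> * M \<le> r powr \<gamma> * (2 / \<delta> * r)" using M2 by (intro mult_left_mono) auto
      also have "\<dots> = 2 / \<delta> * r powr (\<gamma> + 1)" using r by (simp add: powr_add)
      also have "\<dots> \<le> 2 / \<delta> * ((1 + \<delta> powr (\<gamma> + 1)) * n powr e)"
      proof (intro mult_left_mono powr_le_scale)
        have "\<delta> / n \<le> a / 1" using a by simp
        also have "\<dots> \<le> a / b" using pos b by (intro divide_left_mono) auto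
        finally show "\<delta> / n \<le> r" by (simp add: r_def)
      qed (use 1 n \<delta> e in auto)
      also have "\<dots> = (2 / \<delta> * (1 + \<delta> powr (\<gamma> + 1))) * n powr e" by simp
      also have "\<dots> \<le> kernel_const \<delta> \<gamma> * n powr e"
        unfolding kernel_const_def using t by (intro mult_right_mono) auto
      finally show ?thesis using 1 by simp
    next
      case 2
      have "r powr \<gamma> * M \<le> 2 powr \<bar>\<gamma>\<bar> * 1"
        using powr_le_two_powr[OF 2] M by (intro mult_mono) auto
      also have "\<dots> \<le> kernel_const \<delta> \<gamma> * n powr e"
        unfolding kernel_const_def by (rule mult_mono) (use t n1 in auto)
      finally show ?thesis using 2 by simp
    next
      case 3
      then have "2 * b < a" using pos by (simp add: r_def field_simps)
      then have "a / 2 \<le> \<bar>a - b\<bar>" by arith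
      then have "M * (n * (a / 2)) \<le> M * (n * \<bar>a - b\<bar>)" using M n by (intro mult_left_mono) auto
      then have "M * (n * a) \<le> 2" using M by simp
      then have "M \<le> 2 / a * (1 / n)" using pos n by (simp add: field_simps)
      also have "\<dots> \<le> 2 / a * (b / \<delta>)" using na pos by (intro mult_left_mono) auto
      finally have M2: "M \<le> 2 / \<delta> * (1 / r)" by (simp add: r_def mult_ac)
      have "r powr \<gamma> * M \<le> r powr \<gamma> * (2 / \<delta> * (1 / r))" using M2 by (intro mult_left_mono) auto
      also have "r powr \<gamma> * (2 / \<delta> * (1 / r)) = 2 / \<delta> * ((1 / r) powr (2 - \<gamma>)) * r"
        using r by (simp add: powr_divide powr_diff power2_eq_square)
      also have "\<dots> \<le> 2 / \<delta> * ((1 + \<delta> powr (2 - \<gamma>)) * n powr e) * r"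
      proof (intro mult_right_mono mult_left_mono powr_le_scale)
        have "\<delta> / n \<le> b / 1" using b by simp
        also have "\<dots> \<le> b / a" using pos a by (intro divide_left_mono) auto
        finally show "\<delta> / n \<le> 1 / r" by (simp add: r_def)
      qed (use 3 n \<delta> e in auto)
      also have "\<dots> = (2 / \<delta> * (1 + \<delta> powr (2 - \<gamma>))) * n powr e * r" by simp
      also have "\<dots> \<le> kernel_const \<delta> \<gamma> * n powr e * r"
        unfolding kernel_const_def using t r by (intro mult_right_mono) auto
      finally show ?thesis using 3 by simp
    qed
    also have "\<dots> \<le> kernel_const \<delta> \<gamma> * n powr e * (r + 1)"
      unfolding kernel_const_def by (rule mult_left_mono) (use r t in auto)
    finally show ?thesis .
  qed
  then have "r powr \<gamma> * M * b \<le> kernel_const \<delta> \<gamma> * n powr e * (r + 1) * b"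
    using pos by (intro mult_right_mono) auto
  also have "\<dots> = kernel_const \<delta> \<gamma> * n powr e * (a + b)" using pos by (simp add: r_def field_simps)
  finally show ?thesis unfolding lhs by (simp add: mult_ac)
qed

text \<open>The value 3/4 lies below \<open>sqrt 3 / 2\<close> and exceeds 1/2 by a fixed amount,
  which separates two angles at opposite ends.\<close>

lemma unit_circle_bounds:
  fixes s c :: real
  assumes "s\<^sup>2 + c\<^sup>2 = 1" "s > 0" "c > 0"
  shows "s \<le> 1" "c \<le> 1" "s < 1/2 \<Longrightarrow> c > 3/4" "c < 1/2 \<Longrightarrow> s > 3/4"
proof -
  have le: "x \<le> 1" and big: "x < 1/2 \<Longrightarrow> y > 3/4" if "x\<^sup>2 + y\<^sup>2 = 1" "x > 0" "y > 0" for x y :: real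
  proof -
    have "x\<^sup>2 \<le> 1\<^sup>2" using that(1) zero_le_power2[of y] unfolding one_power2 by linarith
    then show "x \<le> 1" by (rule power2_le_imp_le) simp
    assume "x < 1/2"
    then have "x\<^sup>2 < (1/2)\<^sup>2" using that by (intro power_strict_mono) auto
    then have "(3/4)\<^sup>2 < y\<^sup>2" using that(1) by (simp add: power2_eq_square)
    then show "y > 3/4" by (rule power2_less_imp_less) (use that in simp)
  qed
  have "c\<^sup>2 + s\<^sup>2 = 1" using assms(1) by simp
  then show "s \<le> 1" "c \<le> 1" "s < 1/2 \<Longrightarrow> c > 3/4" "c < 1/2 \<Longrightarrow> s > 3/4"
    using le big assms by blast+
qed

text \<open>The intended values: \<open>s\<close>, \<open>c\<close> and \<open>sk\<close>,
  \<open>ck\<close> are sine and cosine of the half angles of \<theta> and \<phi>, \<open>M\<close>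
  is \<open>min 1 (1 / (n * |\<theta> - \<phi>|))\<close>, and \<open>s * ck + c * sk\<close> is
  \<open>sin ((\<theta> + \<phi>) / 2)\<close>. If both angles avoid the same endpoint, one pair of
  powers is bounded and the other is an instance of \<open>kernel_bound\<close>. At opposite ends
  \<open>M\<close> is of order \<open>1 / n\<close>, and the powers are estimated
  separately.\<close>

lemma bulk_node_bound:
  fixes a b e \<delta> :: real
  assumes \<delta>: "0 < \<delta>" and b1: "b + 1 > 0"
    and e: "e \<ge> 0" "e \<ge> - a" "e \<ge> a - 3" "e \<ge> b - 1" "e \<ge> b - a"
  obtains K where "K > 0" "\<And>n s c sk ck M. n \<ge> 1 \<Longrightarrow> \<delta> / n \<le> s \<Longrightarrow> \<delta> / n \<le> c \<Longrightarrow> \<delta> / n \<le> sk \<Longrightarrow> \<delta> / n \<le> ck \<Longrightarrow>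
     s\<^sup>2 + c\<^sup>2 = 1 \<Longrightarrow> sk\<^sup>2 + ck\<^sup>2 = 1 \<Longrightarrow> 0 \<le> M \<Longrightarrow> M \<le> 1 \<Longrightarrow> M * (n * \<bar>s - sk\<bar>) \<le> 1 \<Longrightarrow>
     M * (n * \<bar>c - ck\<bar>) \<le> 1 \<Longrightarrow>
     s powr (2 - a) * c powr (- b) * sk powr (a - 1) * ck powr (b + 1) * M \<le> K * n powr e * (s * ck + c * sk)"
proof -
  define Q where "Q x = 2 powr \<bar>x :: real\<bar>" for x
  define D where "D x = 1 + \<delta> powr x" for x
  have Qpos: "Q x > 0" and Dpos: "D x > 0" for x by (simp_all add: Q_def D_def add_pos_nonneg)
  define KA where "KA = 2 * kernel_const \<delta> (2 - a) * (Q (- b) * Q (b + 1))"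
  define KB where "KB = 2 * kernel_const \<delta> (- b) * (Q (2 - a) * Q (a - 1))"
  define KC where "KC = 16 * (Q (2 - a) * Q (b + 1) * (D (- b) * D (a - 1)))"
  define KD where "KD = 16 * (Q (- b) * Q (a - 1) * D (2 - a))"
  define K where "K = \<bar>KA\<bar> + \<bar>KB\<bar> + KC + KD"
  have "KC > 0" "KD > 0" using Qpos Dpos by (auto simp: KC_def KD_def intro!: mult_pos_pos)
  then have K: "K > 0" "KA \<le> K" "KB \<le> K" "KC \<le> K" "KD \<le> K" by (auto simp: K_def)
  have "s powr (2 - a) * c powr (- b) * sk powr (a - 1) * ck powr (b + 1) * M \<le> K * n powr e * (s * ck + c * sk)"
    if n: "n \<ge> 1" and lo: "\<delta> / n \<le> s" "\<delta> / n \<le> c" "\<delta> / n \<le> sk" "\<delta> / n \<le> ck"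
      and pyth: "s\<^sup>2 + c\<^sup>2 = 1" "sk\<^sup>2 + ck\<^sup>2 = 1" and M: "0 \<le> M" "M \<le> 1"
      and Ms: "M * (n * \<bar>s - sk\<bar>) \<le> 1" and Mc: "M * (n * \<bar>c - ck\<bar>) \<le> 1" for n s c sk ck M
  proof -
    have "\<delta> / n > 0" using \<delta> n by simp
    then have pos: "s > 0" "c > 0" "sk > 0" "ck > 0" using lo by linarith+
    have hi: "s \<le> 1" "c \<le> 1" "sk \<le> 1" "ck \<le> 1"
      using unit_circle_bounds[OF pyth(1)] unit_circle_bounds[OF pyth(2)] pos by auto
    define S where "S = s * ck + c * sk"
    have S: "S > 0" using pos by (simp add: S_def add_pos_pos)
    have ne: "n powr e > 0" using n by simp
    note q = powr_le_two_powr[folded Q_def]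
    note d = powr_le_scale[OF \<delta> n, folded D_def]
    have reduce: ?thesis if "s powr (2 - a) * c powr (- b) * sk powr (a - 1) * ck powr (b + 1) * M \<le> K' * n powr e * S"
      "K' \<le> K" for K'
    proof -
      have "K' * n powr e * S \<le> K * n powr e * S" using that(2) ne S by (intro mult_right_mono) auto
      then show ?thesis using that(1) by (simp add: S_def)
    qed
    have kpos: "kernel_const \<delta> x > 0" for x
      using \<delta> unfolding kernel_const_def by (intro add_pos_nonneg) auto
    consider (A) "c \<ge> 1/2" "ck \<ge> 1/2" | (B) "s \<ge> 1/2" "sk \<ge> 1/2"
      | (C) "c < 1/2" "sk < 1/2" "s > 3/4" "ck > 3/4" | (D) "ck < 1/2" "s < 1/2" "sk > 3/4" "c > 3/4"
    proof -
      have "c \<ge> 1/2 \<and> ck \<ge> 1/2 \<or> s \<ge> 1/2 \<and> sk \<ge> 1/2 \<or> c < 1/2 \<and> sk < 1/2 \<or> ck < 1/2 \<and> s < 1/2"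
        using unit_circle_bounds(3,4)[OF pyth(1) pos(1,2)] unit_circle_bounds(3,4)[OF pyth(2) pos(3,4)] by linarith
      then show thesis
        using A B C D unit_circle_bounds(3,4)[OF pyth(1) pos(1,2)] unit_circle_bounds(3,4)[OF pyth(2) pos(3,4)]
        by blast
    qed
    then show ?thesis
    proof cases
      case A
      \<comment> \<open>With \<open>\<gamma> = 2 - a\<close> the kernel asks for
        \<open>e \<ge> a - 3\<close> and \<open>e \<ge> - a\<close>.\<close>
      have "s powr (2 - a) * sk powr (1 - (2 - a)) * M \<le> kernel_const \<delta> (2 - a) * n powr e * (s + sk)"
        by (rule kernel_bound) (use \<delta> n lo hi M Ms e in auto)
      moreover have "s + sk \<le> 2 * S"
      proof -
        have "s * (1/2) \<le> s * ck" "(1/2) * sk \<le> c * sk" using A pos by (intro mult_left_mono mult_right_mono; simp)+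
        then show ?thesis by (simp add: S_def)
      qed
      then have "kernel_const \<delta> (2 - a) * n powr e * (s + sk) \<le> kernel_const \<delta> (2 - a) * n powr e * (2 * S)"
        using ne kpos[of "2 - a"] by (intro mult_left_mono) auto
      ultimately have 1: "s powr (2 - a) * sk powr (a - 1) * M \<le> kernel_const \<delta> (2 - a) * n powr e * (2 * S)"
        by (simp add: algebra_simps)
      have 2: "c powr (- b) * ck powr (b + 1) \<le> Q (- b) * Q (b + 1)"
        using A hi Qpos[of "- b"] by (intro mult_mono q) auto
      have "(s powr (2 - a) * sk powr (a - 1) * M) * (c powr (- b) * ck powr (b + 1))
        \<le> (kernel_const \<delta> (2 - a) * n powr e * (2 * S)) * (Q (- b) * Q (b + 1))"
        by (rule mult_mono[OF 1 2]) (use ne S kpos[of "2 - a"] in auto)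
      then show ?thesis by (intro reduce[OF _ K(2)]) (simp add: KA_def mult_ac)
    next
      case B
      \<comment> \<open>With \<open>\<gamma> = - b\<close> the kernel asks for
        \<open>e \<ge> b - 1\<close>; the other condition, \<open>e \<ge> - b - 2\<close>, follows
        from \<open>b + 1 > 0\<close>.\<close>
      have "c powr (- b) * ck powr (1 - (- b)) * M \<le> kernel_const \<delta> (- b) * n powr e * (c + ck)"
        by (rule kernel_bound) (use \<delta> n lo hi M Mc e b1 in auto)
      moreover have "c + ck \<le> 2 * S"
      proof -
        have "c * (1/2) \<le> c * sk" "(1/2) * ck \<le> s * ck" using B pos by (intro mult_left_mono mult_right_mono; simp)+
        then show ?thesis by (simp add: S_def)
      qed
      then have "kernel_const \<delta> (- b) * n powr e * (c + ck) \<le> kernel_const \<delta> (- b) * n powr e * (2 * S)"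
        using ne kpos[of "- b"] by (intro mult_left_mono) auto
      ultimately have 1: "c powr (- b) * ck powr (b + 1) * M \<le> kernel_const \<delta> (- b) * n powr e * (2 * S)"
        by (simp add: algebra_simps)
      have 2: "s powr (2 - a) * sk powr (a - 1) \<le> Q (2 - a) * Q (a - 1)"
        using B hi Qpos[of "2 - a"] by (intro mult_mono q) auto
      have "(c powr (- b) * ck powr (b + 1) * M) * (s powr (2 - a) * sk powr (a - 1))
        \<le> (kernel_const \<delta> (- b) * n powr e * (2 * S)) * (Q (2 - a) * Q (a - 1))"
        by (rule mult_mono[OF 1 2]) (use ne S kpos[of "- b"] in auto)
      then show ?thesis by (intro reduce[OF _ K(3)]) (simp add: KB_def mult_ac)
    next
      case C
      have "1/4 \<le> \<bar>s - sk\<bar>" using C by linarith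
      then have "M * (n * (1/4)) \<le> M * (n * \<bar>s - sk\<bar>)" using M n by (intro mult_left_mono) auto
      then have "M * n \<le> 4" using Ms by simp
      then have M4: "M \<le> 4 / n" using n by (simp add: field_simps)
      have "(1/2) * (1/2) \<le> s * ck" using C by (intro mult_mono) auto
      then have S4: "1/4 \<le> S" using pos by (simp add: S_def add_increasing2)
      have 1: "s powr (2 - a) * ck powr (b + 1) \<le> Q (2 - a) * Q (b + 1)"
        using C hi Qpos[of "2 - a"] by (intro mult_mono q) auto
      have 2: "c powr (- b) * sk powr (a - 1) \<le> (D (- b) * n powr (max 0 b)) * (D (a - 1) * n powr (max 0 (1 - a)))"
        using lo hi Dpos[of "- b"] by (intro mult_mono d) auto
      have "c powr (- b) * sk powr (a - 1) * M \<le> (D (- b) * n powr (max 0 b)) * (D (a - 1) * n powr (max 0 (1 - a))) * (4 / n)"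
        by (rule mult_mono[OF 2 M4]) (use M Dpos[of "- b"] Dpos[of "a - 1"] in auto)
      also have "\<dots> = 4 * (D (- b) * D (a - 1)) * (n powr (max 0 b) * n powr (max 0 (1 - a)) * n powr (- 1))"
        using n by (simp add: powr_minus_divide)
      also have "\<dots> = 4 * (D (- b) * D (a - 1)) * n powr (max 0 b + max 0 (1 - a) + - 1)"
        by (simp only: powr_add)
      \<comment> \<open>The exponent on the left is one of -1, \<open>b - 1\<close>,
        \<open>- a\<close> and \<open>b - a\<close>; this is the source of
        \<open>b - a\<close>.\<close>
      also have "\<dots> \<le> 4 * (D (- b) * D (a - 1)) * n powr e"
        using e n Dpos[of "- b"] Dpos[of "a - 1"] by (intro mult_left_mono powr_mono) auto
      finally have 3: "c powr (- b) * sk powr (a - 1) * M \<le> 4 * (D (- b) * D (a - 1)) * n powr e" .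
      have "(s powr (2 - a) * ck powr (b + 1)) * (c powr (- b) * sk powr (a - 1) * M)
        \<le> (Q (2 - a) * Q (b + 1)) * (4 * (D (- b) * D (a - 1)) * n powr e)"
        by (rule mult_mono[OF 1 3]) (use M Qpos[of "2 - a"] Qpos[of "b + 1"] in auto)
      also have "\<dots> = KC * n powr e * (1/4)" by (simp add: KC_def)
      also have "\<dots> \<le> KC * n powr e * S" using S4 \<open>KC > 0\<close> ne by (intro mult_left_mono) auto
      finally show ?thesis by (intro reduce[OF _ K(4)]) (simp add: mult_ac)
    next
      case D
      have "1/4 \<le> \<bar>s - sk\<bar>" using D by linarith
      then have "M * (n * (1/4)) \<le> M * (n * \<bar>s - sk\<bar>)" using M n by (intro mult_left_mono) auto
      then have "M * n \<le> 4" using Ms by simp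
      then have M4: "M \<le> 4 / n" using n by (simp add: field_simps)
      have "(1/2) * (1/2) \<le> c * sk" using D by (intro mult_mono) auto
      then have S4: "1/4 \<le> S" using pos by (simp add: S_def add_increasing)
      have "ck powr (b + 1) \<le> 1 powr (b + 1)" using b1 hi pos by (intro powr_mono2) auto
      then have "(c powr (- b) * sk powr (a - 1)) * ck powr (b + 1) \<le> (Q (- b) * Q (a - 1)) * 1"
        using D hi Qpos[of "- b"] Qpos[of "a - 1"] by (intro mult_mono q) auto
      then have 1: "(c powr (- b) * sk powr (a - 1)) * ck powr (b + 1) \<le> Q (- b) * Q (a - 1)" by simp
      have "s powr (2 - a) * M \<le> (D (2 - a) * n powr (max 0 (a - 2))) * (4 / n)"
        by (rule mult_mono) (use M M4 lo hi Dpos[of "2 - a"] in \<open>auto intro!: d\<close>)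
      also have "\<dots> = 4 * D (2 - a) * (n powr (max 0 (a - 2)) * n powr (- 1))"
        using n by (simp add: powr_minus_divide)
      also have "\<dots> = 4 * D (2 - a) * n powr (max 0 (a - 2) + - 1)"
        by (simp only: powr_add)
      \<comment> \<open>Here the exponent on the left is -1 or \<open>a - 3\<close>.\<close>
      also have "\<dots> \<le> 4 * D (2 - a) * n powr e"
        using e n Dpos[of "2 - a"] by (intro mult_left_mono powr_mono) auto
      finally have 3: "s powr (2 - a) * M \<le> 4 * D (2 - a) * n powr e" .
      have "((c powr (- b) * sk powr (a - 1)) * ck powr (b + 1)) * (s powr (2 - a) * M)
        \<le> (Q (- b) * Q (a - 1)) * (4 * D (2 - a) * n powr e)"
        by (rule mult_mono[OF 1 3]) (use M Qpos[of "- b"] Qpos[of "a - 1"] in auto)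
      also have "\<dots> = KD * n powr e * (1/4)" by (simp add: KD_def)
      also have "\<dots> \<le> KD * n powr e * S" using S4 \<open>KD > 0\<close> ne by (intro mult_left_mono) auto
      finally show ?thesis by (intro reduce[OF _ K(5)]) (simp add: mult_ac)
    qed
  qed
  then show ?thesis using that K(1) by blast
qed

text \<open>For \<theta> in the cap at 0: \<open>p\<close> contributes \<open>n powr (a - 1)\<close>
  and \<open>1 - cos \<theta>\<close> another \<open>n powr (- 2)\<close>. The first two factors
  form \<open>(n * sk) powr (a - 3)\<close> with \<open>n * sk\<close> between \<delta> and
  \<open>n\<close>.\<close>

lemma left_edge_node_bound:
  fixes a b e \<delta> n sk ck :: real
  assumes "0 < \<delta>" "n \<ge> 1" "\<delta> / n \<le> sk" "sk \<le> 1" "0 \<le> ck" "ck \<le> 1"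
    and "b + 1 > 0" "e \<ge> 0" "e \<ge> a - 3"
  shows "n powr (a - 3) * sk powr (a - 3) * ck powr (b + 1) \<le> (1 + \<delta> powr (a - 3)) * n powr e"
proof -
  have "n powr (a - 3) * sk powr (a - 3) * ck powr (b + 1)
    \<le> n powr (a - 3) * ((1 + \<delta> powr (a - 3)) * n powr (e - (a - 3))) * 1"
    using assms powr_mono2[of "b + 1" ck 1] powr_le_scale[of \<delta> n sk "e - (a - 3)" "a - 3"]
    by (intro mult_mono mult_left_mono) auto
  also have "\<dots> = (1 + \<delta> powr (a - 3)) * (n powr (a - 3) * n powr (e - (a - 3)))" by simp
  also have "n powr (a - 3) * n powr (e - (a - 3)) = n powr e" by (simp flip: powr_add)
  finally show ?thesis .
qed

text \<open>One of \<open>s\<close>, \<open>c\<close> is at least \<open>1/2\<close>, so only one of the two powers can be large.\<close>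

lemma two_sided_bound:
  fixes f g h e \<delta> n s c :: real
  assumes \<delta>: "0 < \<delta>" and n: "n \<ge> 1" and lo: "\<delta> / n \<le> s" "\<delta> / n \<le> c" and pyth: "s\<^sup>2 + c\<^sup>2 = 1"
    and e: "e \<ge> h" "e \<ge> h - f" "e \<ge> h - g"
  shows "n powr h * (s powr f * c powr g)
    \<le> (2 powr \<bar>f\<bar> * (1 + \<delta> powr g) + 2 powr \<bar>g\<bar> * (1 + \<delta> powr f)) * n powr e"
proof -
  have "\<delta> / n > 0" using \<delta> n by simp
  then have pos: "s > 0" "c > 0" using lo by linarith+
  have hi: "s \<le> 1" "c \<le> 1" using unit_circle_bounds[OF pyth pos] by auto
  have shift: "n powr h * n powr (e - h) = n powr e" by (simp flip: powr_add)
  have step: "n powr h * (x powr f' * y powr g') \<le> (2 powr \<bar>f'\<bar> * (1 + \<delta> powr g')) * n powr e"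
    if "1/2 \<le> x" "x \<le> 1" "\<delta> / n \<le> y" "y \<le> 1" "e \<ge> h - g'" for x y f' g'
  proof -
    have "n powr h * (x powr f' * y powr g') \<le> n powr h * (2 powr \<bar>f'\<bar> * ((1 + \<delta> powr g') * n powr (e - h)))"
      using that \<delta> n e by (intro mult_left_mono mult_mono powr_le_two_powr powr_le_scale) auto
    also have "\<dots> = (2 powr \<bar>f'\<bar> * (1 + \<delta> powr g')) * (n powr h * n powr (e - h))" by simp
    finally show ?thesis unfolding shift .
  qed
  have "s \<ge> 1/2 \<or> c \<ge> 1/2"
  proof (rule ccontr)
    assume "\<not> ?thesis"
    then have "s\<^sup>2 < (1/2)\<^sup>2" "c\<^sup>2 < (1/2)\<^sup>2" using pos by (auto intro!: power_strict_mono)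
    then show False using pyth by (simp add: power2_eq_square)
  qed
  then show ?thesis
  proof
    assume "s \<ge> 1/2"
    then have "n powr h * (s powr f * c powr g) \<le> (2 powr \<bar>f\<bar> * (1 + \<delta> powr g)) * n powr e"
      using lo hi e by (intro step) auto
    also have "\<dots> \<le> (2 powr \<bar>f\<bar> * (1 + \<delta> powr g) + 2 powr \<bar>g\<bar> * (1 + \<delta> powr f)) * n powr e"
      by (intro mult_right_mono) auto
    finally show ?thesis .
  next
    assume "c \<ge> 1/2"
    then have "n powr h * (c powr g * s powr f) \<le> (2 powr \<bar>g\<bar> * (1 + \<delta> powr f)) * n powr e"
      using lo hi e by (intro step) auto
    also have "\<dots> \<le> (2 powr \<bar>f\<bar> * (1 + \<delta> powr g) + 2 powr \<bar>g\<bar> * (1 + \<delta> powr f)) * n powr e"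
      by (intro mult_right_mono) auto
    finally show ?thesis by (simp add: mult.commute)
  qed
qed

section \<open>Estimates at the nodes\<close>

lemma half_angle_scale:
  assumes \<epsilon>: "0 < \<epsilon>" and n: "n \<ge> 1" and \<theta>: "\<epsilon> / n \<le> \<theta>" "\<theta> \<le> pi - \<epsilon> / n"
  shows "\<epsilon> / pi / n \<le> sin (\<theta> / 2)" "\<epsilon> / pi / n \<le> cos (\<theta> / 2)"
proof -
  have en: "\<epsilon> / n > 0" using \<epsilon> n by simp
  have *: "\<epsilon> / pi / n \<le> sin (x / 2)" if "\<epsilon> / n \<le> x" "x \<le> pi" for x
  proof -
    have "\<epsilon> / pi / n = 2 * (\<epsilon> / n / 2) / pi" by simp
    also have "\<dots> \<le> 2 * (x / 2) / pi" using that by (intro divide_right_mono mult_left_mono) auto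
    also have "\<dots> \<le> sin (x / 2)" using that en by (intro sin_ge_two_div_pi) auto
    finally show ?thesis .
  qed
  show "\<epsilon> / pi / n \<le> sin (\<theta> / 2)" using \<theta> en by (intro *) auto
  have "\<epsilon> / pi / n \<le> sin ((pi - \<theta>) / 2)" using \<theta> en by (intro *) auto
  also have "(pi - \<theta>) / 2 = pi / 2 - \<theta> / 2" by (simp add: field_simps)
  finally show "\<epsilon> / pi / n \<le> cos (\<theta> / 2)" by (simp add: sin_diff)
qed

text \<open>\<open>sin (\<phi> / 2)\<close> is
  \<open>2 * sin (\<phi> / 4) * cos (\<phi> / 4)\<close>, and \<open>\<phi> / 4\<close> is at most
  \<open>pi / 4\<close>. For a zero \<phi> and \<theta> in the cap at 0 this gives
  \<open>|cos \<theta> - cos \<phi>| \<ge> (sin (\<phi> / 2))\<^sup>2\<close>.\<close>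

lemma sin_sq_half_le:
  assumes "0 \<le> \<theta>" "2 * \<theta> \<le> \<phi>" "\<phi> \<le> pi"
  shows "2 * (sin (\<theta> / 2))\<^sup>2 \<le> (sin (\<phi> / 2))\<^sup>2"
proof -
  have "0 \<le> sin (\<theta> / 2)" "0 \<le> cos (\<phi> / 4)" using assms by (auto intro!: sin_ge_zero cos_ge_zero)
  have "sin (\<theta> / 2) \<le> sin (\<phi> / 4)" using assms by (intro sin_monotone_2pi_le) auto
  then have 1: "(sin (\<theta> / 2))\<^sup>2 \<le> (sin (\<phi> / 4))\<^sup>2" using \<open>0 \<le> sin (\<theta> / 2)\<close> by (intro power_mono)
  have "cos (pi / 4) \<le> cos (\<phi> / 4)" using assms by (intro cos_monotone_0_pi_le) auto
  then have "(sqrt 2 / 2)\<^sup>2 \<le> (cos (\<phi> / 4))\<^sup>2" by (intro power_mono) (simp_all add: cos_45)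
  then have 2: "1/2 \<le> (cos (\<phi> / 4))\<^sup>2" by (simp add: power_divide)
  have "2 * (sin (\<theta> / 2))\<^sup>2 \<le> 4 * (sin (\<phi> / 4))\<^sup>2 * (1/2)" using 1 by simp
  also have "\<dots> \<le> 4 * (sin (\<phi> / 4))\<^sup>2 * (cos (\<phi> / 4))\<^sup>2" using 2 by (intro mult_left_mono) auto
  also have "\<dots> = (2 * sin (\<phi> / 4) * cos (\<phi> / 4))\<^sup>2" by (simp add: power_mult_distrib)
  also have "2 * sin (\<phi> / 4) * cos (\<phi> / 4) = sin (\<phi> / 2)" using sin_double[of "\<phi> / 4"] by simp
  finally show ?thesis .
qed

lemma cos_sq_half_le:
  assumes "\<theta> \<le> pi" "2 * (pi - \<theta>) \<le> pi - \<phi>" "0 \<le> \<phi>"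
  shows "2 * (cos (\<theta> / 2))\<^sup>2 \<le> (cos (\<phi> / 2))\<^sup>2"
proof -
  have "sin ((pi - x) / 2) = cos (x / 2)" for x
  proof -
    have "(pi - x) / 2 = pi / 2 - x / 2" by (simp add: field_simps)
    show ?thesis unfolding \<open>(pi - x) / 2 = pi / 2 - x / 2\<close> by (simp add: sin_diff)
  qed
  then show ?thesis using sin_sq_half_le[of "pi - \<theta>" "pi - \<phi>"] assms by simp
qed

lemma abs_sin_diff_le: "\<bar>sin x - sin y\<bar> \<le> \<bar>x - y\<bar>" for x y :: real
proof -
  have "\<bar>sin x - sin y\<bar> = 2 * \<bar>sin ((x - y) / 2)\<bar> * \<bar>cos ((x + y) / 2)\<bar>"
    by (simp add: sin_diff_sin abs_mult)
  also have "\<dots> \<le> 2 * \<bar>(x - y) / 2\<bar> * 1"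
    by (intro mult_mono mult_left_mono abs_sin_x_le_abs_x) auto
  finally show ?thesis by simp
qed

lemma abs_cos_diff_le: "\<bar>cos x - cos y\<bar> \<le> \<bar>x - y\<bar>" for x y :: real
  using abs_sin_diff_le[of "pi / 2 - x" "pi / 2 - y"] by (simp add: sin_diff)

text \<open>The difference of the cosines is \<open>2 * sin ((\<theta> + \<phi>) / 2) * sin ((\<phi>
  - \<theta>) / 2)\<close>: the bracket on the left is the first sine, and Jordan's inequality
  bounds the second.\<close>

lemma cos_diff_ge:
  assumes "0 < \<theta>" "\<theta> < pi" "0 < \<phi>" "\<phi> < pi"
  shows "\<bar>\<theta> - \<phi>\<bar> * (sin (\<theta> / 2) * cos (\<phi> / 2) + cos (\<theta> / 2) * sin (\<phi> / 2)) \<le> pi / 2 * \<bar>cos \<theta> - cos \<phi>\<bar>"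
proof -
  define S where "S = sin (\<theta> / 2) * cos (\<phi> / 2) + cos (\<theta> / 2) * sin (\<phi> / 2)"
  have S: "S \<ge> 0" using half_angle_pos[OF assms(1,2)] half_angle_pos[OF assms(3,4)] by (simp add: S_def)
  have S': "S = sin ((\<theta> + \<phi>) / 2)" by (simp add: S_def sin_add add_divide_distrib)
  have "\<bar>sin ((\<phi> - \<theta>) / 2)\<bar> = sin (\<bar>\<theta> - \<phi>\<bar> / 2)"
  proof (cases "\<theta> \<le> \<phi>")
    case True
    then have "sin ((\<phi> - \<theta>) / 2) \<ge> 0" using assms by (intro sin_ge_zero) auto
    then show ?thesis using True by simp
  next
    case False
    then have "sin ((\<theta> - \<phi>) / 2) \<ge> 0" using assms by (intro sin_ge_zero) auto
    moreover have "sin ((\<phi> - \<theta>) / 2) = - sin ((\<theta> - \<phi>) / 2)"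
      by (metis minus_diff_eq minus_divide_left sin_minus)
    ultimately show ?thesis using False by simp
  qed
  moreover have "2 * (\<bar>\<theta> - \<phi>\<bar> / 2) / pi \<le> sin (\<bar>\<theta> - \<phi>\<bar> / 2)"
    using assms by (intro sin_ge_two_div_pi) auto
  ultimately have "\<bar>\<theta> - \<phi>\<bar> \<le> pi * \<bar>sin ((\<phi> - \<theta>) / 2)\<bar>" by (simp add: field_simps)
  then have "\<bar>\<theta> - \<phi>\<bar> * S \<le> pi * \<bar>sin ((\<phi> - \<theta>) / 2)\<bar> * S" using S by (rule mult_right_mono)
  also have "\<dots> = pi / 2 * \<bar>cos \<theta> - cos \<phi>\<bar>"
    using S unfolding cos_diff_cos S' by (simp add: abs_mult)
  finally show ?thesis by (simp add: S_def)
qed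

lemma cos_half_sq: "1 - cos \<theta> = 2 * (sin (\<theta> / 2))\<^sup>2" "1 + cos \<theta> = 2 * (cos (\<theta> / 2))\<^sup>2" for \<theta> :: real
  using cos_double_sin[of "\<theta> / 2"] cos_double_cos[of "\<theta> / 2"] by simp_all

text \<open>For a zero \<open>\<phi>\<close> the scale \<open>G\<close> of the profile bounds \<open>p' (cos \<phi>)\<close> from below and \<open>p\<close> from above,
  so it cancels; no asymptotics of the zeros themselves is needed.\<close>

lemma jacobi_node_estimate:
  fixes \<alpha> \<beta> \<epsilon> C e :: real
  assumes \<beta>: "\<beta> > -1" and \<epsilon>: "0 < \<epsilon>" "\<epsilon> \<le> 1/4" and C: "C > 0"
    and e: "e \<ge> 0" "e \<ge> - 1/2 - \<alpha>" "e \<ge> \<alpha> - 5/2" "e \<ge> \<beta> - 1/2" "e \<ge> \<beta> - \<alpha>"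
  obtains K where "K > 0" "\<And>m p G \<theta> \<phi>. jacobi_ode \<alpha> \<beta> m p \<Longrightarrow> jacobi_profile \<alpha> \<beta> m p \<epsilon> C G \<Longrightarrow> G > 0 \<Longrightarrow>
     \<theta> \<in> {0..pi} \<Longrightarrow> \<phi> \<in> {0<..<pi} \<Longrightarrow> poly p (cos \<phi>) = 0 \<Longrightarrow>
     (1 - cos \<theta>) * \<bar>poly p (cos \<theta>)\<bar>
       \<le> K * real (Suc m) powr e * ((1 - cos \<phi>) * \<bar>poly (pderiv p) (cos \<phi>)\<bar> * \<bar>cos \<theta> - cos \<phi>\<bar>)"
proof -
  define a b where "a = \<alpha> + 1/2" and "b = \<beta> + 1/2"
  define \<delta> where "\<delta> = \<epsilon> / pi"
  have \<delta>: "0 < \<delta>" using \<epsilon> by (simp add: \<delta>_def)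
  have b1: "b + 1 > 0" using \<beta> by (simp add: b_def)
  have e': "e \<ge> 0" "e \<ge> - a" "e \<ge> a - 3" "e \<ge> b - 1" "e \<ge> b - a" using e by (auto simp: a_def b_def)
  obtain K1 where K1: "K1 > 0" "\<And>n s c sk ck M. n \<ge> 1 \<Longrightarrow> \<delta> / n \<le> s \<Longrightarrow> \<delta> / n \<le> c \<Longrightarrow> \<delta> / n \<le> sk \<Longrightarrow> \<delta> / n \<le> ck \<Longrightarrow>
     s\<^sup>2 + c\<^sup>2 = 1 \<Longrightarrow> sk\<^sup>2 + ck\<^sup>2 = 1 \<Longrightarrow> 0 \<le> M \<Longrightarrow> M \<le> 1 \<Longrightarrow> M * (n * \<bar>s - sk\<bar>) \<le> 1 \<Longrightarrow>
     M * (n * \<bar>c - ck\<bar>) \<le> 1 \<Longrightarrow>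
     s powr (2 - a) * c powr (- b) * sk powr (a - 1) * ck powr (b + 1) * M \<le> K1 * n powr e * (s * ck + c * sk)"
    using bulk_node_bound[OF \<delta> b1 e'] by metis
  define K2 where "K2 = 1 + \<delta> powr (a - 3)"
  define K3 where "K3 = 2 powr \<bar>a - 1\<bar> * (1 + \<delta> powr (b - 1)) + 2 powr \<bar>b - 1\<bar> * (1 + \<delta> powr (a - 1))"
  have K2: "K2 > 0" and K3: "K3 > 0" using \<delta> by (auto simp: K2_def K3_def intro!: add_pos_nonneg mult_pos_pos add_pos_pos)
  define K0 where "K0 = C * (2 * K1 + K2 + K3)"
  have K0: "K0 > 0" using C K1(1) K2 K3 by (simp add: K0_def)
  have main: "(1 - cos \<theta>) * \<bar>poly p (cos \<theta>)\<bar>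
       \<le> (2 * C * K0) * real (Suc m) powr e * ((1 - cos \<phi>) * \<bar>poly (pderiv p) (cos \<phi>)\<bar> * \<bar>cos \<theta> - cos \<phi>\<bar>)"
    if ode: "jacobi_ode \<alpha> \<beta> m p" and prof: "jacobi_profile \<alpha> \<beta> m p \<epsilon> C G" and G: "G > 0"
      and \<theta>: "\<theta> \<in> {0..pi}" and \<phi>: "\<phi> \<in> {0<..<pi}" and zero: "poly p (cos \<phi>) = 0" for m p G \<theta> \<phi>
  proof -
    define n where "n = real (Suc m)"
    have n: "n \<ge> 1" by (simp add: n_def)
    have en: "0 < \<epsilon> / n" "\<epsilon> / n \<le> 1/4" using \<epsilon> n by (auto simp: divide_le_eq)
    have prof2: "n * \<bar>jacobi_v \<alpha> \<beta> p x\<bar> \<le> C * G" "\<bar>jacobi_d \<alpha> \<beta> p x\<bar> \<le> C * G"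
      if "\<epsilon> / n \<le> x" "x \<le> pi - \<epsilon> / n" for x
      using prof that unfolding jacobi_profile_def n_def[symmetric] by auto
    have prof3: "2 * \<epsilon> / n \<le> \<phi>" "\<phi> \<le> pi - 2 * \<epsilon> / n" "G \<le> C * \<bar>jacobi_w \<alpha> \<beta> p \<phi>\<bar>"
      using prof \<phi> zero unfolding jacobi_profile_def n_def[symmetric] by auto
    have prof4: "n powr (1 - a) * \<bar>poly p (cos \<theta>)\<bar> \<le> C * G" if "\<theta> \<le> \<epsilon> / n"
      using prof that \<theta> unfolding jacobi_profile_def n_def[symmetric] by (auto simp: a_def)
    have prof5: "n powr (1 - b) * \<bar>poly p (cos \<theta>)\<bar> \<le> C * G" if "\<theta> \<ge> pi - \<epsilon> / n"
      using prof that \<theta> unfolding jacobi_profile_def n_def[symmetric] by (auto simp: b_def)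
    have e2: "2 * \<epsilon> / n = 2 * (\<epsilon> / n)" by simp
    have \<phi>b: "\<epsilon> / n \<le> \<phi>" "\<phi> \<le> pi - \<epsilon> / n" using prof3(1,2) en unfolding e2 by linarith+
    define s c sk ck where "s = sin (\<theta> / 2)" and "c = cos (\<theta> / 2)" and "sk = sin (\<phi> / 2)" and "ck = cos (\<phi> / 2)"
    have k: "sk > 0" "ck > 0" using half_angle_pos[of \<phi>] \<phi> by (auto simp: sk_def ck_def)
    have klo: "\<delta> / n \<le> sk" "\<delta> / n \<le> ck"
      unfolding \<delta>_def sk_def ck_def by (rule half_angle_scale[OF \<epsilon>(1) n \<phi>b])+
    have pyth: "s\<^sup>2 + c\<^sup>2 = 1" "sk\<^sup>2 + ck\<^sup>2 = 1" by (simp_all add: s_def c_def sk_def ck_def)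
    have kle: "sk \<le> 1" "ck \<le> 1" using unit_circle_bounds[OF pyth(2) k] by auto
    have ne: "n powr e > 0" using n by simp
    define P where "P = \<bar>poly p (cos \<theta>)\<bar>"
    define X where "X = \<bar>cos \<theta> - cos \<phi>\<bar>"
    have P: "P \<ge> 0" and X: "X \<ge> 0" by (simp_all add: P_def X_def)
    have "C * G * n powr e * X \<ge> 0" using C G X by (intro mult_nonneg_nonneg) auto
    then have widen: "x \<le> K0 * n powr e * G * X" if "x \<le> L * (C * G * n powr e * X)" "L \<le> 2 * K1 + K2 + K3" for x L
    proof -
      have "L * (C * G * n powr e * X) \<le> (2 * K1 + K2 + K3) * (C * G * n powr e * X)"
        using that(2) \<open>C * G * n powr e * X \<ge> 0\<close> by (rule mult_right_mono)
      then show ?thesis using that(1) by (simp add: K0_def mult_ac)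
    qed
    \<comment> \<open>The claim with \<open>G\<close> in place of the derivative at the zero, and
      the corresponding powers of the half angles of \<phi> moved to the left.\<close>
    have key: "s\<^sup>2 * P * sk powr (a - 1) * ck powr (b + 1) \<le> K0 * n powr e * G * X"
    proof -
      consider "\<theta> \<le> \<epsilon> / n" | "\<theta> \<ge> pi - \<epsilon> / n" | "\<epsilon> / n < \<theta>" "\<theta> < pi - \<epsilon> / n" by linarith
      then show ?thesis
      proof cases
        case 1
        have "2 * s\<^sup>2 \<le> sk\<^sup>2" unfolding s_def sk_def
          by (rule sin_sq_half_le) (use 1 \<theta> \<phi> prof3(1)[unfolded e2] in auto)
        then have X1: "sk\<^sup>2 \<le> X"
          using cos_half_sq(1)[of \<theta>] cos_half_sq(1)[of \<phi>] by (simp add: X_def s_def sk_def)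
        have "s \<le> \<theta> / 2" unfolding s_def using \<theta> by (intro sin_x_le_x) auto
        also have "\<dots> \<le> 1 / n" using 1 \<epsilon> n by (simp add: field_simps)
        finally have "s\<^sup>2 \<le> (1 / n)\<^sup>2" using \<theta> unfolding s_def by (intro power_mono sin_ge_zero) auto
        then have s2: "s\<^sup>2 \<le> n powr (- 2)" using n by (simp add: powr_minus_divide power_divide)
        have PG: "P \<le> C * G * n powr (a - 1)"
        proof -
          have "P = n powr (a - 1) * (n powr (1 - a) * P)" using n by (simp flip: powr_add mult.assoc)
          also have "\<dots> \<le> n powr (a - 1) * (C * G)"
            using prof4[OF 1] by (intro mult_left_mono) (auto simp: P_def)
          finally show ?thesis by (simp add: mult_ac)
        qed
        have "s\<^sup>2 * P \<le> n powr (- 2) * (C * G * n powr (a - 1))"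
          using s2 PG P by (intro mult_mono) auto
        also have "\<dots> = C * G * (n powr (- 2) * n powr (a - 1))" by simp
        also have "n powr (- 2) * n powr (a - 1) = n powr (a - 3)" by (simp flip: powr_add)
        finally have "s\<^sup>2 * P * (sk powr (a - 1) * ck powr (b + 1)) \<le> C * G * n powr (a - 3) * (sk powr (a - 1) * ck powr (b + 1))"
          by (intro mult_right_mono) auto
        also have "C * G * n powr (a - 3) * (sk powr (a - 1) * ck powr (b + 1))
          = C * G * (n powr (a - 3) * sk powr (a - 3) * ck powr (b + 1)) * sk\<^sup>2"
        proof -
          have "sk powr (a - 1) = sk powr (a - 3 + 2)" by simp
          also have "\<dots> = sk powr (a - 3) * sk\<^sup>2" unfolding powr_add using k by simp
          finally show ?thesis by simp
        qed
        also have "\<dots> \<le> C * G * (K2 * n powr e) * X"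
          unfolding K2_def using C G X1 K2 n klo kle k b1 \<delta> e'
          by (intro mult_mono mult_left_mono left_edge_node_bound) (auto simp: K2_def)
        finally show ?thesis by (intro widen[of _ K2]) (use K1(1) K3 in \<open>auto simp: mult_ac\<close>)
      next
        case 2
        have "2 * c\<^sup>2 \<le> ck\<^sup>2" unfolding c_def ck_def
          by (rule cos_sq_half_le) (use 2 \<theta> \<phi> prof3(2)[unfolded e2] in auto)
        then have X1: "ck\<^sup>2 \<le> X"
          using cos_half_sq(2)[of \<theta>] cos_half_sq(2)[of \<phi>] by (simp add: X_def c_def ck_def)
        have s1: "s\<^sup>2 \<le> 1" using pyth(1) zero_le_power2[of c] by linarith
        have PG: "P \<le> C * G * n powr (b - 1)"
        proof -
          have "P = n powr (b - 1) * (n powr (1 - b) * P)" using n by (simp flip: powr_add mult.assoc)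
          also have "\<dots> \<le> n powr (b - 1) * (C * G)"
            using prof5[OF 2] by (intro mult_left_mono) (auto simp: P_def)
          finally show ?thesis by (simp add: mult_ac)
        qed
        have "s\<^sup>2 * P \<le> 1 * (C * G * n powr (b - 1))"
          using s1 PG P by (intro mult_mono) auto
        then have "s\<^sup>2 * P * (sk powr (a - 1) * ck powr (b + 1)) \<le> C * G * n powr (b - 1) * (sk powr (a - 1) * ck powr (b + 1))"
          by (intro mult_right_mono) auto
        also have "C * G * n powr (b - 1) * (sk powr (a - 1) * ck powr (b + 1))
          = C * G * (n powr (b - 1) * (sk powr (a - 1) * ck powr (b - 1))) * ck\<^sup>2"
        proof -
          have "ck powr (b + 1) = ck powr (b - 1 + 2)" by (simp add: add.commute)
          also have "\<dots> = ck powr (b - 1) * ck\<^sup>2" unfolding powr_add using k by simp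
          finally show ?thesis by simp
        qed
        also have "\<dots> \<le> C * G * (K3 * n powr e) * X"
          unfolding K3_def using C G X1 K3 n klo pyth \<delta> e'
          by (intro mult_mono mult_left_mono two_sided_bound) (auto simp: K3_def)
        finally show ?thesis by (intro widen[of _ K3]) (use K1(1) K2 in \<open>auto simp: mult_ac\<close>)
      next
        case 3
        show ?thesis
        proof (cases "\<theta> = \<phi>")
          case True
          then show ?thesis using zero by (simp add: P_def X_def)
        next
          case False
          define h where "h = \<bar>\<theta> - \<phi>\<bar>"
          have h: "h > 0" using False by (simp add: h_def)
          \<comment> \<open>\<open>M\<close> merges two bounds: \<open>v\<close> vanishes at \<phi>
            and has derivative at most \<open>C * G\<close>, so \<open>V \<le> C * G * h\<close>;
            and \<open>V \<le> C * G / n\<close> throughout the bulk.\<close>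
          define M where "M = min 1 (1 / (n * h))"
          have M: "0 \<le> M" "M \<le> 1" "M * (n * h) \<le> 1"
            using h n by (auto simp: M_def min_def field_simps)
          have th: "0 < \<theta>" "\<theta> < pi" using 3 en by linarith+
          have pos: "s > 0" "c > 0" using half_angle_pos[OF th] by (auto simp: s_def c_def)
          have lo: "\<delta> / n \<le> s" "\<delta> / n \<le> c"
            unfolding \<delta>_def s_def c_def by (rule half_angle_scale[OF \<epsilon>(1) n]; use 3 in simp)+
          define V where "V = \<bar>jacobi_v \<alpha> \<beta> p \<theta>\<bar>"
          have "V \<le> C * G * h"
          proof -
            have "norm (jacobi_v \<alpha> \<beta> p \<theta> - jacobi_v \<alpha> \<beta> p \<phi>) \<le> C * G * norm (\<theta> - \<phi>)"
            proof (rule field_differentiable_bound[of "{\<epsilon> / n..pi - \<epsilon> / n}"])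
              fix z assume "z \<in> {\<epsilon> / n..pi - \<epsilon> / n}"
              then have z: "\<epsilon> / n \<le> z" "z \<le> pi - \<epsilon> / n" by simp_all
              then have "0 < z" "z < pi" using en(1) by linarith+
              then show "(jacobi_v \<alpha> \<beta> p has_field_derivative jacobi_d \<alpha> \<beta> p z) (at z within {\<epsilon> / n..pi - \<epsilon> / n})"
                by (rule has_field_derivative_at_within[OF jacobi_v_deriv])
              show "norm (jacobi_d \<alpha> \<beta> p z) \<le> C * G" using prof2(2)[OF z] by (simp only: real_norm_def)
            next
              show "\<theta> \<in> {\<epsilon> / n..pi - \<epsilon> / n}" using 3 by (simp only: atLeastAtMost_iff) linarith
              show "\<phi> \<in> {\<epsilon> / n..pi - \<epsilon> / n}" using \<phi>b by (simp only: atLeastAtMost_iff)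
            qed (rule convex_real_interval)
            then show ?thesis by (simp add: V_def h_def jacobi_v_def zero)
          qed
          moreover have "V \<le> C * G * (1 / n)"
            using prof2(1)[of \<theta>] 3 n by (simp add: V_def field_simps)
          moreover have "h * M = min h (1 / n)" using h n by (simp add: M_def min_def field_simps)
          ultimately have VM: "V \<le> C * G * (h * M)" by (simp add: min_def)
          have PV: "P = V * (s powr (- a) * c powr (- b))"
          proof -
            have "V = s powr a * c powr b * P"
              by (simp add: V_def jacobi_v_def jacobi_weight_def abs_mult P_def s_def c_def a_def b_def)
            then show ?thesis using pos by (simp add: powr_minus field_simps)
          qed
          have s2: "s\<^sup>2 * s powr (- a) = s powr (2 - a)"
            using pos by (simp add: powr_diff powr_minus field_simps)
          have "s\<^sup>2 * P * sk powr (a - 1) * ck powr (b + 1)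
            = V * ((s\<^sup>2 * s powr (- a)) * c powr (- b) * sk powr (a - 1) * ck powr (b + 1))"
            unfolding PV by simp
          also have "\<dots> \<le> (C * G * (h * M)) * ((s\<^sup>2 * s powr (- a)) * c powr (- b) * sk powr (a - 1) * ck powr (b + 1))"
            using VM by (intro mult_right_mono) auto
          also have "\<dots> = C * G * h * (s powr (2 - a) * c powr (- b) * sk powr (a - 1) * ck powr (b + 1) * M)"
            unfolding s2 by simp
          also have "\<dots> \<le> C * G * h * (K1 * n powr e * (s * ck + c * sk))"
          proof (intro mult_left_mono K1(2))
            have "\<bar>s - sk\<bar> \<le> h" "\<bar>c - ck\<bar> \<le> h"
              using abs_sin_diff_le[of "\<theta> / 2" "\<phi> / 2"] abs_cos_diff_le[of "\<theta> / 2" "\<phi> / 2"]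
              by (auto simp: s_def sk_def c_def ck_def h_def)
            then have "M * (n * \<bar>s - sk\<bar>) \<le> M * (n * h)" "M * (n * \<bar>c - ck\<bar>) \<le> M * (n * h)"
              using M n by (auto intro!: mult_left_mono)
            then show "M * (n * \<bar>s - sk\<bar>) \<le> 1" "M * (n * \<bar>c - ck\<bar>) \<le> 1" using M by linarith+
          qed (use n lo klo pyth M C G h in auto)
          also have "\<dots> = C * G * K1 * n powr e * (h * (s * ck + c * sk))" by simp
          also have "\<dots> \<le> C * G * K1 * n powr e * (pi / 2 * X)"
            using cos_diff_ge[OF th, of \<phi>] \<phi> C G K1(1)
            by (intro mult_left_mono) (auto simp: h_def X_def s_def c_def sk_def ck_def)
          also have "\<dots> = (pi / 2 * K1) * (C * G * n powr e * X)" by simp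
          finally show ?thesis
          proof (rule widen)
            have "pi / 2 * K1 \<le> 2 * K1" using K1(1) pi_less_4 by (intro mult_right_mono) auto
            then show "pi / 2 * K1 \<le> 2 * K1 + K2 + K3" using K2 K3 by linarith
          qed
        qed
      qed
    qed
    define D where "D = \<bar>poly (pderiv p) (cos \<phi>)\<bar>"
    define R where "R = sk powr (a - 1) * ck powr (b + 1)"
    have R: "R > 0" using k by (simp add: R_def)
    have sk2: "sk powr (a + 1) = sk powr (a - 1) * sk\<^sup>2"
      using k by (simp add: powr_diff powr_add field_simps power2_eq_square)
    \<comment> \<open>\<open>sin \<phi> = 2 * sk * ck\<close> raises both exponents by one;
      splitting off \<open>sk\<^sup>2\<close>, which is half of \<open>1 - cos \<phi>\<close>,
      leaves the factor \<open>R\<close> of \<open>key\<close>.\<close>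
    have "\<bar>jacobi_w \<alpha> \<beta> p \<phi>\<bar> = sk powr a * ck powr b * (D * (2 * sk * ck))"
      unfolding jacobi_w_def half_angle(1)[of \<phi>] using k
      by (simp add: jacobi_weight_def abs_mult D_def sk_def ck_def a_def b_def)
    also have "\<dots> = 2 * (sk powr (a + 1) * ck powr (b + 1)) * D"
      using k by (simp add: powr_add)
    also have "\<dots> = 2 * (R * sk\<^sup>2) * D" unfolding sk2 R_def by simp
    finally have GD: "G \<le> C * (2 * (R * sk\<^sup>2) * D)" using prof3(3) by simp
    have "R * (s\<^sup>2 * P) \<le> K0 * n powr e * G * X" using key by (simp add: R_def mult_ac)
    also have "\<dots> \<le> K0 * n powr e * (C * (2 * (R * sk\<^sup>2) * D)) * X"
      using GD K0 ne X by (intro mult_left_mono mult_right_mono) auto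
    also have "\<dots> = R * (2 * C * K0 * n powr e * (sk\<^sup>2 * D * X))" by simp
    finally have "s\<^sup>2 * P \<le> 2 * C * K0 * n powr e * (sk\<^sup>2 * D * X)" using R by simp
    then show ?thesis
      unfolding cos_half_sq(1)[of \<theta>] cos_half_sq(1)[of \<phi>]
      by (simp add: s_def sk_def P_def D_def X_def n_def mult_ac)
  qed
  show ?thesis by (rule that[of "2 * C * K0"]) (use C K0 main in auto)
qed

text \<open>This is the node 1, whose basis polynomial is \<open>p\<close> divided by its value
  there. The profile bounds \<open>G\<close> by that value; an excess can come from the size of
  \<open>p\<close> at -1, with exponent \<beta> - \<alpha>, or in the bulk.\<close>

lemma jacobi_sup_estimate:
  fixes \<alpha> \<beta> \<epsilon> C e :: real
  assumes \<epsilon>: "0 < \<epsilon>" "\<epsilon> \<le> 1/4" and C: "C > 0"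
    and e: "e \<ge> 0" "e \<ge> - 1/2 - \<alpha>" "e \<ge> \<beta> - \<alpha>"
  obtains K where "K > 0" "\<And>m p G \<theta>. jacobi_profile \<alpha> \<beta> m p \<epsilon> C G \<Longrightarrow> G > 0 \<Longrightarrow>
     \<theta> \<in> {0..pi} \<Longrightarrow> \<bar>poly p (cos \<theta>)\<bar> \<le> K * real (Suc m) powr e * \<bar>poly p 1\<bar>"
proof -
  define a b where "a = \<alpha> + 1/2" and "b = \<beta> + 1/2"
  define \<delta> where "\<delta> = \<epsilon> / pi"
  have \<delta>: "0 < \<delta>" using \<epsilon> by (simp add: \<delta>_def)
  have e': "e \<ge> 0" "e \<ge> - a" "e \<ge> b - a" using e by (auto simp: a_def b_def)
  define K3 where "K3 = 2 powr \<bar>- a\<bar> * (1 + \<delta> powr (- b)) + 2 powr \<bar>- b\<bar> * (1 + \<delta> powr (- a))"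
  have K3: "K3 > 0" using \<delta> by (auto simp: K3_def intro!: add_pos_nonneg mult_pos_pos add_pos_pos)
  have main: "\<bar>poly p (cos \<theta>)\<bar> \<le> (C * C * (K3 + 1)) * real (Suc m) powr e * \<bar>poly p 1\<bar>"
    if prof: "jacobi_profile \<alpha> \<beta> m p \<epsilon> C G" and G: "G > 0" and \<theta>: "\<theta> \<in> {0..pi}" for m p G \<theta>
  proof -
    define n where "n = real (Suc m)"
    have n: "n \<ge> 1" by (simp add: n_def)
    have en: "0 < \<epsilon> / n" "\<epsilon> / n \<le> 1/4" using \<epsilon> n by (auto simp: divide_le_eq)
    define Q where "Q = \<bar>poly p 1\<bar>"
    define P where "P = \<bar>poly p (cos \<theta>)\<bar>"
    have P: "P \<ge> 0" by (simp add: P_def)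
    have GQ: "G \<le> C * (n powr (1 - a) * Q)"
      using prof unfolding jacobi_profile_def n_def[symmetric] Q_def by (auto simp: a_def)
    have "P \<le> (K3 + 1) * (C * G * n powr (e + a - 1))"
    proof -
      have pow: "x \<le> (K3 + 1) * (C * G * n powr (e + a - 1))"
        if "x \<le> C * G * (L * n powr (e + a - 1))" "L \<le> K3 + 1" for x L
      proof -
        have "C * G * (L * n powr (e + a - 1)) = L * (C * G * n powr (e + a - 1))" by simp
        also have "\<dots> \<le> (K3 + 1) * (C * G * n powr (e + a - 1))"
          using that(2) C G by (intro mult_right_mono) auto
        finally show ?thesis using that(1) by simp
      qed
      consider "\<theta> \<le> \<epsilon> / n" | "\<theta> \<ge> pi - \<epsilon> / n" | "\<epsilon> / n < \<theta>" "\<theta> < pi - \<epsilon> / n" by linarith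
      then show ?thesis
      proof cases
        case 1
        then have "n powr (1 - a) * P \<le> C * G"
          using prof \<theta> unfolding jacobi_profile_def n_def[symmetric] P_def by (auto simp: a_def)
        then have "n powr (a - 1) * (n powr (1 - a) * P) \<le> n powr (a - 1) * (C * G)"
          by (intro mult_left_mono) auto
        then have "P \<le> n powr (a - 1) * (C * G)" using n by (simp flip: powr_add mult.assoc)
        also have "\<dots> \<le> n powr (e + a - 1) * (C * G)"
          using C G n e' by (intro mult_right_mono powr_mono) auto
        finally show ?thesis by (intro pow[of _ 1]) (use K3 in \<open>auto simp: mult_ac\<close>)
      next
        case 2
        then have "n powr (1 - b) * P \<le> C * G"
          using prof \<theta> unfolding jacobi_profile_def n_def[symmetric] P_def by (auto simp: b_def)
        then have "n powr (b - 1) * (n powr (1 - b) * P) \<le> n powr (b - 1) * (C * G)"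
          by (intro mult_left_mono) auto
        then have "P \<le> n powr (b - 1) * (C * G)" using n by (simp flip: powr_add mult.assoc)
        also have "\<dots> \<le> n powr (e + a - 1) * (C * G)"
          using C G n e' by (intro mult_right_mono powr_mono) auto
        finally show ?thesis by (intro pow[of _ 1]) (use K3 in \<open>auto simp: mult_ac\<close>)
      next
        case 3
        define s c where "s = sin (\<theta> / 2)" and "c = cos (\<theta> / 2)"
        have th: "0 < \<theta>" "\<theta> < pi" using 3 en by linarith+
        have pos: "s > 0" "c > 0" using half_angle_pos[OF th] by (auto simp: s_def c_def)
        have lo: "\<delta> / n \<le> s" "\<delta> / n \<le> c"
          unfolding \<delta>_def s_def c_def by (rule half_angle_scale[OF \<epsilon>(1) n]; use 3 in simp)+
        define V where "V = \<bar>jacobi_v \<alpha> \<beta> p \<theta>\<bar>"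
        have "n * V \<le> C * G"
          using prof 3 unfolding jacobi_profile_def n_def[symmetric] V_def by auto
        then have V: "V \<le> C * G * n powr (- 1)" using n by (simp add: powr_minus_divide field_simps)
        have PV: "P = V * (s powr (- a) * c powr (- b))"
        proof -
          have "V = s powr a * c powr b * P"
            by (simp add: V_def jacobi_v_def jacobi_weight_def abs_mult P_def s_def c_def a_def b_def)
          then show ?thesis using pos by (simp add: powr_minus field_simps)
        qed
        have "P \<le> C * G * n powr (- 1) * (s powr (- a) * c powr (- b))"
          unfolding PV using V by (intro mult_right_mono) auto
        also have "\<dots> = C * G * (n powr (- 1) * (s powr (- a) * c powr (- b)))" by simp
        \<comment> \<open>For the exponent \<open>e + a - 1\<close> the conditions of
          \<open>two_sided_bound\<close> are \<open>e \<ge> - a\<close>, \<open>e \<ge> 0\<close>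
          and \<open>e \<ge> b - a\<close>.\<close>
        also have "\<dots> \<le> C * G * (K3 * n powr (e + a - 1))"
          unfolding K3_def using C G n lo \<delta> e'
          by (intro mult_left_mono two_sided_bound) (auto simp: s_def c_def)
        finally show ?thesis by (intro pow[of _ K3]) auto
      qed
    qed
    also have "\<dots> = (K3 + 1) * C * n powr (e + a - 1) * G" by simp
    also have "\<dots> \<le> (K3 + 1) * C * n powr (e + a - 1) * (C * (n powr (1 - a) * Q))"
      using GQ K3 C by (intro mult_left_mono) auto
    also have "\<dots> = (C * C * (K3 + 1)) * (n powr (e + a - 1) * n powr (1 - a)) * Q" by simp
    also have "n powr (e + a - 1) * n powr (1 - a) = n powr e" by (simp flip: powr_add)
    finally show ?thesis by (simp add: P_def Q_def n_def)
  qed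
  show ?thesis by (rule that[of "C * C * (K3 + 1)"]) (use C K3 main in auto)
qed

section \<open>The Lagrange basis\<close>

text \<open>By \<open>jacobi_ode_ge_1\<close> there is no zero at or beyond 1; reflection settles
  the other end.\<close>

lemma jacobi_zero_range:
  assumes \<alpha>: "\<alpha> > -1" and \<beta>: "\<beta> > -1" and ode: "jacobi_ode \<alpha> \<beta> m p" and "p \<noteq> 0" "poly p t = 0"
  shows "-1 < t" "t < 1"
proof -
  show "t < 1"
    using jacobi_ode_at_1[OF \<alpha> \<beta> ode \<open>p \<noteq> 0\<close>] jacobi_ode_ge_1[OF \<alpha> \<beta> ode, of t] assms(5) by fastforce
  define q where "q = pcompose p [:0, -1:]"
  have q: "jacobi_ode \<beta> \<alpha> m q" unfolding q_def by (rule jacobi_ode_reflect[OF ode])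
  have poly_q: "poly q u = poly p (- u)" for u by (simp add: q_def poly_pcompose)
  have "q \<noteq> 0" using \<open>p \<noteq> 0\<close> poly_q by (metis add.inverse_inverse poly_0 poly_all_0_iff_0)
  then show "-1 < t"
    using jacobi_ode_at_1[OF \<beta> \<alpha> q] jacobi_ode_ge_1[OF \<beta> \<alpha> q, of "- t"] assms(5) poly_q[of "- t"] by fastforce
qed

text \<open>The difference of the two sides has degree below \<open>n\<close> but vanishes at all
  \<open>n\<close> nodes.\<close>

lemma poly_eq_smult_nodal:
  assumes "bij_betw x {..<n} {t. poly Q t = 0}" "degree Q = n" "Q \<noteq> 0"
  shows "Q = smult (lead_coeff Q) (nodal_poly n x)"
proof (rule ccontr)
  define d where "d = Q - smult (lead_coeff Q) (nodal_poly n x)"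
  assume "Q \<noteq> smult (lead_coeff Q) (nodal_poly n x)"
  then have "d \<noteq> 0" by (simp add: d_def)
  have deg: "degree (nodal_poly n x) = n"
    unfolding nodal_poly_def by (subst degree_prod_eq_sum_degree) auto
  have monic: "lead_coeff (nodal_poly n x) = 1"
    unfolding nodal_poly_def by (simp add: lead_coeff_prod)
  have "degree d \<le> n"
    unfolding d_def using assms(2) deg by (intro degree_diff_le) (auto intro: order_trans[OF degree_smult_le])
  moreover have "coeff d n = 0"
    using monic assms(2) deg by (simp add: d_def)
  ultimately have "degree d < n" using \<open>d \<noteq> 0\<close>
    by (metis leading_coeff_0_iff le_neq_implies_less)
  moreover have "{t. poly Q t = 0} \<subseteq> {t. poly d t = 0}"
  proof
    fix t assume t: "t \<in> {t. poly Q t = 0}"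
    then obtain i where "i < n" "t = x i"
      using assms(1) by (auto simp: bij_betw_def)
    then have "poly (nodal_poly n x) t = 0"
      by (auto simp: nodal_poly_def poly_prod intro!: prod_zero)
    then show "t \<in> {t. poly d t = 0}" using t by (simp add: d_def)
  qed
  then have "card {t. poly Q t = 0} \<le> card {t. poly d t = 0}"
    by (intro card_mono poly_roots_finite \<open>d \<noteq> 0\<close>)
  moreover have "card {t. poly d t = 0} \<le> degree d" by (rule card_poly_roots_bound[OF \<open>d \<noteq> 0\<close>])
  moreover have "card {t. poly Q t = 0} = n" using bij_betw_same_card[OF assms(1)] by simp
  ultimately show False by simp
qed

text \<open>At \<open>t = x k\<close> the estimate in the hypothesis is void, but there the basis polynomial equals 1.\<close>

lemma lagrange_basis_le:
  assumes bij: "bij_betw x {..<n} {t. poly Q t = 0}" and "degree Q = n" "Q \<noteq> 0" and k: "k < n"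
    and B: "B \<ge> 1" and est: "\<bar>poly Q t\<bar> \<le> B * (\<bar>poly (pderiv Q) (x k)\<bar> * \<bar>t - x k\<bar>)"
  shows "\<bar>poly (lagrange_basis n x k) t\<bar> \<le> B"
proof -
  define c where "c = lead_coeff Q"
  have c: "c \<noteq> 0" using \<open>Q \<noteq> 0\<close> by (simp add: c_def)
  define S where "S = (\<Prod>i\<in>{..<n} - {k}. [:- x i, 1:])"
  have nodal: "nodal_poly n x = [:- x k, 1:] * S"
    unfolding nodal_poly_def S_def using k by (simp add: prod.remove)
  have Q: "Q = smult c (nodal_poly n x)"
    unfolding c_def by (rule poly_eq_smult_nodal[OF bij assms(2,3)])
  have S_k: "poly (pderiv (nodal_poly n x)) (x k) = poly S (x k)"
    by (simp only: nodal pderiv_mult) (simp add: pderiv_pCons)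
  have "inj_on x {..<n}" using bij by (simp add: bij_betw_def)
  then have S0: "poly S (x k) \<noteq> 0"
    using k by (auto simp: S_def poly_prod dest: inj_onD)
  have basis: "poly (lagrange_basis n x k) t = poly S t / poly S (x k)"
  proof -
    have "nodal_poly n x div [:- x k, 1:] = S"
      unfolding nodal by (rule nonzero_mult_div_cancel_left) simp
    then show ?thesis by (simp add: lagrange_basis_def S_k)
  qed
  show ?thesis
  proof (cases "t = x k")
    case True
    then show ?thesis using basis S0 B by simp
  next
    case False
    have "poly Q t = c * ((t - x k) * poly S t)" by (subst Q) (simp add: nodal algebra_simps)
    moreover have "poly (pderiv Q) (x k) = c * poly S (x k)"
      by (subst Q) (simp add: pderiv_smult S_k)
    ultimately have "\<bar>c\<bar> * \<bar>t - x k\<bar> * \<bar>poly S t\<bar> \<le> \<bar>c\<bar> * \<bar>t - x k\<bar> * (B * \<bar>poly S (x k)\<bar>)"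
      using est by (simp add: abs_mult mult_ac)
    then have "\<bar>poly S t\<bar> \<le> B * \<bar>poly S (x k)\<bar>"
      using c False by (simp add: mult_le_cancel_left_pos)
    then show ?thesis
      unfolding basis abs_divide using S0 by (simp add: divide_le_eq)
  qed
qed

lemma sup_norm_bounds:
  assumes "\<And>t. t \<in> {-1..1} \<Longrightarrow> \<bar>poly p t\<bar> \<le> B"
  shows "0 \<le> sup_norm p" "sup_norm p \<le> B"
proof -
  have "bdd_above ((\<lambda>t. \<bar>poly p t\<bar>) ` {-1..1})" using assms by (intro bdd_aboveI2[of _ _ B]) auto
  then have "\<bar>poly p 0\<bar> \<le> sup_norm p" unfolding sup_norm_def by (intro cSUP_upper) auto
  then show "0 \<le> sup_norm p" by linarith
  show "sup_norm p \<le> B" unfolding sup_norm_def using assms by (intro cSUP_least) auto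
qed

text \<open>The derivative of \<open>(1 - t) * p\<close> is \<open>- poly p 1\<close> at 1 and
  \<open>(1 - z) * poly (pderiv p) z\<close> at a zero \<open>z\<close> of \<open>p\<close>. These
  values occur in \<open>jacobi_sup_estimate\<close> and \<open>jacobi_node_estimate\<close>, so
  \<open>lagrange_basis_le\<close> covers both kinds of nodes.\<close>

lemma radau_lagrange_bigo:
  fixes \<alpha> \<beta> e :: real and x :: "nat \<Rightarrow> nat \<Rightarrow> real"
  assumes \<alpha>: "\<alpha> > -1" and \<beta>: "\<beta> > -1"
    and radau: "\<And>n. n \<ge> 1 \<Longrightarrow> radau_points \<alpha> \<beta> n (x n)"
    and e: "e \<ge> 0" "e \<ge> - 1/2 - \<alpha>" "e \<ge> \<alpha> - 5/2" "e \<ge> \<beta> - 1/2" "e \<ge> \<beta> - \<alpha>"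
  shows "(\<lambda>n. MAX j\<in>{..<n}. sup_norm (lagrange_basis n (x n) j)) \<in> O(\<lambda>n. real n powr e)"
proof -
  obtain \<epsilon> C where \<epsilon>: "0 < \<epsilon>" "\<epsilon> \<le> 1/4" and C: "C > 0" and
    prof: "\<And>m p. jacobi_ode \<alpha> \<beta> m p \<Longrightarrow> p \<noteq> 0 \<Longrightarrow> \<exists>G>0. jacobi_profile \<alpha> \<beta> m p \<epsilon> C G"
    using jacobi_profile_exists[OF \<alpha> \<beta>] by metis
  obtain K1 where K1: "K1 > 0" "\<And>m p G \<theta> \<phi>. jacobi_ode \<alpha> \<beta> m p \<Longrightarrow> jacobi_profile \<alpha> \<beta> m p \<epsilon> C G \<Longrightarrow> G > 0 \<Longrightarrow>
     \<theta> \<in> {0..pi} \<Longrightarrow> \<phi> \<in> {0<..<pi} \<Longrightarrow> poly p (cos \<phi>) = 0 \<Longrightarrow>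
     (1 - cos \<theta>) * \<bar>poly p (cos \<theta>)\<bar>
       \<le> K1 * real (Suc m) powr e * ((1 - cos \<phi>) * \<bar>poly (pderiv p) (cos \<phi>)\<bar> * \<bar>cos \<theta> - cos \<phi>\<bar>)"
    using jacobi_node_estimate[OF \<beta> \<epsilon> C e] by metis
  obtain K2 where K2: "K2 > 0" "\<And>m p G \<theta>. jacobi_profile \<alpha> \<beta> m p \<epsilon> C G \<Longrightarrow> G > 0 \<Longrightarrow>
     \<theta> \<in> {0..pi} \<Longrightarrow> \<bar>poly p (cos \<theta>)\<bar> \<le> K2 * real (Suc m) powr e * \<bar>poly p 1\<bar>"
    using jacobi_sup_estimate[OF \<epsilon> C e(1,2,5)] by metis
  define K where "K = 1 + K1 + K2"
  have "\<bar>MAX j\<in>{..<n}. sup_norm (lagrange_basis n (x n) j)\<bar> \<le> K * real n powr e" if n: "n \<ge> 1" for n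
  proof -
    define m where "m = n - 1"
    have nm: "n = Suc m" using n by (simp add: m_def)
    define p where "p = jacobi_poly \<alpha> \<beta> m"
    have p: "jacobi_ode \<alpha> \<beta> m p" "p \<noteq> 0" "degree p = m"
      unfolding p_def by (rule jacobi_poly_ode[OF \<alpha> \<beta>])+
    obtain G where G: "G > 0" "jacobi_profile \<alpha> \<beta> m p \<epsilon> C G" using prof[OF p(1,2)] by blast
    define Q where "Q = [:1, -1:] * p"
    have Q: "Q \<noteq> 0" "degree Q = n"
      unfolding Q_def using degree_mult_eq[of "[:1, -1:]" p] p nm by (auto simp del: mult_pCons_left)
    have poly_Q: "poly Q t = (1 - t) * poly p t" for t by (simp add: Q_def algebra_simps)
    have poly_Q': "poly (pderiv Q) t = (1 - t) * poly (pderiv p) t - poly p t" for t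
      unfolding Q_def pderiv_mult by (simp add: pderiv_pCons algebra_simps)
    have bij: "bij_betw (x n) {..<n} {t. poly Q t = 0}"
      using radau[OF n] unfolding radau_points_def by (simp add: poly_Q p_def m_def)
    define B where "B = K * real n powr e"
    have n1: "real n powr e \<ge> 1" using n e by (simp add: ge_one_powr_ge_zero)
    have KB: "K1 * real n powr e \<le> B" "K2 * real n powr e \<le> B"
      unfolding B_def K_def using K1(1) K2(1) by (intro mult_right_mono; simp)+
    have "1 * 1 \<le> B" unfolding B_def K_def using K1(1) K2(1) n1 by (intro mult_mono) auto
    then have B1: "B \<ge> 1" by simp
    have bound: "\<bar>poly (lagrange_basis n (x n) k) t\<bar> \<le> B" if k: "k < n" and t: "t \<in> {-1..1}" for k t
    proof (rule lagrange_basis_le[OF bij Q(2,1) k B1])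
      define z where "z = x n k"
      define \<theta> where "\<theta> = arccos t"
      have \<theta>: "\<theta> \<in> {0..pi}" "cos \<theta> = t" using t by (auto simp: \<theta>_def arccos_lbound arccos_ubound)
      have "poly Q z = 0" using bij k by (auto simp: z_def bij_betw_def)
      then consider "z = 1" | "z \<noteq> 1" "poly p z = 0" by (auto simp: poly_Q)
      then show "\<bar>poly Q t\<bar> \<le> B * (\<bar>poly (pderiv Q) (x n k)\<bar> * \<bar>t - x n k\<bar>)"
        unfolding z_def[symmetric]
      proof cases
        case 1
        have "\<bar>poly p t\<bar> \<le> K2 * real n powr e * \<bar>poly p 1\<bar>"
          using K2(2)[OF G(2,1) \<theta>(1)] by (simp only: \<theta>(2) nm)
        also have "\<dots> \<le> B * \<bar>poly p 1\<bar>" using KB by (intro mult_right_mono) auto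
        finally have "(1 - t) * \<bar>poly p t\<bar> \<le> (1 - t) * (B * \<bar>poly p 1\<bar>)"
          using t by (intro mult_left_mono) auto
        then show "\<bar>poly Q t\<bar> \<le> B * (\<bar>poly (pderiv Q) z\<bar> * \<bar>t - z\<bar>)"
          using t 1 by (simp add: poly_Q poly_Q' abs_mult mult_ac)
      next
        case 2
        have z: "-1 < z" "z < 1" using jacobi_zero_range[OF \<alpha> \<beta> p(1,2) 2(2)] by auto
        define \<phi> where "\<phi> = arccos z"
        have \<phi>: "\<phi> \<in> {0<..<pi}" "cos \<phi> = z" using z arccos_lt_bounded[of z] by (auto simp: \<phi>_def)
        have "(1 - t) * \<bar>poly p t\<bar> \<le> K1 * real n powr e * ((1 - z) * \<bar>poly (pderiv p) z\<bar> * \<bar>t - z\<bar>)"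
          using K1(2)[OF p(1) G(2,1) \<theta>(1) \<phi>(1)] 2(2) by (simp only: \<theta>(2) \<phi>(2) nm)
        also have "\<dots> \<le> B * ((1 - z) * \<bar>poly (pderiv p) z\<bar> * \<bar>t - z\<bar>)"
          using KB z by (intro mult_right_mono) auto
        finally show "\<bar>poly Q t\<bar> \<le> B * (\<bar>poly (pderiv Q) z\<bar> * \<bar>t - z\<bar>)"
          using t z 2 by (simp add: poly_Q poly_Q' abs_mult)
      qed
    qed
    define M where "M = (\<lambda>j. sup_norm (lagrange_basis n (x n) j)) ` {..<n}"
    \<comment> \<open>The maximum is attained, so the bound uniform in the index applies to it;
      \<open>n \<ge> 1\<close> makes the index set nonempty.\<close>
    have "finite M" "M \<noteq> {}" using n by (auto simp: M_def lessThan_empty_iff)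
    then have "Max M \<in> M" by (rule Max_in)
    then obtain j where "j < n" "Max M = sup_norm (lagrange_basis n (x n) j)" by (auto simp: M_def)
    then have "0 \<le> Max M" "Max M \<le> B" using sup_norm_bounds[OF bound] by auto
    then show ?thesis by (simp add: M_def B_def)
  qed
  then show ?thesis
    by (intro bigoI[of _ K] eventually_sequentiallyI[of 1]) auto
qed

theorem mainTheorem8:
  fixes \<alpha> \<beta> :: real and x :: "nat \<Rightarrow> nat \<Rightarrow> real"
  assumes "\<alpha> > -1" and "\<beta> > -1"
    and "\<And>n. n \<ge> 1 \<Longrightarrow> radau_points \<alpha> \<beta> n (x n)"
  shows "(\<alpha> \<le> 1/2 \<longrightarrow>
            (\<lambda>n. MAX j\<in>{..<n}. sup_norm (lagrange_basis n (x n) j))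
              \<in> O(\<lambda>n. real n powr (- Min {0, \<alpha> + 1/2, \<alpha> - \<beta>}))) \<and>
         (\<alpha> > 1/2 \<longrightarrow>
            (\<lambda>n. MAX j\<in>{..<n}. sup_norm (lagrange_basis n (x n) j))
              \<in> O(\<lambda>n. real n powr (- Min {0, 1/2 - \<beta>, 5/2 - \<alpha>, \<alpha> - \<beta>})))"
proof (intro conjI impI)
  \<comment> \<open>The two exponents missing from this case are covered: \<beta> - 1/2 is at most
    \<beta> - \<alpha>, and \<alpha> - 5/2 is negative.\<close>
  assume "\<alpha> \<le> 1/2"
  moreover have "Min {0, \<alpha> + 1/2, \<alpha> - \<beta>} \<le> 0" "Min {0, \<alpha> + 1/2, \<alpha> - \<beta>} \<le> \<alpha> + 1/2"
    "Min {0, \<alpha> + 1/2, \<alpha> - \<beta>} \<le> \<alpha> - \<beta>" by (rule Min_le; simp)+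
  ultimately show "(\<lambda>n. MAX j\<in>{..<n}. sup_norm (lagrange_basis n (x n) j))
      \<in> O(\<lambda>n. real n powr (- Min {0, \<alpha> + 1/2, \<alpha> - \<beta>}))"
    by (intro radau_lagrange_bigo[OF assms(1,2)] assms(3)) (assumption | linarith)+
next
  \<comment> \<open>Here the missing exponent -1/2 - \<alpha> is negative.\<close>
  assume "\<alpha> > 1/2"
  moreover have "Min {0, 1/2 - \<beta>, 5/2 - \<alpha>, \<alpha> - \<beta>} \<le> 0" "Min {0, 1/2 - \<beta>, 5/2 - \<alpha>, \<alpha> - \<beta>} \<le> 1/2 - \<beta>"
    "Min {0, 1/2 - \<beta>, 5/2 - \<alpha>, \<alpha> - \<beta>} \<le> 5/2 - \<alpha>" "Min {0, 1/2 - \<beta>, 5/2 - \<alpha>, \<alpha> - \<beta>} \<le> \<alpha> - \<beta>"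
    by (rule Min_le; simp)+
  ultimately show "(\<lambda>n. MAX j\<in>{..<n}. sup_norm (lagrange_basis n (x n) j))
      \<in> O(\<lambda>n. real n powr (- Min {0, 1/2 - \<beta>, 5/2 - \<alpha>, \<alpha> - \<beta>}))"
    by (intro radau_lagrange_bigo[OF assms(1,2)] assms(3)) (assumption | linarith)+
qed

end
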